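(* A language $L\subseteq T^*$ over a finite alphabet $T$ is multiple context-free (i.e. $L=L(G)$ for some multiple context-free grammar $G$ with terminal alphabet $T$) if and only if $L=L(G')$ for some linear logic grammar $G'$ whose lexicon is $\otimes$-free (no formula occurring in a sequent of the lexicon contains the connective $\otimes$).
   Context: Multiple context-free grammars (MCFG). An MCFG is a tuple $G=(N,T,S,P)$ where $N$ is a finite alphabet of predicate symbols (nonterminals) of nonzero arities, $T$ a finite alphabet of terminals, $S\in N$ unary, and $P$ a finite set of productions $B_1(x^1_1,\dots,x^1_{k_1}),\dots,B_n(x^n_1,\dots,x^n_{k_n})\vdash A(s_1,\dots,s_k)$ with $n\ge 0$, $A,B_j\in N$ of arities $k,k_j$, the $x^j_i$ pairwise distinct variables not in $T$, $s_1,\dots,s_k$ words over $T$ and the variables, and every variable $x^j_i$ occurring exactly once in exactly one of $s_1,\dots,s_k$. Derivable formulas: if the production above is in $P$ and $B_j(s'^j_1,\dots,s'^j_{k_j})$ are derivable (for $j=1,\dots,n$; vacuous if $n=0$), then $A(t_1,\dots,t_k)$ is derivable, where $t_m$ is obtained from $s_m$ by substituting $s'^j_i$ for $x^j_i$. $L(G)=\{w\in T^*: S(w)\text{ derivable}\}$. Cowordisms. A boundary $X$ is a natural number $|X|$ with a subset $X_l\subseteq\{1,\dots,|X|\}$ of left endpoints; $X_r$ is its complement (right endpoints). $X\otimes Y$: $|X\otimes Y|=|X|+|Y|$, $(X\otimes Y)_l=X_l\cup\{|X|+i:i\in Y_l\}$; $\mathbf 1$ is the boundary of cardinality $0$; $X^\perp$: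 $|X^\perp|=|X|$, $(X^\perp)_l=\{|X|+1-i: i\in X_r\}$. A regular multiword with boundary $X$ over $T$ is a set of edges $(i,w,j)$, $w\in T^*$, forming a perfect matching of $\{1,\dots,|X|\}$ with each edge going from a left endpoint $i$ to a right endpoint $j$. A multiword is a pair $(M_0,M_c)$ of a regular multiword and a finite multiset of cyclic words (words modulo cyclic permutation); it is regular if $M_c=\emptyset$. A cowordism $\sigma:X\to Y$ is a multiword with boundary $Y\otimes X^\perp$, vertex $|Y|+|X|+1-i$ representing vertex $i$ of $X$. Composition $\tau\circ\sigma$ of $\sigma:X\to Y,\tau:Y\to Z$: identify vertex $i$ of $\sigma$ with vertex $|Z|+|Y|+1-i$ of $\tau$ ($1\le i\le |Y|$); maximal paths between non-identified vertices become edges labelled by the concatenation of labels along the path (vertex $j\le|Z|$ of $\tau$ keeps number $j$, vertex $|Y|+j$ of $\sigma$ becomes $|Z|+j$), closed cycles contribute their cyclic words, and singular parts are added. $\mathrm{id}_X$ has edges $(i,\epsilon,2|X|+1-i)$, $i\in X_l$, and $(2|X|+1-i,\epsilon,i)$, $i\in X_r$. For $\sigma:X\to Y$, $\tau:Z\to W$, $\sigma\otimes\tau:X\otimes Z\to Y\otimes W$ has boundary $Y\otimes W\otimes Z^\perp\otimes X^\perp$: the edges of $\sigma$ with vertex $i$ renumbered $i$ if $i\le|Y|$ and $i+|W|+|Z|$ otherwise, the edges of $\tau$ shifted by $|Y|$, singular parts added. Linear logic and its interpretation. Given a set $N$ of positive literals, LL formulas are built from literals $P,P^\perp$ ($P\in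 N$) by $\otimes$ and $\wp$; negation is defined by $(P^\perp)^\perp=P$, $(A\otimes B)^\perp=A^\perp\wp B^\perp$, $(A\wp B)^\perp=A^\perp\otimes B^\perp$. Rules: $\vdash A^\perp,A$ (Id); from $\vdash\Gamma,A$ and $\vdash A^\perp,\Delta$ infer $\vdash\Gamma,\Delta$ (Cut); from $\vdash\Gamma,A,B,\Delta$ infer $\vdash\Gamma,B,A,\Delta$ (Ex); from $\vdash\Gamma,A,B$ infer $\vdash\Gamma,A\wp B$; from $\vdash\Gamma,A$ and $\vdash B,\Delta$ infer $\vdash\Gamma,A\otimes B,\Delta$. Given a boundary $[P]$ for each $P\in N$, set $[A\otimes B]=[A]\otimes[B]$, $[A^\perp]=[A]^\perp$ (so $[A\wp B]=[B]\otimes[A]$), and $[A_1,\dots,A_n]=[A_n]\otimes\dots\otimes[A_1]$. A derivation of $\vdash\Gamma$ is interpreted as a multiword with boundary $[\Gamma]$: Id as $\mathrm{id}_{[A]}$; Ex by permuting the vertex blocks of $[A]$ and $[B]$; $\wp$ does nothing; $\otimes$ as the union of the two multiwords with vertex blocks arranged as $[\Delta]\otimes[A]\otimes[B]\otimes[\Gamma]$ and singular parts added; Cut by gluing vertex $i$ of the $[A]$ block of the first premise to vertex $|[A]|+1-i$ of the $[A]^\perp$ block of the second, concatenating labels along paths and collecting closed cycles as cyclic words, as in composition. Linear logic grammars. A cowordism typing judgement $\sigma/\vdash\Gamma$ is an LL sequent $\Gamma$ with a multiword $\sigma$ over $T$ with boundary $[\Gamma]$. A linear logic grammar (LLG) is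 $G=(N,T,Lex,S)$: $N$ a finite set of positive literals each assigned a boundary, $T$ a finite alphabet, $Lex$ a finite set of cowordism typing judgements (lexicon), $S\in N$ with $[S]$ having exactly one left and one right endpoint. A judgement $\sigma/\vdash\Gamma$ is derivable in $G$ if some LL derivation of $\vdash\Gamma$ using lexicon sequents as additional initial sequents (each interpreted by its cowordism) has interpretation $\sigma$. $L(G)$ is the set of words $w$ labelling the unique edge of some regular $\sigma$ with $\sigma/\vdash S$ derivable. *)

theory Defs
  imports Main "HOL-Library.Multiset"
begin

section \<open>Multiple context-free grammars\<close>

datatype 't symbol = Term 't | Var nat

text \<open>
  \<open>Production [(B1, xs1), \<dots>, (Bn, xsn)] A [s1, \<dots>, sk]\<close> stands for
  \<open>B1(xs1), \<dots>, Bn(xsn) \<turnstile> A(s1, \<dots>, sk)\<close>, where each \<open>xsj\<close> is a list of variable names.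
\<close>

datatype ('n, 't) production =
  Production (body: "('n \<times> nat list) list") (head: 'n) (args: "'t symbol list list")

definition production_vars :: "('n, 't) production \<Rightarrow> nat list" where
  "production_vars p = concat (map snd (body p))"

record ('n, 't) mcfg =
  mcfg_nonterminals :: "'n set"
  mcfg_arity :: "'n \<Rightarrow> nat"
  mcfg_terminals :: "'t set"
  mcfg_start :: 'n
  mcfg_productions :: "('n, 't) production set"

definition wf_production :: "('n, 't) mcfg \<Rightarrow> ('n, 't) production \<Rightarrow> bool" where
  "wf_production G p \<longleftrightarrow>
     head p \<in> mcfg_nonterminals G \<and> length (args p) = mcfg_arity G (head p) \<and>
     (\<forall>(B, xs) \<in> set (body p). B \<in> mcfg_nonterminals G \<and> length xs = mcfg_arity G B) \<and>
     distinct (production_vars p) \<and>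
     (\<forall>s \<in> set (args p). set s \<subseteq> Term ` mcfg_terminals G \<union> Var ` set (production_vars p)) \<and>
     (\<forall>x \<in> set (production_vars p). count_list (concat (args p)) (Var x) = 1)"

definition wf_mcfg :: "('n, 't) mcfg \<Rightarrow> bool" where
  "wf_mcfg G \<longleftrightarrow>
     finite (mcfg_nonterminals G) \<and> (\<forall>A \<in> mcfg_nonterminals G. mcfg_arity G A \<noteq> 0) \<and>
     finite (mcfg_terminals G) \<and>
     mcfg_start G \<in> mcfg_nonterminals G \<and> mcfg_arity G (mcfg_start G) = 1 \<and>
     finite (mcfg_productions G) \<and> (\<forall>p \<in> mcfg_productions G. wf_production G p)"

fun subst_symbol :: "(nat \<Rightarrow> 't list) \<Rightarrow> 't symbol \<Rightarrow> 't list" where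
  "subst_symbol \<theta> (Term a) = [a]"
| "subst_symbol \<theta> (Var x) = \<theta> x"

definition subst_word :: "(nat \<Rightarrow> 't list) \<Rightarrow> 't symbol list \<Rightarrow> 't list" where
  "subst_word \<theta> s = concat (map (subst_symbol \<theta>) s)"

text \<open>
  The words substituted for the variables of a production are given by one assignment \<open>\<theta>\<close>;
  as the variables are pairwise distinct, every choice of tuples for the premises arises this way.
\<close>

inductive mcfg_derivable :: "('n, 't) mcfg \<Rightarrow> 'n \<Rightarrow> 't list list \<Rightarrow> bool" for G where
  "\<lbrakk>p \<in> mcfg_productions G; \<forall>(B, xs) \<in> set (body p). mcfg_derivable G B (map \<theta> xs)\<rbrakk>
    \<Longrightarrow> mcfg_derivable G (head p) (map (subst_word \<theta>) (args p))"

definition mcfg_language :: "('n, 't) mcfg \<Rightarrow> 't list set" where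
  "mcfg_language G = {w \<in> lists (mcfg_terminals G). mcfg_derivable G (mcfg_start G) [w]}"


section \<open>Boundaries\<close>

typedef boundary = "{(n :: nat, L :: nat set). L \<subseteq> {1..n}}"
  by auto

setup_lifting type_definition_boundary

lift_definition bsize :: "boundary \<Rightarrow> nat" is fst .

lift_definition lefts :: "boundary \<Rightarrow> nat set" is snd .

definition rights :: "boundary \<Rightarrow> nat set" where
  "rights X = {1..bsize X} - lefts X"

lift_definition bunit :: boundary is "(0, {})"
  by simp

lift_definition btensor :: "boundary \<Rightarrow> boundary \<Rightarrow> boundary"  (infixr "\<otimes>\<^sub>b" 70)
  is "\<lambda>(m, L) (n, K). (m + n, L \<union> {m + i | i. i \<in> K})"
  by force

lift_definition bdual :: "boundary \<Rightarrow> boundary"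
  is "\<lambda>(n, L). (n, {n + 1 - i | i. i \<in> {1..n} - L})"
  by auto

lemma lefts_subset: "lefts X \<subseteq> {1..bsize X}"
  by transfer auto

lemma boundary_eqI: "\<lbrakk>bsize X = bsize Y; \<And>i. i \<in> lefts X \<longleftrightarrow> i \<in> lefts Y\<rbrakk> \<Longrightarrow> X = Y"
  by transfer auto

lemma bsize_btensor [simp]: "bsize (X \<otimes>\<^sub>b Y) = bsize X + bsize Y"
  by transfer auto

lemma bsize_bdual [simp]: "bsize (bdual X) = bsize X"
  by transfer auto

lemma mem_lefts_btensor:
  "i \<in> lefts (X \<otimes>\<^sub>b Y) \<longleftrightarrow> i \<in> lefts X \<or> bsize X < i \<and> i - bsize X \<in> lefts Y"
  by transfer (force simp: Suc_le_eq)

lemma mem_lefts_bdual: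
  "i \<in> lefts (bdual X) \<longleftrightarrow> i \<in> {1..bsize X} \<and> bsize X + 1 - i \<notin> lefts X"
proof (transfer, clarsimp, rule iffI)
  fix n i :: nat and L :: "nat set"
  assume "Suc 0 \<le> i \<and> i \<le> n \<and> Suc n - i \<notin> L"
  then show "\<exists>j. i = Suc n - j \<and> Suc 0 \<le> j \<and> j \<le> n \<and> j \<notin> L"
    by (intro exI[of _ "Suc n - i"]) auto
qed auto

lemma bdual_bdual [simp]: "bdual (bdual X) = X"
  using lefts_subset[of X] by (intro boundary_eqI) (auto simp: mem_lefts_bdual)

lemma bdual_btensor: "bdual (X \<otimes>\<^sub>b Y) = bdual Y \<otimes>\<^sub>b bdual X"
proof (rule boundary_eqI)
  fix i
  have X: "j \<in> lefts X \<Longrightarrow> 1 \<le> j \<and> j \<le> bsize X" and Y: "j \<in> lefts Y \<Longrightarrow> 1 \<le> j \<and> j \<le> bsize Y" for j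
    using lefts_subset by force+
  consider "i \<le> bsize Y" | "bsize Y < i" by linarith
  then show "i \<in> lefts (bdual (X \<otimes>\<^sub>b Y)) \<longleftrightarrow> i \<in> lefts (bdual Y \<otimes>\<^sub>b bdual X)"
  proof cases
    case 1
    then have "bsize X + bsize Y + 1 - i - bsize X = bsize Y + 1 - i"
      "bsize X + bsize Y + 1 - i > bsize X" by auto
    then show ?thesis using 1 X[of "bsize X + bsize Y + 1 - i"]
      by (auto simp: mem_lefts_btensor mem_lefts_bdual)
  next
    case 2
    then have "bsize X + 1 - (i - bsize Y) = bsize X + bsize Y + 1 - i"
      "\<not> bsize X + bsize Y + 1 - i > bsize X" by auto
    then show ?thesis using 2
      by (auto simp: mem_lefts_btensor mem_lefts_bdual)
  qed
qed (simp)


section \<open>Multiwords\<close>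

definition cyclic_eq :: "'a list \<Rightarrow> 'a list \<Rightarrow> bool" where
  "cyclic_eq u v \<longleftrightarrow> (\<exists>n. v = rotate n u)"

lemma cyclic_eq_append: "cyclic_eq u v \<longleftrightarrow> (\<exists>x y. u = x @ y \<and> v = y @ x)"
proof
  assume "cyclic_eq u v"
  then obtain n where "v = rotate n u"
    by (auto simp: cyclic_eq_def)
  then have "u = take (n mod length u) u @ drop (n mod length u) u \<and>
             v = drop (n mod length u) u @ take (n mod length u) u"
    by (simp add: rotate_drop_take)
  then show "\<exists>x y. u = x @ y \<and> v = y @ x"
    by blast
next
  assume "\<exists>x y. u = x @ y \<and> v = y @ x"
  then show "cyclic_eq u v"
    by (metis cyclic_eq_def rotate_append)
qed

quotient_type 'a cyclic_word = "'a list" / cyclic_eq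
proof (rule equivpI)
  show "reflp (cyclic_eq :: 'a list \<Rightarrow> _)"
    by (rule reflpI) (auto simp: cyclic_eq_append)
  show "symp (cyclic_eq :: 'a list \<Rightarrow> _)"
    by (rule sympI) (auto simp: cyclic_eq_append)
  show "transp (cyclic_eq :: 'a list \<Rightarrow> _)"
    by (rule transpI) (auto simp: cyclic_eq_def rotate_rotate)
qed

lift_definition cyclic_set :: "'a cyclic_word \<Rightarrow> 'a set" is set
  by (auto simp: cyclic_eq_def)

lift_definition cyclic_concat_map :: "('a \<Rightarrow> 'b list) \<Rightarrow> 'a cyclic_word \<Rightarrow> 'b cyclic_word"
  is "\<lambda>f es. concat (map f es)"
  by (force simp: cyclic_eq_append)

type_synonym 't edge = "nat \<times> 't list \<times> nat"

abbreviation edge_source :: "'t edge \<Rightarrow> nat" where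
  "edge_source e \<equiv> fst e"

abbreviation edge_label :: "'t edge \<Rightarrow> 't list" where
  "edge_label e \<equiv> fst (snd e)"

abbreviation edge_target :: "'t edge \<Rightarrow> nat" where
  "edge_target e \<equiv> snd (snd e)"

datatype 't multiword =
  Multiword (edges: "'t edge set") (singular: "'t cyclic_word multiset")

definition regular :: "'t multiword \<Rightarrow> bool" where
  "regular \<sigma> \<longleftrightarrow> singular \<sigma> = {#}"

text \<open>\<open>E\<close> is (the edge set of) a regular multiword over \<open>T\<close> with boundary \<open>X\<close>.\<close>

definition is_regular_multiword :: "'t set \<Rightarrow> boundary \<Rightarrow> 't edge set \<Rightarrow> bool" where
  "is_regular_multiword T X E \<longleftrightarrow>
     (\<forall>(i, w, j) \<in> E. i \<in> lefts X \<and> w \<in> lists T \<and> j \<in> rights X) \<and>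
     (\<forall>v \<in> {1..bsize X}. \<exists>!e. e \<in> E \<and> (edge_source e = v \<or> edge_target e = v))"

definition is_multiword :: "'t set \<Rightarrow> boundary \<Rightarrow> 't multiword \<Rightarrow> bool" where
  "is_multiword T X \<sigma> \<longleftrightarrow>
     is_regular_multiword T X (edges \<sigma>) \<and> (\<forall>c \<in># singular \<sigma>. cyclic_set c \<subseteq> T)"

definition renumber :: "(nat \<Rightarrow> nat) \<Rightarrow> 't multiword \<Rightarrow> 't multiword" where
  "renumber f \<sigma> = Multiword ((\<lambda>(i, w, j). (f i, w, f j)) ` edges \<sigma>) (singular \<sigma>)"

definition mw_union :: "'t multiword \<Rightarrow> 't multiword \<Rightarrow> 't multiword" where
  "mw_union \<sigma> \<tau> = Multiword (edges \<sigma> \<union> edges \<tau>) (singular \<sigma> + singular \<tau>)"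

definition identity_mw :: "boundary \<Rightarrow> 't multiword" where
  "identity_mw X = Multiword
     ({(i, [], 2 * bsize X + 1 - i) | i. i \<in> lefts X} \<union>
      {(2 * bsize X + 1 - i, [], i) | i. i \<in> rights X}) {#}"

text \<open>
  Gluing along a symmetric relation \<open>R\<close> of identified vertices. A path is a nonempty list of edges,
  the target of each edge being identified with the source of the next. A closed cycle is a closed
  path without repeated edges, taken up to rotation (hence a cyclic word over edges), so that
  distinct cycles with the same label count separately.
\<close>

definition is_path :: "(nat \<times> nat) set \<Rightarrow> 't edge set \<Rightarrow> 't edge list \<Rightarrow> bool" where
  "is_path R E es \<longleftrightarrow> es \<noteq> [] \<and> set es \<subseteq> E \<and>
     successively (\<lambda>e e'. (edge_target e, edge_source e') \<in> R) es"

definition path_label :: "'t edge list \<Rightarrow> 't list" where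
  "path_label es = concat (map edge_label es)"

definition glued_edges :: "(nat \<times> nat) set \<Rightarrow> 't edge set \<Rightarrow> 't edge set" where
  "glued_edges R E =
     {(edge_source (hd es), path_label es, edge_target (last es)) | es.
        is_path R E es \<and> edge_source (hd es) \<notin> Field R \<and> edge_target (last es) \<notin> Field R}"

definition closed_cycles :: "(nat \<times> nat) set \<Rightarrow> 't edge set \<Rightarrow> 't edge cyclic_word set" where
  "closed_cycles R E =
     abs_cyclic_word ` {es. is_path R E es \<and> distinct es \<and>
                            (edge_target (last es), edge_source (hd es)) \<in> R}"

definition glue :: "(nat \<times> nat) set \<Rightarrow> 't multiword \<Rightarrow> 't multiword" where
  "glue R \<sigma> = Multiword (glued_edges R (edges \<sigma>))
     (singular \<sigma> + image_mset (cyclic_concat_map edge_label) (mset_set (closed_cycles R (edges \<sigma>))))"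


section \<open>Linear logic and its interpretation\<close>

datatype 'n formula =
    Pos 'n
  | Neg 'n
  | Tensor "'n formula" "'n formula"
  | Par "'n formula" "'n formula"

primrec neg :: "'n formula \<Rightarrow> 'n formula" where
  "neg (Pos P) = Neg P"
| "neg (Neg P) = Pos P"
| "neg (Tensor A B) = Par (neg A) (neg B)"
| "neg (Par A B) = Tensor (neg A) (neg B)"

primrec tensor_free :: "'n formula \<Rightarrow> bool" where
  "tensor_free (Pos P) \<longleftrightarrow> True"
| "tensor_free (Neg P) \<longleftrightarrow> True"
| "tensor_free (Tensor A B) \<longleftrightarrow> False"
| "tensor_free (Par A B) \<longleftrightarrow> tensor_free A \<and> tensor_free B"

primrec formula_boundary :: "('n \<Rightarrow> boundary) \<Rightarrow> 'n formula \<Rightarrow> boundary" where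
  "formula_boundary b (Pos P) = b P"
| "formula_boundary b (Neg P) = bdual (b P)"
| "formula_boundary b (Tensor A B) = formula_boundary b A \<otimes>\<^sub>b formula_boundary b B"
| "formula_boundary b (Par A B) = formula_boundary b B \<otimes>\<^sub>b formula_boundary b A"

lemma formula_boundary_neg: "formula_boundary b (neg A) = bdual (formula_boundary b A)"
  by (induction A) (simp_all add: bdual_btensor)

primrec sequent_boundary :: "('n \<Rightarrow> boundary) \<Rightarrow> 'n formula list \<Rightarrow> boundary" where
  "sequent_boundary b [] = bunit"
| "sequent_boundary b (A # \<Gamma>) = sequent_boundary b \<Gamma> \<otimes>\<^sub>b formula_boundary b A"

text \<open>
  The multiword operations interpreting the rules. Here \<open>a\<close>, \<open>b\<close>, \<open>d\<close> are the sizes of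
  the boundaries of \<open>A\<close>, \<open>B\<close>, \<open>\<Delta>\<close>; recall that sequents are read from right to left, e.g.
  the premise \<open>\<turnstile> \<Gamma>, A\<close> has the boundary \<open>[A] \<otimes> [\<Gamma>]\<close>.

  Exchange: from \<open>[\<Delta>] \<otimes> [B] \<otimes> [A] \<otimes> [\<Gamma>]\<close> to \<open>[\<Delta>] \<otimes> [A] \<otimes> [B] \<otimes> [\<Gamma>]\<close>.
\<close>

definition exchange_mw :: "nat \<Rightarrow> nat \<Rightarrow> nat \<Rightarrow> 't multiword \<Rightarrow> 't multiword" where
  "exchange_mw d a b = renumber (\<lambda>v.
     if v \<le> d then v else if v \<le> d + b then v + a else if v \<le> d + b + a then v - b else v)"

text \<open>Tensor: from \<open>[A] \<otimes> [\<Gamma>]\<close> and \<open>[\<Delta>] \<otimes> [B]\<close> to \<open>[\<Delta>] \<otimes> [A] \<otimes> [B] \<otimes> [\<Gamma>]\<close>.\<close>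

definition tensor_mw :: "nat \<Rightarrow> nat \<Rightarrow> nat \<Rightarrow> 't multiword \<Rightarrow> 't multiword \<Rightarrow> 't multiword" where
  "tensor_mw d a b \<sigma> \<tau> = mw_union
     (renumber (\<lambda>v. if v \<le> a then d + v else d + b + v) \<sigma>)
     (renumber (\<lambda>v. if v \<le> d then v else a + v) \<tau>)"

text \<open>
  Cut: the multiwords over \<open>[A] \<otimes> [\<Gamma>]\<close> and \<open>[\<Delta>] \<otimes> [A]\<^sup>\<bottom>\<close> are placed side by side over
  \<open>[\<Delta>] \<otimes> [A]\<^sup>\<bottom> \<otimes> [A] \<otimes> [\<Gamma>]\<close>. Vertex \<open>i\<close> of the block \<open>[A]\<close> is then number \<open>d + a + i\<close> and
  vertex \<open>a + 1 - i\<close> of the block \<open>[A]\<^sup>\<bottom>\<close> is number \<open>d + (a + 1 - i)\<close>; these are identified,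
  and the remaining vertices are renumbered consecutively.
\<close>

definition cut_pairs :: "nat \<Rightarrow> nat \<Rightarrow> (nat \<times> nat) set" where
  "cut_pairs d a = {(d + a + i, d + (a + 1 - i)) | i. i \<in> {1..a}} \<union>
                   {(d + (a + 1 - i), d + a + i) | i. i \<in> {1..a}}"

definition cut_mw :: "nat \<Rightarrow> nat \<Rightarrow> 't multiword \<Rightarrow> 't multiword \<Rightarrow> 't multiword" where
  "cut_mw d a \<sigma> \<tau> = renumber (\<lambda>v. if v \<le> d then v else v - 2 * a)
     (glue (cut_pairs d a) (mw_union (renumber (\<lambda>v. d + a + v) \<sigma>) \<tau>))"


section \<open>Linear logic grammars\<close>

type_synonym ('n, 't) judgement = "'t multiword \<times> 'n formula list"

record ('n, 't) llg =
  llg_literals :: "'n set"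
  llg_boundary :: "'n \<Rightarrow> boundary"
  llg_terminals :: "'t set"
  llg_lexicon :: "('n, 't) judgement set"
  llg_start :: 'n

abbreviation formula_size :: "('n, 't) llg \<Rightarrow> 'n formula \<Rightarrow> nat" where
  "formula_size G A \<equiv> bsize (formula_boundary (llg_boundary G) A)"

abbreviation sequent_size :: "('n, 't) llg \<Rightarrow> 'n formula list \<Rightarrow> nat" where
  "sequent_size G \<Gamma> \<equiv> bsize (sequent_boundary (llg_boundary G) \<Gamma>)"

definition is_judgement :: "('n, 't) llg \<Rightarrow> ('n, 't) judgement \<Rightarrow> bool" where
  "is_judgement G = (\<lambda>(\<sigma>, \<Gamma>).
     (\<forall>A \<in> set \<Gamma>. set_formula A \<subseteq> llg_literals G) \<and>
     is_multiword (llg_terminals G) (sequent_boundary (llg_boundary G) \<Gamma>) \<sigma>)"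

definition wf_llg :: "('n, 't) llg \<Rightarrow> bool" where
  "wf_llg G \<longleftrightarrow>
     finite (llg_literals G) \<and> finite (llg_terminals G) \<and>
     finite (llg_lexicon G) \<and> (\<forall>J \<in> llg_lexicon G. is_judgement G J) \<and>
     llg_start G \<in> llg_literals G \<and>
     card (lefts (llg_boundary G (llg_start G))) = 1 \<and>
     card (rights (llg_boundary G (llg_start G))) = 1"

text \<open>
  \<open>llg_derivable G \<sigma> \<Gamma>\<close>: some derivation of \<open>\<turnstile> \<Gamma>\<close> from the lexicon has interpretation \<open>\<sigma>\<close>.
\<close>

inductive llg_derivable :: "('n, 't) llg \<Rightarrow> 't multiword \<Rightarrow> 'n formula list \<Rightarrow> bool" for G where
  Lexicon: "(\<sigma>, \<Gamma>) \<in> llg_lexicon G \<Longrightarrow> llg_derivable G \<sigma> \<Gamma>"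
| Id: "set_formula A \<subseteq> llg_literals G \<Longrightarrow>
    llg_derivable G (identity_mw (formula_boundary (llg_boundary G) A)) [neg A, A]"
| Cut: "\<lbrakk>llg_derivable G \<sigma> (\<Gamma> @ [A]); llg_derivable G \<tau> (neg A # \<Delta>)\<rbrakk> \<Longrightarrow>
    llg_derivable G (cut_mw (sequent_size G \<Delta>) (formula_size G A) \<sigma> \<tau>) (\<Gamma> @ \<Delta>)"
| Ex: "llg_derivable G \<sigma> (\<Gamma> @ [A, B] @ \<Delta>) \<Longrightarrow>
    llg_derivable G (exchange_mw (sequent_size G \<Delta>) (formula_size G A) (formula_size G B) \<sigma>)
      (\<Gamma> @ [B, A] @ \<Delta>)"
| Par: "llg_derivable G \<sigma> (\<Gamma> @ [A, B]) \<Longrightarrow> llg_derivable G \<sigma> (\<Gamma> @ [Par A B])"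
| Tensor: "\<lbrakk>llg_derivable G \<sigma> (\<Gamma> @ [A]); llg_derivable G \<tau> (B # \<Delta>)\<rbrakk> \<Longrightarrow>
    llg_derivable G (tensor_mw (sequent_size G \<Delta>) (formula_size G A) (formula_size G B) \<sigma> \<tau>)
      (\<Gamma> @ [Tensor A B] @ \<Delta>)"

definition llg_language :: "('n, 't) llg \<Rightarrow> 't list set" where
  "llg_language G = {w. \<exists>\<sigma> i j. llg_derivable G \<sigma> [Pos (llg_start G)] \<and>
     regular \<sigma> \<and> edges \<sigma> = {(i, w, j)}}"

definition tensor_free_lexicon :: "('n, 't) llg \<Rightarrow> bool" where
  "tensor_free_lexicon G \<longleftrightarrow> (\<forall>(\<sigma>, \<Gamma>) \<in> llg_lexicon G. \<forall>A \<in> set \<Gamma>. tensor_free A)"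

end

theory Submission
  imports Defs "HOL-Library.Countable"
begin

text \<open>
  Vertices of multiwords are treated as names: gluing two multiwords amounts to letting them share
  vertices and then hiding the shared ones, so that the hidden vertices can be eliminated in any
  order. Formulas are interpreted by sets of multiwords: a tensor consists of disjoint unions, and a
  par consists of the multiwords that turn every element of the dual of one component into an element
  of the other. For any choice of the literals' sets, all rules of linear logic, including Cut,
  preserve the property that plugging elements of the duals into all formulas of a sequent but one
  yields an element of the remaining one. This replaces cut elimination.

  A production \<open>B1(xs1), \<dots>, Bn(xsn) \<turnstile> A(s1, \<dots>, sk)\<close> of an MCFG becomes a lexical entry for
  \<open>\<turnstile> B1\<^sup>\<bottom>, \<dots>, Bn\<^sup>\<bottom>, A\<close>. For soundness, the sets of the positive literals are the derivable tuples
  and those of the negative literals are empty. Conversely, par is invertible, hence a tensor-free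
  lexicon may be taken to consist of sequents of literals. For each such entry and each choice of one
  of its literals there are productions that plug the other literals; the nonterminals are pairs of a
  literal and a perfect matching of its boundary, and the components of a tuple are the labels of the
  matching's edges. Plugging is performed symbolically, with variables as edge labels; every label is
  used exactly once because a plugging without cycles is a sequence of contractions of single vertices.
\<close>


section \<open>Labelled graphs and the elimination of their inner vertices\<close>

section \<open>Paths through internal vertices\<close>

text \<open>Only regular multiwords contribute to the language of a linear logic grammar. Singular
  parts are never removed by a rule, so every multiword inside a derivation of a regular one is
  regular and none of its cuts closes a cycle. Multiwords thus reduce to edge sets, and cyclic words
  to the predicate \<open>cyc\<close>. Cut elimination would have to permute cuts past arbitrary
  lexical axioms and follow the multiword through each permutation. A model asks for one check per
  rule instead. The price is symmetry: a cut can leave the remaining formula in either premise, so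
  each formula of a sequent must be able to act as the output. The model leads to finitely many
  productions because the shape of a plugging, that is, which end points become connected and
  whether a cycle arises, depends on the shapes of the parts and not on their words. A nonterminal
  therefore remembers a shape, and a production is one plugging carried out on shapes, with words
  kept as variables.\<close>

inductive internal_path :: "nat set \<Rightarrow> 't edge set \<Rightarrow> nat \<Rightarrow> 't list \<Rightarrow> nat \<Rightarrow> bool" for V E where
  single: "(i, w, j) \<in> E \<Longrightarrow> internal_path V E i w j"
| extend: "\<lbrakk>internal_path V E i w j; j \<in> V; (j, u, k) \<in> E\<rbrakk> \<Longrightarrow> internal_path V E i (w @ u) k"

definition hide :: "nat set \<Rightarrow> 't edge set \<Rightarrow> 't edge set" where
  "hide V E = {(i, w, j). internal_path V E i w j \<and> i \<notin> V \<and> j \<notin> V}"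

text \<open>Paths may repeat edges here, unlike those in \<open>closed_cycles\<close>. Only the
  existence of a cycle is tracked, not its label: a single one makes a glued multiword
  singular.\<close>

definition cyc :: "nat set \<Rightarrow> 't edge set \<Rightarrow> bool" where
  "cyc V E \<longleftrightarrow> (\<exists>v \<in> V. \<exists>w. internal_path V E v w v)"

definition rename :: "(nat \<Rightarrow> nat) \<Rightarrow> 't edge set \<Rightarrow> 't edge set" where
  "rename g E = (\<lambda>(i, w, j). (g i, w, g j)) ` E"

definition vertices :: "'t edge set \<Rightarrow> nat set" where
  "vertices E = fst ` E \<union> (snd \<circ> snd) ` E"

lemma edge_set_eqI: "(\<And>i w j. (i, w, j) \<in> E \<longleftrightarrow> (i, w, j) \<in> F) \<Longrightarrow> E = F"
  by auto

lemma edge_vertices: "(i, w, j) \<in> E \<Longrightarrow> i \<in> vertices E \<and> j \<in> vertices E"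
  by (force simp: vertices_def)

lemma vertices_Un [simp]: "vertices (E \<union> F) = vertices E \<union> vertices F"
  by (auto simp: vertices_def)

lemma internal_path_vertices:
  "internal_path V E i w j \<Longrightarrow> i \<in> vertices E \<and> j \<in> vertices E"
  by (induction rule: internal_path.induct) (auto dest: edge_vertices)

lemma mem_hide: "(i, w, j) \<in> hide V E \<longleftrightarrow> internal_path V E i w j \<and> i \<notin> V \<and> j \<notin> V"
  by (simp add: hide_def)

lemma vertices_hide: "vertices (hide V E) \<subseteq> vertices E - V"
  by (auto simp: vertices_def mem_hide dest!: internal_path_vertices)

lemma internal_path_trans:
  assumes "internal_path V E j u k" "internal_path V E i w j" "j \<in> V"
  shows "internal_path V E i (w @ u) k"
  using assms
  by (induction rule: internal_path.induct) (auto simp flip: append_assoc intro: internal_path.intros)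

lemma internal_path_mono:
  assumes "internal_path V E i w j" "V \<subseteq> V'" "E \<subseteq> E'"
  shows "internal_path V' E' i w j"
  using assms by (induction rule: internal_path.induct) (auto intro: internal_path.intros)

lemma internal_path_hide:
  assumes "internal_path V1 (hide V2 E) i w j"
  shows "internal_path (V1 \<union> V2) E i w j"
  using assms
proof (induction rule: internal_path.induct)
  case (single i w j)
  then show ?case by (auto simp: mem_hide intro: internal_path_mono)
next
  case (extend i w j u k)
  then have "internal_path (V1 \<union> V2) E j u k"
    by (auto simp: mem_hide intro: internal_path_mono)
  with extend show ?case by (auto intro: internal_path_trans)
qed

text \<open>The path is cut at its last visit to a vertex outside \<open>V2\<close> before its end:
  the part up to that vertex is a path of the graph with \<open>V2\<close> already hidden, the rest
  runs inside \<open>V2\<close>. Keeping the unfinished rest in the statement makes the induction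
  work, as the next edge either prolongs it or finds it completed to an edge of
  \<open>hide V2 E\<close>.\<close>

lemma internal_path_decompose:
  assumes "internal_path (V1 \<union> V2) E i w j" "i \<notin> V2" "V1 \<inter> V2 = {}"
  shows "\<exists>u v k. w = u @ v \<and> (k = i \<and> u = [] \<or> k \<in> V1 \<and> internal_path V1 (hide V2 E) i u k) \<and>
           k \<notin> V2 \<and> internal_path V2 E k v j"
  using assms
proof (induction rule: internal_path.induct)
  case (single i w j)
  then show ?case by (auto intro: internal_path.intros)
next
  case (extend i w j x l)
  then obtain u v k where *: "w = u @ v" "k = i \<and> u = [] \<or> k \<in> V1 \<and> internal_path V1 (hide V2 E) i u k"
    "k \<notin> V2" "internal_path V2 E k v j" by blast
  show ?case
  proof (cases "j \<in> V2")
    case True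
    then have "internal_path V2 E k (v @ x) l"
      using * extend by (auto intro: internal_path.intros)
    then show ?thesis using *
      by (intro exI[of _ u] exI[of _ "v @ x"] exI[of _ k]) auto
  next
    case False
    then have h: "(k, v, j) \<in> hide V2 E" using * by (simp add: mem_hide)
    then have "internal_path V1 (hide V2 E) i (u @ v) j"
      using *(2) by (auto intro: internal_path.intros)
    then show ?thesis using * False extend
      by (intro exI[of _ "u @ v"] exI[of _ x] exI[of _ j]) (auto intro: internal_path.intros)
  qed
qed

lemma internal_path_through_hide:
  assumes "internal_path (V1 \<union> V2) E i w j" "i \<notin> V2" "j \<notin> V2" "V1 \<inter> V2 = {}"
  shows "internal_path V1 (hide V2 E) i w j"
proof -
  obtain u v k where *: "w = u @ v" "k = i \<and> u = [] \<or> k \<in> V1 \<and> internal_path V1 (hide V2 E) i u k"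
    "k \<notin> V2" "internal_path V2 E k v j"
    using internal_path_decompose[OF assms(1,2,4)] by blast
  then have "(k, v, j) \<in> hide V2 E" using assms(3) by (simp add: mem_hide)
  then show ?thesis using * by (auto intro: internal_path.intros)
qed

text \<open>Edges of \<open>hide V2 E\<close> expand to paths of \<open>E\<close>; conversely, a
  path through both sets is chopped at its visits to \<open>V1\<close>. This is associativity of
  composition in terms of names.\<close>

lemma hide_hide:
  assumes "V1 \<inter> V2 = {}"
  shows "hide V1 (hide V2 E) = hide (V1 \<union> V2) E"
proof -
  have "internal_path V1 (hide V2 E) i w j \<Longrightarrow> i \<notin> V2 \<and> j \<notin> V2" for i w j
    using vertices_hide[of V2 E] by (auto dest!: internal_path_vertices)
  then show ?thesis
    using assms by (auto simp: mem_hide intro: internal_path_hide internal_path_through_hide)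
qed

text \<open>Serves to move the base point of a cycle: a closed path based in \<open>V2\<close>
  either stays there or reaches \<open>V1\<close>, where it can be based instead.\<close>

lemma internal_path_first_exit:
  assumes "internal_path (V1 \<union> V2) E i w j"
  shows "internal_path V2 E i w j \<or>
    (\<exists>k \<in> V1. \<exists>u v. internal_path V2 E i u k \<and> internal_path (V1 \<union> V2) E k v j)"
  using assms
proof (induction rule: internal_path.induct)
  case (single i w j)
  then show ?case by (auto intro: internal_path.intros)
next
  case (extend i w j u k)
  then show ?case by (blast intro: internal_path.intros)
qed

text \<open>Elimination in stages finds the same cycles: one that stays in \<open>V2\<close> shows
  up at the first stage, any other one meets \<open>V1\<close> and survives as a cycle of
  \<open>hide V2 E\<close>.\<close>

lemma cyc_Un:
  assumes "V1 \<inter> V2 = {}"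
  shows "cyc (V1 \<union> V2) E \<longleftrightarrow> cyc V2 E \<or> cyc V1 (hide V2 E)"
proof
  assume "cyc (V1 \<union> V2) E"
  then obtain v w where v: "v \<in> V1 \<union> V2" "internal_path (V1 \<union> V2) E v w v"
    by (auto simp: cyc_def)
  have outer: "cyc V1 (hide V2 E)" if "v \<in> V1" "internal_path (V1 \<union> V2) E v w v" for v w
    using internal_path_through_hide[OF that(2)] that assms by (auto simp: cyc_def)
  show "cyc V2 E \<or> cyc V1 (hide V2 E)"
  proof (cases "v \<in> V1")
    case True
    then show ?thesis using outer v by blast
  next
    case False
    then have "v \<in> V2" using v by blast
    from internal_path_first_exit[OF v(2)] show ?thesis
    proof
      assume "internal_path V2 E v w v"
      then show ?thesis using \<open>v \<in> V2\<close> by (auto simp: cyc_def)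
    next
      assume "\<exists>k \<in> V1. \<exists>u x. internal_path V2 E v u k \<and> internal_path (V1 \<union> V2) E k x v"
      then obtain k u x where k: "k \<in> V1" "internal_path V2 E v u k" "internal_path (V1 \<union> V2) E k x v"
        by blast
      then have "internal_path (V1 \<union> V2) E k (x @ u) k"
        using \<open>v \<in> V2\<close> by (auto intro: internal_path_trans internal_path_mono)
      then show ?thesis using outer k by blast
    qed
  qed
next
  assume "cyc V2 E \<or> cyc V1 (hide V2 E)"
  then show "cyc (V1 \<union> V2) E"
    by (auto simp: cyc_def intro: internal_path_mono internal_path_hide)
qed

text \<open>An edge of \<open>F\<close> has both ends outside \<open>V\<close>, so nothing can be
  joined to it at a vertex of \<open>V\<close>: a path that uses \<open>F\<close> consists of that
  edge alone.\<close>

lemma internal_path_Un_disjoint: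
  assumes "internal_path V (E \<union> F) i w j" "vertices F \<inter> V = {}"
  shows "internal_path V E i w j \<or> (i, w, j) \<in> F"
  using assms
  by (induction rule: internal_path.induct)
     (auto intro: internal_path.intros dest: edge_vertices)

lemma hide_Un_disjoint:
  assumes "vertices F \<inter> V = {}"
  shows "hide V (E \<union> F) = hide V E \<union> F"
proof
  show "hide V (E \<union> F) \<subseteq> hide V E \<union> F"
    using assms by (auto simp: mem_hide dest: internal_path_Un_disjoint)
  show "hide V E \<union> F \<subseteq> hide V (E \<union> F)"
    using assms edge_vertices[of _ _ _ F]
    by (fastforce simp: mem_hide intro: internal_path_mono[where V = V and E = E] internal_path.single)
qed

lemma cyc_Un_disjoint:
  assumes "vertices F \<inter> V = {}"
  shows "cyc V (E \<union> F) \<longleftrightarrow> cyc V E"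
proof -
  have "internal_path V E v w v" if "internal_path V (E \<union> F) v w v" "v \<in> V" for v w
    using internal_path_Un_disjoint[OF that(1) assms] that assms by (auto dest: edge_vertices)
  then show ?thesis
    unfolding cyc_def by (meson internal_path_mono order_refl sup_ge1)
qed

lemma hide_empty [simp]: "hide {} E = E"
proof -
  have "internal_path {} E i w j \<longleftrightarrow> (i, w, j) \<in> E" for i w j
    by (auto elim: internal_path.cases intro: internal_path.intros)
  then show ?thesis by (auto simp: mem_hide)
qed

lemma cyc_empty [simp]: "\<not> cyc {} E"
  by (simp add: cyc_def)

lemma internal_path_labels:
  "internal_path V E i w j \<Longrightarrow> set w \<subseteq> (\<Union>(a, u, b) \<in> E. set u)"
  by (induction rule: internal_path.induct) fastforce+


section \<open>Compatibility of elimination with vertex names and with label maps\<close>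

subsection \<open>Renaming vertices and relabelling edges\<close>

lemma mem_rename: "(a, w, b) \<in> rename g E \<longleftrightarrow> (\<exists>i j. (i, w, j) \<in> E \<and> a = g i \<and> b = g j)"
  by (force simp: rename_def)

lemma rename_Un [simp]: "rename g (E \<union> F) = rename g E \<union> rename g F"
  by (simp add: rename_def image_Un)

lemma rename_empty [simp]: "rename g {} = {}"
  by (simp add: rename_def)

lemma vertices_rename [simp]: "vertices (rename g E) = g ` vertices E"
  by (force simp: rename_def vertices_def)

lemma rename_comp: "rename g (rename h E) = rename (g \<circ> h) E"
  by (auto simp: rename_def image_image intro!: image_cong)

lemma rename_cong: "(\<And>v. v \<in> vertices E \<Longrightarrow> g v = h v) \<Longrightarrow> rename g E = rename h E"
  unfolding rename_def by (intro image_cong) (auto dest: edge_vertices)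

lemma rename_ident: "(\<And>v. v \<in> vertices E \<Longrightarrow> g v = v) \<Longrightarrow> rename g E = E"
  by (rule trans[OF rename_cong[of E g id]]) (auto simp: rename_def)

lemma internal_path_rename:
  assumes "inj_on g (vertices E \<union> V)"
  shows "internal_path (g ` V) (rename g E) a w b \<longleftrightarrow>
    (\<exists>i j. internal_path V E i w j \<and> a = g i \<and> b = g j)"
proof
  assume "internal_path (g ` V) (rename g E) a w b"
  then show "\<exists>i j. internal_path V E i w j \<and> a = g i \<and> b = g j"
  proof (induction rule: internal_path.induct)
    case (single i w j)
    then show ?case by (auto simp: mem_rename intro: internal_path.intros)
  next
    case (extend i w j u k)
    then obtain i' j' j'' k' where *: "internal_path V E i' w j'" "i = g i'" "j = g j'"
      "(j'', u, k') \<in> E" "j = g j''" "k = g k'" by (auto simp: mem_rename)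
    from extend(2) obtain v where v: "v \<in> V" "j = g v" by auto
    have "j' \<in> vertices E" "j'' \<in> vertices E"
      using * by (auto dest: internal_path_vertices edge_vertices)
    then have "j' = v" "j'' = v"
      using assms v * unfolding inj_on_def by blast+
    then have "internal_path V E i' (w @ u) k'" using * v by (auto intro: internal_path.extend)
    then show ?case using * by blast
  qed
next
  assume "\<exists>i j. internal_path V E i w j \<and> a = g i \<and> b = g j"
  then obtain i j where "internal_path V E i w j" "a = g i" "b = g j" by blast
  then show "internal_path (g ` V) (rename g E) a w b"
  proof (induction arbitrary: a b rule: internal_path.induct)
    case (single i w j)
    then show ?case by (intro internal_path.single) (auto simp: mem_rename)
  next
    case (extend i w j u k)
    show ?case
      by (rule internal_path.extend[of _ _ _ _ "g j"]) (use extend in \<open>auto simp: mem_rename\<close>)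
  qed
qed

text \<open>Injectivity has to cover \<open>V\<close> as well: a vertex of the graph outside
  \<open>V\<close> must not receive the name of a vertex in \<open>V\<close>.\<close>

lemma hide_rename:
  assumes "inj_on g (vertices E \<union> V)"
  shows "hide (g ` V) (rename g E) = rename g (hide V E)"
proof -
  have V: "g i \<in> g ` V \<longleftrightarrow> i \<in> V" if "i \<in> vertices E" for i
    using assms that unfolding inj_on_def by blast
  show ?thesis
  proof (rule edge_set_eqI)
    fix a w b
    have "(\<exists>i j. internal_path V E i w j \<and> a = g i \<and> b = g j) \<and> a \<notin> g ` V \<and> b \<notin> g ` V \<longleftrightarrow>
        (\<exists>i j. (internal_path V E i w j \<and> a = g i \<and> b = g j) \<and> a \<notin> g ` V \<and> b \<notin> g ` V)"
      by blast
    also have "\<dots> \<longleftrightarrow> (\<exists>i j. (internal_path V E i w j \<and> i \<notin> V \<and> j \<notin> V) \<and> a = g i \<and> b = g j)"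
    proof (intro ex_cong1)
      fix i j
      show "(internal_path V E i w j \<and> a = g i \<and> b = g j) \<and> a \<notin> g ` V \<and> b \<notin> g ` V \<longleftrightarrow>
          (internal_path V E i w j \<and> i \<notin> V \<and> j \<notin> V) \<and> a = g i \<and> b = g j"
      proof (cases "internal_path V E i w j \<and> a = g i \<and> b = g j")
        case True
        then show ?thesis using V[of i] V[of j] internal_path_vertices[of V E i w j] by simp
      qed blast
    qed
    finally show "(a, w, b) \<in> hide (g ` V) (rename g E) \<longleftrightarrow> (a, w, b) \<in> rename g (hide V E)"
      unfolding mem_hide mem_rename internal_path_rename[OF assms] .
  qed
qed

lemma cyc_rename:
  assumes "inj_on g (vertices E \<union> V)"
  shows "cyc (g ` V) (rename g E) \<longleftrightarrow> cyc V E"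
proof -
  have inj: "i = j" if "g i = g j" "i \<in> vertices E" "j \<in> V" for i j
    using assms that unfolding inj_on_def by blast
  show ?thesis
  proof
    assume "cyc (g ` V) (rename g E)"
    then obtain v w where v: "v \<in> V" "internal_path (g ` V) (rename g E) (g v) w (g v)"
      by (auto simp: cyc_def)
    then obtain i j where ij: "internal_path V E i w j" "g v = g i" "g v = g j"
      using internal_path_rename[OF assms] by blast
    then have "i = v" "j = v" using inj v internal_path_vertices by metis+
    then show "cyc V E" using ij(1) v(1) unfolding cyc_def by blast
  next
    assume "cyc V E"
    then show "cyc (g ` V) (rename g E)"
      using internal_path_rename[OF assms] unfolding cyc_def by blast
  qed
qed

definition relabel :: "('a list \<Rightarrow> 'b list) \<Rightarrow> 'a edge set \<Rightarrow> 'b edge set" where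
  "relabel f E = (\<lambda>(i, w, j). (i, f w, j)) ` E"

lemma mem_relabel: "(i, u, j) \<in> relabel f E \<longleftrightarrow> (\<exists>w. (i, w, j) \<in> E \<and> u = f w)"
  by (force simp: relabel_def)

lemma relabel_Un [simp]: "relabel f (E \<union> F) = relabel f E \<union> relabel f F"
  by (simp add: relabel_def image_Un)

text \<open>Labels of paths are concatenations, so a map that respects concatenation commutes with
  forming paths. A plugging can therefore be computed once with variables as labels and instantiated
  by a substitution afterwards.\<close>

lemma internal_path_relabel:
  assumes f: "\<And>u v. f (u @ v) = f u @ f v"
  shows "internal_path V (relabel f E) i u j \<longleftrightarrow> (\<exists>w. internal_path V E i w j \<and> u = f w)"
proof
  assume "internal_path V (relabel f E) i u j"
  then show "\<exists>w. internal_path V E i w j \<and> u = f w"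
  proof (induction rule: internal_path.induct)
    case (extend i w j u k)
    then show ?case by (auto simp: mem_relabel) (metis f internal_path.extend)
  qed (auto simp: mem_relabel intro: internal_path.intros)
next
  assume "\<exists>w. internal_path V E i w j \<and> u = f w"
  then obtain w where "internal_path V E i w j" "u = f w" by blast
  then show "internal_path V (relabel f E) i u j"
  proof (induction arbitrary: u rule: internal_path.induct)
    case (extend i w j u k)
    then show ?case by (auto simp: f mem_relabel intro!: internal_path.extend[where j = j])
  qed (auto simp: mem_relabel intro!: internal_path.single)
qed

lemma hide_relabel:
  assumes "\<And>u v. f (u @ v) = f u @ f v"
  shows "hide V (relabel f E) = relabel f (hide V E)"
  using internal_path_relabel[of f, OF assms] by (auto simp: mem_hide mem_relabel)

lemma cyc_relabel:
  assumes "\<And>u v. f (u @ v) = f u @ f v"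
  shows "cyc V (relabel f E) \<longleftrightarrow> cyc V E"
  using internal_path_relabel[of f, OF assms] by (auto simp: cyc_def)


section \<open>Perfect matchings and the contraction of their vertices\<close>

subsection \<open>Perfect matchings\<close>

text \<open>The sets \<open>S\<close> and \<open>T\<close> may overlap. When two multiwords share
  vertices, a shared vertex is the target of an edge of one and the source of an edge of the other,
  so it lies in both sets until it is hidden.\<close>

definition matching :: "nat set \<Rightarrow> nat set \<Rightarrow> 't edge set \<Rightarrow> bool" where
  "matching S T E \<longleftrightarrow> finite S \<and> finite T \<and>
     (\<forall>(i, w, j) \<in> E. i \<in> S \<and> j \<in> T) \<and>
     (\<forall>i \<in> S. \<exists>!e. e \<in> E \<and> edge_source e = i) \<and>
     (\<forall>j \<in> T. \<exists>!e. e \<in> E \<and> edge_target e = j)"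

lemma matchingD:
  assumes "matching S T E" "(i, w, j) \<in> E"
  shows "i \<in> S" "j \<in> T"
  using assms by (auto simp: matching_def)

lemma matching_source_unique:
  assumes "matching S T E" "(i, w, j) \<in> E" "(i, w', j') \<in> E"
  shows "w' = w \<and> j' = j"
proof -
  have "i \<in> S" using assms by (auto simp: matching_def)
  then have "\<exists>!e. e \<in> E \<and> edge_source e = i" using assms(1) by (auto simp: matching_def)
  then show ?thesis using assms(2,3) by (metis fst_conv snd_conv)
qed

lemma matching_target_unique:
  assumes "matching S T E" "(i, w, j) \<in> E" "(i', w', j) \<in> E"
  shows "w' = w \<and> i' = i"
proof -
  have "j \<in> T" using assms by (auto simp: matching_def)
  then have "\<exists>!e. e \<in> E \<and> edge_target e = j" using assms(1) by (auto simp: matching_def)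
  then show ?thesis using assms(2,3) by (metis fst_conv snd_conv)
qed

lemma matching_source_exists: "\<lbrakk>matching S T E; i \<in> S\<rbrakk> \<Longrightarrow> \<exists>w j. (i, w, j) \<in> E"
  unfolding matching_def by (metis ex1_implies_ex prod.collapse)

lemma matching_target_exists: "\<lbrakk>matching S T E; j \<in> T\<rbrakk> \<Longrightarrow> \<exists>i w. (i, w, j) \<in> E"
  unfolding matching_def by (metis ex1_implies_ex prod.collapse)

lemma matchingI:
  assumes "finite S" "finite T"
    and "\<And>i w j. (i, w, j) \<in> E \<Longrightarrow> i \<in> S \<and> j \<in> T"
    and "\<And>i. i \<in> S \<Longrightarrow> \<exists>w j. (i, w, j) \<in> E" "\<And>j. j \<in> T \<Longrightarrow> \<exists>i w. (i, w, j) \<in> E"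
    and "\<And>i w j w' j'. \<lbrakk>(i, w, j) \<in> E; (i, w', j') \<in> E\<rbrakk> \<Longrightarrow> w' = w \<and> j' = j"
    and "\<And>i w j w' i'. \<lbrakk>(i, w, j) \<in> E; (i', w', j) \<in> E\<rbrakk> \<Longrightarrow> w' = w \<and> i' = i"
  shows "matching S T E"
proof -
  have "\<exists>!e. e \<in> E \<and> edge_source e = i" if i: "i \<in> S" for i
  proof -
    obtain w j where "(i, w, j) \<in> E" using assms(4)[OF i] by blast
    moreover have "e = (i, w, j)" if "e \<in> E \<and> edge_source e = i" for e
      using that assms(6)[OF calculation, of "edge_label e" "edge_target e"] by (cases e) auto
    ultimately show ?thesis by (intro ex1I[of _ "(i, w, j)"]) auto
  qed
  moreover have "\<exists>!e. e \<in> E \<and> edge_target e = j" if j: "j \<in> T" for j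
  proof -
    obtain i w where "(i, w, j) \<in> E" using assms(5)[OF j] by blast
    moreover have "e = (i, w, j)" if "e \<in> E \<and> edge_target e = j" for e
      using that assms(7)[OF calculation, of "edge_source e" "edge_label e"] by (cases e) auto
    ultimately show ?thesis by (intro ex1I[of _ "(i, w, j)"]) auto
  qed
  ultimately show ?thesis using assms(1-3) by (fastforce simp: matching_def)
qed

lemma matching_vertices:
  assumes "matching S T E" shows "vertices E = S \<union> T"
proof
  show "vertices E \<subseteq> S \<union> T" using matchingD[OF assms] by (auto simp: vertices_def)
  show "S \<union> T \<subseteq> vertices E"
    using matching_source_exists[OF assms] matching_target_exists[OF assms]
    by (blast dest: edge_vertices)
qed

lemma matching_finite:
  assumes "matching S T E" shows "finite E"
proof (rule inj_on_finite[of fst E S])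
  show "inj_on fst E"
    using matching_source_unique[OF assms] by (fastforce simp: inj_on_def)
  show "fst ` E \<subseteq> S" "finite S" using assms by (auto simp: matching_def)
qed

lemma matching_Un:
  assumes E: "matching S T E" and F: "matching S' T' F" and "S \<inter> S' = {}" "T \<inter> T' = {}"
  shows "matching (S \<union> S') (T \<union> T') (E \<union> F)"
proof (rule matchingI)
  show "finite (S \<union> S')" "finite (T \<union> T')" using E F by (auto simp: matching_def)
next
  fix i w j w' j' assume "(i, w, j) \<in> E \<union> F" "(i, w', j') \<in> E \<union> F"
  then show "w' = w \<and> j' = j"
    using assms(3) matching_source_unique[OF E] matching_source_unique[OF F]
      matchingD(1)[OF E] matchingD(1)[OF F] by blast
next
  fix i w j w' i' assume "(i, w, j) \<in> E \<union> F" "(i', w', j) \<in> E \<union> F"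
  then show "w' = w \<and> i' = i"
    using assms(4) matching_target_unique[OF E] matching_target_unique[OF F]
      matchingD(2)[OF E] matchingD(2)[OF F] by blast
qed (use matchingD[OF E] matchingD[OF F] matching_source_exists[OF E] matching_source_exists[OF F]
      matching_target_exists[OF E] matching_target_exists[OF F] in blast)+

lemma matching_empty [simp]: "matching {} {} {}"
  by (simp add: matching_def)

lemma matching_single: "matching {i} {j} {(i, w, j)}"
  by (auto simp: matching_def)

lemma matching_rename:
  assumes E: "matching S T E" and g: "inj_on g (S \<union> T)"
  shows "matching (g ` S) (g ` T) (rename g E)"
proof (rule matchingI)
  have inj: "g a = g b \<longleftrightarrow> a = b" if "a \<in> S \<union> T" "b \<in> S \<union> T" for a b
    using g that by (auto simp: inj_on_def)
  show "finite (g ` S)" "finite (g ` T)" using E by (auto simp: matching_def)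
  show "\<exists>w j. (i, w, j) \<in> rename g E" if "i \<in> g ` S" for i
    using that matching_source_exists[OF E] by (fastforce simp: mem_rename)
  show "\<exists>i w. (i, w, j) \<in> rename g E" if "j \<in> g ` T" for j
    using that matching_target_exists[OF E] by (fastforce simp: mem_rename)
  show "i \<in> g ` S \<and> j \<in> g ` T" if "(i, w, j) \<in> rename g E" for i w j
    using that matchingD[OF E] by (auto simp: mem_rename)
  show "w' = w \<and> j' = j" if "(i, w, j) \<in> rename g E" "(i, w', j') \<in> rename g E" for i w j w' j'
    using that by (auto simp: mem_rename inj matchingD[OF E] dest: matching_source_unique[OF E])
  show "w' = w \<and> i' = i" if "(i, w, j) \<in> rename g E" "(i', w', j) \<in> rename g E" for i w j w' i'
    using that by (auto simp: mem_rename inj matchingD[OF E] dest: matching_target_unique[OF E])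
qed

lemma matching_relabel:
  assumes "matching S T E"
  shows "matching S T (relabel f E)"
proof (rule matchingI)
  show "finite S" "finite T" using assms by (auto simp: matching_def)
  show "f' = w \<and> j' = j" if "(i, w, j) \<in> relabel f E" "(i, f', j') \<in> relabel f E" for i w j f' j'
    using that matching_source_unique[OF assms] unfolding mem_relabel by blast
  show "f' = w \<and> i' = i" if "(i, w, j) \<in> relabel f E" "(i', f', j) \<in> relabel f E" for i w j f' i'
    using that matching_target_unique[OF assms] unfolding mem_relabel by blast
  show "\<exists>w j. (i, w, j) \<in> relabel f E" if "i \<in> S" for i
    using matching_source_exists[OF assms that] unfolding mem_relabel by blast
  show "\<exists>i w. (i, w, j) \<in> relabel f E" if "j \<in> T" for j
    using matching_target_exists[OF assms that] unfolding mem_relabel by blast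
qed (auto simp: mem_relabel matchingD[OF assms])

text \<open>Will express that a production uses each of its variables exactly once. The sum ranges
  over a set of edges, so additivity requires disjoint edge sets.\<close>

definition label_count :: "'t \<Rightarrow> 't edge set \<Rightarrow> nat" where
  "label_count x E = (\<Sum>e\<in>E. count_list (edge_label e) x)"

lemma label_count_Un:
  "\<lbrakk>finite E; finite F; E \<inter> F = {}\<rbrakk> \<Longrightarrow> label_count x (E \<union> F) = label_count x E + label_count x F"
  by (simp add: label_count_def sum.union_disjoint)

text \<open>At a vertex that is both a source and a target exactly one edge enters and one leaves.
  Without a loop these two differ and hiding merges them; a longer path would have to return to
  \<open>v\<close> by a loop.\<close>

lemma hide_single_vertex:
  assumes E: "matching S T E" and v: "v \<in> S" "v \<in> T" and nc: "\<not> cyc {v} E"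
  obtains a w b u where "(a, w, v) \<in> E" "(v, u, b) \<in> E" "a \<noteq> v" "b \<noteq> v"
    "hide {v} E = E - {(a, w, v), (v, u, b)} \<union> {(a, w @ u, b)}"
proof -
  obtain a w where a: "(a, w, v) \<in> E" using matching_target_exists[OF E v(2)] by blast
  obtain b u where b: "(v, u, b) \<in> E" using matching_source_exists[OF E v(1)] by blast
  have noloop: "(v, x, v) \<notin> E" for x using nc by (auto simp: cyc_def intro: internal_path.intros)
  have only: "internal_path {v} E i x j \<Longrightarrow> (i, x, j) \<in> E \<or> i = a \<and> x = w @ u \<and> j = b" for i x j
  proof (induction rule: internal_path.induct)
    case (extend i x j y k)
    then have j: "j = v" by simp
    have yk: "y = u \<and> k = b" using matching_source_unique[OF E b] extend j by blast
    have "b \<noteq> v" using b noloop by blast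
    then have "(i, x, v) \<in> E" using extend j by blast
    then show ?case using matching_target_unique[OF E a, of i x] yk by blast
  qed auto
  have path: "internal_path {v} E a (w @ u) b" using a b by (auto intro: internal_path.intros)
  have ne: "a \<noteq> v" "b \<noteq> v" using a b noloop by blast+
  have "(i, x, j) \<in> hide {v} E \<longleftrightarrow> (i, x, j) \<in> E - {(a, w, v), (v, u, b)} \<union> {(a, w @ u, b)}" for i x j
    using matching_source_unique[OF E b, of x j] matching_target_unique[OF E a, of i x] only[of i x j] path ne
      internal_path.single[of i x j E "{v}"]
    by (auto simp: mem_hide)
  then have "hide {v} E = E - {(a, w, v), (v, u, b)} \<union> {(a, w @ u, b)}"
    by (intro edge_set_eqI)
  with that a b ne show thesis by blast
qed

lemma matching_hide_single_vertex:
  assumes E: "matching S T E" and v: "v \<in> S" "v \<in> T" and nc: "\<not> cyc {v} E"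
  shows "matching (S - {v}) (T - {v}) (hide {v} E)" "label_count x (hide {v} E) = label_count x E"
proof -
  obtain a w b u where *: "(a, w, v) \<in> E" "(v, u, b) \<in> E" "a \<noteq> v" "b \<noteq> v"
    and h: "hide {v} E = E - {(a, w, v), (v, u, b)} \<union> {(a, w @ u, b)}"
    using hide_single_vertex[OF assms] by metis
  have mem: "(i, z, j) \<in> hide {v} E \<longleftrightarrow>
      (i, z, j) \<in> E \<and> i \<noteq> v \<and> j \<noteq> v \<or> i = a \<and> z = w @ u \<and> j = b" for i z j
    using matching_source_unique[OF E *(2), of z j] matching_target_unique[OF E *(1), of i z] *
    unfolding h by blast
  show "matching (S - {v}) (T - {v}) (hide {v} E)"
  proof (rule matchingI)
    show "finite (S - {v})" "finite (T - {v})" using E by (auto simp: matching_def)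
    show "\<exists>z j. (i, z, j) \<in> hide {v} E" if i: "i \<in> S - {v}" for i
    proof -
      obtain z j where "(i, z, j) \<in> E" using matching_source_exists[OF E, of i] i by blast
      then show ?thesis using i matching_target_unique[OF E *(1), of i z] unfolding mem by blast
    qed
    show "\<exists>i z. (i, z, j) \<in> hide {v} E" if j: "j \<in> T - {v}" for j
    proof -
      obtain i z where "(i, z, j) \<in> E" using matching_target_exists[OF E, of j] j by blast
      then show ?thesis using j matching_source_unique[OF E *(2), of z j] unfolding mem by blast
    qed
    show "i \<in> S - {v} \<and> j \<in> T - {v}" if "(i, z, j) \<in> hide {v} E" for i z j
      using that matchingD[OF E] * unfolding mem by blast
    show "z' = z \<and> j' = j" if "(i, z, j) \<in> hide {v} E" "(i, z', j') \<in> hide {v} E" for i z j z' j'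
      using that matching_source_unique[OF E] *(1) unfolding mem by blast
    show "z' = z \<and> i' = i" if "(i, z, j) \<in> hide {v} E" "(i', z', j) \<in> hide {v} E" for i z j z' i'
      using that matching_target_unique[OF E] *(2) unfolding mem by blast
  qed
  let ?E = "E - {(a, w, v), (v, u, b)}"
  have fin: "finite ?E" using matching_finite[OF E] by simp
  \<comment> \<open>The merged edge was not present before: the only edge leaving \<open>a\<close>
    goes to \<open>v\<close>, and \<open>b\<close> differs from \<open>v\<close>. Otherwise the set
    would lose an edge and its labels would not be counted.\<close>
  have new: "(a, w @ u, b) \<notin> ?E" using matching_target_unique[OF E *(1), of a "w @ u"] matching_source_unique[OF E *(1), of "w @ u" b] *(4)
    by blast
  have "label_count x (hide {v} E) = label_count x ?E + label_count x {(a, w @ u, b)}"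
    unfolding h using fin new by (intro label_count_Un) auto
  also have "label_count x {(a, w @ u, b)} = label_count x {(a, w, v), (v, u, b)}"
    using * by (simp add: label_count_def)
  also have "label_count x ?E + label_count x {(a, w, v), (v, u, b)} =
      label_count x (?E \<union> {(a, w, v), (v, u, b)})"
    using fin by (intro label_count_Un[symmetric]) auto
  also have "?E \<union> {(a, w, v), (v, u, b)} = E" using * by auto
  finally show "label_count x (hide {v} E) = label_count x E" .
qed

text \<open>The vertices of \<open>V\<close> are contracted one at a time, each stage being acyclic
  by \<open>cyc_Un\<close>. The second conclusion is the linearity argument: no symbol of a label is
  lost or duplicated by hiding.\<close>

lemma matching_hide_label_count:
  assumes "matching S T E" "V \<subseteq> S" "V \<subseteq> T" "\<not> cyc V E"
  shows "matching (S - V) (T - V) (hide V E) \<and> label_count x (hide V E) = label_count x E"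
proof -
  have "finite V" using assms by (auto simp: matching_def intro: finite_subset)
  then show ?thesis using assms
  proof (induction V)
    case (insert v V)
    have cy: "\<not> cyc V E" "\<not> cyc {v} (hide V E)"
      using insert.prems cyc_Un[of "{v}" V E] insert.hyps by auto
    then have IH: "matching (S - V) (T - V) (hide V E)" "label_count x (hide V E) = label_count x E"
      using insert by auto
    have "hide (insert v V) E = hide {v} (hide V E)"
      using hide_hide[of "{v}" V E] insert.hyps by auto
    moreover have "S - insert v V = S - V - {v}" "T - insert v V = T - V - {v}" by auto
    ultimately show ?case
      using matching_hide_single_vertex[OF IH(1) _ _ cy(2)] IH insert by auto
  qed simp
qed

lemmas matching_hide = matching_hide_label_count[THEN conjunct1]
lemmas label_count_hide = matching_hide_label_count[THEN conjunct2]

section \<open>Comparison with the gluing of multiwords\<close>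

subsection \<open>Gluing as hiding in a quotient\<close>

context
  fixes R :: "(nat \<times> nat) set" and E :: "'t edge set" and q :: "nat \<Rightarrow> nat" and V :: "nat set"
  assumes R: "\<And>e e'. \<lbrakk>e \<in> E; e' \<in> E\<rbrakk> \<Longrightarrow> (edge_target e, edge_source e') \<in> R \<longleftrightarrow>
      q (edge_target e) = q (edge_source e') \<and> q (edge_target e) \<in> V"
    and Field: "\<And>v. v \<in> vertices E \<Longrightarrow> v \<in> Field R \<longleftrightarrow> q v \<in> V"
    and fixed: "\<And>v. \<lbrakk>v \<in> vertices E; v \<notin> Field R\<rbrakk> \<Longrightarrow> q v = v"
begin

lemma is_path_snoc:
  "is_path R E (es @ [e]) \<longleftrightarrow> e \<in> E \<and> (es = [] \<or> is_path R E es \<and> (edge_target (last es), edge_source e) \<in> R)"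
  by (cases "es = []") (auto simp: is_path_def successively_append_iff)

lemma rename_quotient_edge: "e \<in> E \<Longrightarrow> (q (edge_source e), edge_label e, q (edge_target e)) \<in> rename q E"
  by (cases e) (auto simp: mem_rename)

lemma is_path_internal_path:
  "is_path R E es \<Longrightarrow>
    internal_path V (rename q E) (q (edge_source (hd es))) (path_label es) (q (edge_target (last es)))"
proof (induction es rule: rev_induct)
  case Nil
  then show ?case by (simp add: is_path_def)
next
  case (snoc e es)
  show ?case
  proof (cases "es = []")
    case True
    then have "e \<in> E" using snoc.prems by (simp add: is_path_snoc[of "[]", simplified])
    then show ?thesis using True rename_quotient_edge by (auto simp: path_label_def intro!: internal_path.single)
  next
    case False
    then have *: "is_path R E es" "(edge_target (last es), edge_source e) \<in> R" "e \<in> E"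
      using snoc.prems by (auto simp: is_path_snoc)
    have "last es \<in> E" using *(1) False by (auto simp: is_path_def)
    then have eq: "q (edge_target (last es)) = q (edge_source e)" "q (edge_target (last es)) \<in> V"
      using R * by auto
    have "internal_path V (rename q E) (q (edge_source (hd es))) (path_label es @ edge_label e) (q (edge_target e))"
      using snoc.IH[OF *(1)] eq rename_quotient_edge[OF *(3)]
      by (intro internal_path.extend[where j = "q (edge_target (last es))"]) auto
    then show ?thesis using False by (simp add: path_label_def)
  qed
qed

lemma internal_path_is_path:
  assumes "internal_path V (rename q E) a w b"
  shows "\<exists>es. is_path R E es \<and> a = q (edge_source (hd es)) \<and> b = q (edge_target (last es)) \<and>
    w = path_label es"
  using assms
proof (induction rule: internal_path.induct)
  case (single i w j)
  then obtain x y where "(x, w, y) \<in> E" "i = q x" "j = q y" by (auto simp: mem_rename)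
  then show ?case by (intro exI[of _ "[(x, w, y)]"]) (auto simp: is_path_def path_label_def)
next
  case (extend i w j u k)
  then obtain x y where e: "(x, u, y) \<in> E" "j = q x" "k = q y" by (auto simp: mem_rename)
  obtain es where es: "is_path R E es" "i = q (edge_source (hd es))" "j = q (edge_target (last es))"
    "w = path_label es" using extend by blast
  have ne: "es \<noteq> []" using es by (auto simp: is_path_def)
  then have "last es \<in> E" using es by (auto simp: is_path_def)
  then have "(edge_target (last es), x) \<in> R" using R[of "last es" "(x, u, y)"] e es extend by auto
  then have "is_path R E (es @ [(x, u, y)])" using es e by (auto simp: is_path_snoc)
  then show ?case using es e ne by (intro exI[of _ "es @ [(x, u, y)]"]) (auto simp: path_label_def)
qed

lemma is_path_ends:
  assumes "is_path R E es" shows "edge_source (hd es) \<in> vertices E" "edge_target (last es) \<in> vertices E"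
proof -
  have "hd es \<in> E" "last es \<in> E" using assms by (auto simp: is_path_def)
  then show "edge_source (hd es) \<in> vertices E" "edge_target (last es) \<in> vertices E"
    by (auto simp: vertices_def)
qed

text \<open>The map \<open>q\<close> gives both vertices of an identified pair the same name, and
  \<open>V\<close> consists of these common names; vertices that are not glued keep theirs. Steps
  along \<open>R\<close> then become passages through a single vertex of \<open>V\<close>.\<close>

lemma glued_edges_eq_hide: "glued_edges R E = hide V (rename q E)"
proof (rule edge_set_eqI)
  fix i w j
  show "(i, w, j) \<in> glued_edges R E \<longleftrightarrow> (i, w, j) \<in> hide V (rename q E)"
  proof
    assume "(i, w, j) \<in> glued_edges R E"
    then obtain es where es: "is_path R E es" "i = edge_source (hd es)" "j = edge_target (last es)"
      "w = path_label es" "i \<notin> Field R" "j \<notin> Field R"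
      by (auto simp: glued_edges_def)
    then have "q i = i" "q j = j" "q i \<notin> V" "q j \<notin> V" using fixed Field is_path_ends by auto
    then show "(i, w, j) \<in> hide V (rename q E)"
      using is_path_internal_path[OF es(1)] es by (auto simp: mem_hide)
  next
    assume "(i, w, j) \<in> hide V (rename q E)"
    then obtain es where es: "is_path R E es" "i = q (edge_source (hd es))" "j = q (edge_target (last es))"
      "w = path_label es" and V: "i \<notin> V" "j \<notin> V"
      using internal_path_is_path[of i w j] unfolding mem_hide by blast
    then have nF: "edge_source (hd es) \<notin> Field R" "edge_target (last es) \<notin> Field R"
      using Field is_path_ends by auto
    then have "i = edge_source (hd es)" "j = edge_target (last es)"
      using es fixed is_path_ends by auto
    then show "(i, w, j) \<in> glued_edges R E"
      using es nF by (auto simp: glued_edges_def)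
  qed
qed

text \<open>Bridges \<open>cyc\<close>, which speaks of arbitrary closed paths, and
  \<open>closed_cycles\<close>, which forbids repeated edges. If an edge occurs twice, the stretch
  from one occurrence up to just before the next is a shorter closed path.\<close>

lemma closed_path_distinct:
  assumes "is_path R E es" "(edge_target (last es), edge_source (hd es)) \<in> R"
  shows "\<exists>es. is_path R E es \<and> distinct es \<and> (edge_target (last es), edge_source (hd es)) \<in> R"
  using assms
proof (induction "length es" arbitrary: es rule: less_induct)
  case less
  show ?case
  proof (cases "distinct es")
    case False
    then obtain xs ys zs e where split: "es = xs @ [e] @ ys @ [e] @ zs"
      using not_distinct_decomp by blast
    have es: "es = xs @ (e # ys) @ (e # zs)" by (simp add: split)
    have "is_path R E (e # ys)" "(edge_target (last (e # ys)), edge_source e) \<in> R"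
      using less.prems(1) unfolding es is_path_def successively_append_iff by auto
    then show ?thesis using less.hyps[of "e # ys"] by (simp add: split)
  qed (use less in blast)
qed

lemma closed_cycles_eq_empty_iff: "closed_cycles R E = {} \<longleftrightarrow> \<not> cyc V (rename q E)"
proof
  assume "closed_cycles R E = {}"
  then have none: "\<not> (is_path R E es \<and> (edge_target (last es), edge_source (hd es)) \<in> R)" for es
    using closed_path_distinct by (auto simp: closed_cycles_def)
  show "\<not> cyc V (rename q E)"
  proof
    assume "cyc V (rename q E)"
    then obtain v w where v: "v \<in> V" "internal_path V (rename q E) v w v" by (auto simp: cyc_def)
    then obtain es where es: "is_path R E es" "v = q (edge_source (hd es))" "v = q (edge_target (last es))"
      using internal_path_is_path by blast
    have "hd es \<in> E" "last es \<in> E" using es(1) by (auto simp: is_path_def)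
    then show False using none[of es] R[of "last es" "hd es"] es v by auto
  qed
next
  assume nc: "\<not> cyc V (rename q E)"
  have False if es: "is_path R E es" "(edge_target (last es), edge_source (hd es)) \<in> R" for es
  proof -
    have "hd es \<in> E" "last es \<in> E" using es(1) by (auto simp: is_path_def)
    then have "q (edge_target (last es)) = q (edge_source (hd es))" "q (edge_target (last es)) \<in> V"
      using R es by auto
    then show False using nc is_path_internal_path[OF es(1)] by (auto simp: cyc_def)
  qed
  then show "closed_cycles R E = {}" by (auto simp: closed_cycles_def)
qed

end

text \<open>As \<open>mset_set\<close> of an infinite set is empty, finiteness is what makes an
  empty singular part equivalent to the absence of cycles.\<close>

lemma finite_closed_cycles:
  assumes "finite E" shows "finite (closed_cycles R E)"
proof -
  have "{es. is_path R E es \<and> distinct es \<and> (edge_target (last es), edge_source (hd es)) \<in> R}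
      \<subseteq> {es. set es \<subseteq> E \<and> distinct es}"
    by (auto simp: is_path_def)
  moreover have "finite {es. set es \<subseteq> E \<and> distinct es}"
    using finite_subset_distinct[OF assms] by simp
  ultimately show ?thesis unfolding closed_cycles_def using finite_subset by blast
qed

lemma regular_glue:
  assumes "finite (edges \<sigma>)"
  shows "regular (glue R \<sigma>) \<longleftrightarrow> regular \<sigma> \<and> closed_cycles R (edges \<sigma>) = {}"
  using finite_closed_cycles[OF assms] by (auto simp: regular_def glue_def mset_set_empty_iff)

lemma edges_renumber [simp]: "edges (renumber g \<sigma>) = rename g (edges \<sigma>)"
  by (simp add: renumber_def rename_def)

lemma regular_renumber [simp]: "regular (renumber g \<sigma>) \<longleftrightarrow> regular \<sigma>"
  by (simp add: renumber_def regular_def)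

lemma edges_mw_union [simp]: "edges (mw_union \<sigma> \<tau>) = edges \<sigma> \<union> edges \<tau>"
  by (simp add: mw_union_def)

lemma regular_mw_union [simp]: "regular (mw_union \<sigma> \<tau>) \<longleftrightarrow> regular \<sigma> \<and> regular \<tau>"
  by (simp add: mw_union_def regular_def)

text \<open>Places the first premise of a cut so that each vertex of its cut formula falls on its
  partner in the dual block of the second premise. All other vertices go beyond
  \<open>d + 2 * a\<close>, where the side-by-side layout of \<open>cut_mw\<close> puts
  them.\<close>

definition cut_embed :: "nat \<Rightarrow> nat \<Rightarrow> nat \<Rightarrow> nat" where
  "cut_embed d a v = (if v \<le> a then d + a + 1 - v else d + a + v)"

lemma mem_cut_pairs:
  "(x, y) \<in> cut_pairs d a \<longleftrightarrow> d < x \<and> x \<le> d + 2 * a \<and> x + y = 2 * d + 2 * a + 1"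
proof
  assume *: "d < x \<and> x \<le> d + 2 * a \<and> x + y = 2 * d + 2 * a + 1"
  show "(x, y) \<in> cut_pairs d a"
  proof (cases "x \<le> d + a")
    case True
    then have "x = d + (a + 1 - (y - (d + a)))" "y = d + a + (y - (d + a))" "y - (d + a) \<in> {1..a}"
      using * by auto
    then show ?thesis unfolding cut_pairs_def by blast
  next
    case False
    then have "y = d + (a + 1 - (x - (d + a)))" "x = d + a + (x - (d + a))" "x - (d + a) \<in> {1..a}"
      using * by auto
    then show ?thesis unfolding cut_pairs_def by blast
  qed
qed (auto simp: cut_pairs_def)

lemma Field_cut_pairs: "v \<in> Field (cut_pairs d a) \<longleftrightarrow> d < v \<and> v \<le> d + 2 * a"
proof
  assume "d < v \<and> v \<le> d + 2 * a"
  then have "(v, 2 * d + 2 * a + 1 - v) \<in> cut_pairs d a" by (auto simp: mem_cut_pairs)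
  then show "v \<in> Field (cut_pairs d a)" by (rule FieldI1)
qed (auto simp: Field_def mem_cut_pairs)

lemma cut_mw_eq_hide:
  fixes \<sigma> \<tau> :: "'t multiword" and a d :: nat
  assumes E1: "matching S1 T1 (edges \<sigma>)" and E2: "matching S2 T2 (edges \<tau>)"
    and disj: "S1 \<inter> T1 = {}" "S2 \<inter> T2 = {}"
    and pos: "0 \<notin> S1 \<union> T1" and le: "\<And>v. v \<in> S2 \<union> T2 \<Longrightarrow> v \<le> d + a"
  defines "H \<equiv> rename (cut_embed d a) (edges \<sigma>) \<union> edges \<tau>"
  shows "edges (cut_mw d a \<sigma> \<tau>) =
      rename (\<lambda>v. if v \<le> d then v else v - 2 * a) (hide {d<..d + a} H)" (is ?edges)
    and "regular (cut_mw d a \<sigma> \<tau>) \<longleftrightarrow> regular \<sigma> \<and> regular \<tau> \<and> \<not> cyc {d<..d + a} H" (is ?reg)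
proof -
  \<comment> \<open>The two members of a pair in \<open>cut_pairs d a\<close> add up to
    \<open>2 * d + 2 * a + 1\<close>; the map folds the upper block onto the lower one
    accordingly.\<close>
  define q where "q v = (if d + a < v \<and> v \<le> d + 2 * a then 2 * d + 2 * a + 1 - v else v)" for v
  let ?mw = "mw_union (renumber (\<lambda>v. d + a + v) \<sigma>) \<tau>"
  have edges: "edges ?mw = rename (\<lambda>v. d + a + v) (edges \<sigma>) \<union> edges \<tau>" by simp
  have m: "matching ((\<lambda>v. d + a + v) ` S1 \<union> S2) ((\<lambda>v. d + a + v) ` T1 \<union> T2) (edges ?mw)"
    unfolding edges using le pos
    by (intro matching_Un matching_rename E1 E2) (fastforce simp: inj_on_def not_le[symmetric])+
  have disj': "((\<lambda>v. d + a + v) ` S1 \<union> S2) \<inter> ((\<lambda>v. d + a + v) ` T1 \<union> T2) = {}"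
    using disj pos le by (fastforce simp: not_le[symmetric])
  have ren: "rename q (edges ?mw) = H"
  proof -
    have "q (d + a + v) = cut_embed d a v" if "v \<in> S1 \<union> T1" for v
    proof -
      have "v \<noteq> 0" using that pos by metis
      then show ?thesis by (auto simp: q_def cut_embed_def)
    qed
    moreover have "q v = v" if "v \<in> S2 \<union> T2" for v using le[OF that] by (auto simp: q_def)
    ultimately show ?thesis unfolding edges rename_Un rename_comp H_def
      using matching_vertices[OF E1] matching_vertices[OF E2]
      by (intro arg_cong2[where f = "(\<union>)"] rename_cong rename_ident) auto
  qed
  have c1: "(edge_target e, edge_source e') \<in> cut_pairs d a \<longleftrightarrow>
      q (edge_target e) = q (edge_source e') \<and> q (edge_target e) \<in> {d<..d + a}"
    if "e \<in> edges ?mw" "e' \<in> edges ?mw" for e e'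
  proof -
    \<comment> \<open>A vertex also has the same image as itself, whereas \<open>cut_pairs\<close>
      relates only different vertices. The discrepancy does not arise: before gluing no vertex is
      both a target and a source.\<close>
    have "edge_target e \<noteq> edge_source e'"
      using that matchingD[OF m] disj' by (metis IntI empty_iff prod.collapse)
    then show ?thesis by (auto simp: mem_cut_pairs q_def split: if_splits)
  qed
  have c2: "v \<in> Field (cut_pairs d a) \<longleftrightarrow> q v \<in> {d<..d + a}" for v
    by (auto simp: Field_cut_pairs q_def)
  have c3: "q v = v" if "v \<notin> Field (cut_pairs d a)" for v
    using that by (auto simp: Field_cut_pairs q_def)
  note glue = glued_edges_eq_hide[of "edges ?mw" "cut_pairs d a" q "{d<..d + a}", OF c1 c2 c3]
    closed_cycles_eq_empty_iff[of "edges ?mw" "cut_pairs d a" q "{d<..d + a}", OF c1 c2 c3]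
  show ?edges using glue(1) unfolding ren by (simp add: cut_mw_def glue_def)
  show ?reg using glue(2) regular_glue[OF matching_finite[OF m]] unfolding ren by (auto simp: cut_mw_def)
qed


section \<open>Typed vertices: polarities and multisets of formulas with named vertices\<close>

section \<open>Interfaces and contexts\<close>

definition signs :: "boundary \<Rightarrow> bool list" where
  "signs X = map (\<lambda>i. i \<in> lefts X) [1..<Suc (bsize X)]"

lemma length_signs [simp]: "length (signs X) = bsize X"
  by (simp add: signs_def)

lemma nth_signs: "k < bsize X \<Longrightarrow> signs X ! k \<longleftrightarrow> Suc k \<in> lefts X"
  by (simp add: signs_def del: upt_Suc)

lemma signs_btensor: "signs (X \<otimes>\<^sub>b Y) = signs X @ signs Y"
proof (rule nth_equalityI)
  fix k assume "k < length (signs (X \<otimes>\<^sub>b Y))"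
  then show "signs (X \<otimes>\<^sub>b Y) ! k = (signs X @ signs Y) ! k"
    using lefts_subset[of X] by (auto simp: nth_signs nth_append mem_lefts_btensor Suc_diff_le)
qed simp

lemma signs_bdual: "signs (bdual X) = rev (map Not (signs X))"
proof (rule nth_equalityI)
  fix k assume k: "k < length (signs (bdual X))"
  then have "Suc (bsize X - Suc k) = bsize X - k" by auto
  with k show "signs (bdual X) ! k = rev (map Not (signs X)) ! k"
    by (simp add: nth_signs rev_nth mem_lefts_bdual)
qed simp

definition sources :: "bool list \<Rightarrow> nat list \<Rightarrow> nat set" where
  "sources p us = {v. (v, True) \<in> set (zip us p)}"

definition targets :: "bool list \<Rightarrow> nat list \<Rightarrow> nat set" where
  "targets p us = {v. (v, False) \<in> set (zip us p)}"

lemma mem_sources: "length us = length p \<Longrightarrow> v \<in> sources p us \<longleftrightarrow> (\<exists>k < length p. v = us ! k \<and> p ! k)"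
  by (auto simp: sources_def in_set_zip)

lemma mem_targets: "length us = length p \<Longrightarrow> v \<in> targets p us \<longleftrightarrow> (\<exists>k < length p. v = us ! k \<and> \<not> p ! k)"
  by (auto simp: targets_def in_set_zip)

lemma sources_append:
  "length us = length p \<Longrightarrow> sources (p @ q) (us @ vs) = sources p us \<union> sources q vs"
  by (auto simp: sources_def)

lemma targets_append:
  "length us = length p \<Longrightarrow> targets (p @ q) (us @ vs) = targets p us \<union> targets q vs"
  by (auto simp: targets_def)

lemma sources_dual:
  "length us = length p \<Longrightarrow> sources (rev (map Not p)) (rev us) = targets p us"
  by (force simp: sources_def targets_def zip_rev zip_map2)

lemma targets_dual:
  "length us = length p \<Longrightarrow> targets (rev (map Not p)) (rev us) = sources p us"
  by (force simp: sources_def targets_def zip_rev zip_map2)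

lemma sources_map: "sources p (map g us) = g ` sources p us"
  by (force simp: sources_def zip_map1)

lemma targets_map: "targets p (map g us) = g ` targets p us"
  by (force simp: targets_def zip_map1)

lemma sources_Un_targets: "length us = length p \<Longrightarrow> sources p us \<union> targets p us = set us"
  unfolding set_eq_iff Un_iff mem_sources mem_targets in_set_conv_nth by metis

lemma sources_Int_targets: "\<lbrakk>length us = length p; distinct us\<rbrakk> \<Longrightarrow> sources p us \<inter> targets p us = {}"
  by (auto simp: mem_sources mem_targets nth_eq_iff_index_eq)

lemma sources_subset: "sources p us \<subseteq> set us" and targets_subset: "targets p us \<subseteq> set us"
  by (auto simp: sources_def targets_def dest: set_zip_leftD)

text \<open>
  In a slot \<open>(A, us)\<close>, the list \<open>us\<close> names the vertices of the boundary of \<open>A\<close> in their order. As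
  duality reverses boundaries, the slot \<open>(neg A, rev us)\<close> has the same vertices, each already
  identified with its partner.
\<close>

type_synonym 'n slot = "'n formula \<times> nat list"

lemma neg_neg [simp]: "neg (neg A) = A"
  by (induction A) auto

lemma size_neg [simp]: "size (neg A) = size A"
  by (induction A) auto

definition slot_vertices :: "'n slot multiset \<Rightarrow> nat set" where
  "slot_vertices M = (\<Union>x \<in> set_mset M. set (snd x))"

definition rename_slots :: "(nat \<Rightarrow> nat) \<Rightarrow> 'n slot multiset \<Rightarrow> 'n slot multiset" where
  "rename_slots g M = image_mset (\<lambda>(A, us). (A, map g us)) M"

lemma slot_vertices_simps [simp]:
  "slot_vertices {#} = {}"
  "slot_vertices (add_mset x M) = set (snd x) \<union> slot_vertices M"
  "slot_vertices (M + N) = slot_vertices M \<union> slot_vertices N"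
  by (auto simp: slot_vertices_def)

lemma slot_vertices_rename [simp]: "slot_vertices (rename_slots g M) = g ` slot_vertices M"
  by (induction M) (auto simp: slot_vertices_def rename_slots_def)

lemma rename_slots_simps [simp]:
  "rename_slots g {#} = {#}"
  "rename_slots g (add_mset (A, us) M) = add_mset (A, map g us) (rename_slots g M)"
  "rename_slots g (M + N) = rename_slots g M + rename_slots g N"
  by (auto simp: rename_slots_def)

lemma finite_slot_vertices [simp]: "finite (slot_vertices M)"
  by (simp add: slot_vertices_def)

locale boundaries =
  fixes b :: "'n \<Rightarrow> boundary"
begin

definition pol :: "'n formula \<Rightarrow> bool list" where
  "pol A = signs (formula_boundary b A)"

lemma pol_neg: "pol (neg A) = rev (map Not (pol A))"
  by (simp add: pol_def formula_boundary_neg signs_bdual)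

lemma pol_Tensor: "pol (Tensor A B) = pol A @ pol B"
  by (simp add: pol_def signs_btensor)

lemma pol_Par: "pol (Par A B) = pol B @ pol A"
  by (simp add: pol_def signs_btensor)

lemma length_pol_neg [simp]: "length (pol (neg A)) = length (pol A)"
  by (simp add: pol_neg)

definition slot_sources :: "'n slot multiset \<Rightarrow> nat set" where
  "slot_sources M = (\<Union>x \<in> set_mset M. sources (pol (fst x)) (snd x))"

definition slot_targets :: "'n slot multiset \<Rightarrow> nat set" where
  "slot_targets M = (\<Union>x \<in> set_mset M. targets (pol (fst x)) (snd x))"

lemma slot_sources_simps [simp]:
  "slot_sources {#} = {}"
  "slot_sources (add_mset x M) = sources (pol (fst x)) (snd x) \<union> slot_sources M"
  "slot_sources (M + N) = slot_sources M \<union> slot_sources N"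
  by (auto simp: slot_sources_def)

lemma slot_targets_simps [simp]:
  "slot_targets {#} = {}"
  "slot_targets (add_mset x M) = targets (pol (fst x)) (snd x) \<union> slot_targets M"
  "slot_targets (M + N) = slot_targets M \<union> slot_targets N"
  by (auto simp: slot_targets_def)

text \<open>No name occurs twice in all of \<open>M\<close>. Counting names, instead of comparing
  slots, also excludes a slot that occurs twice in the multiset, unless its boundary is
  empty.\<close>

definition wf_slots :: "'n slot multiset \<Rightarrow> bool" where
  "wf_slots M \<longleftrightarrow> (\<forall>x \<in># M. length (snd x) = length (pol (fst x))) \<and>
     (\<forall>v. count (\<Sum>x\<in>#M. mset (snd x)) v \<le> 1)"

lemma wf_slots_empty [simp]: "wf_slots {#}"
  by (simp add: wf_slots_def)

lemma mem_slot_vertices: "v \<in> slot_vertices M \<longleftrightarrow> count (\<Sum>x\<in>#M. mset (snd x)) v \<noteq> 0"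
  by (induction M) (auto simp: count_eq_zero_iff)

lemma wf_slots_union:
  "wf_slots (M + N) \<longleftrightarrow> wf_slots M \<and> wf_slots N \<and> slot_vertices M \<inter> slot_vertices N = {}"
proof -
  have "(\<forall>v. f v + g v \<le> Suc 0) \<longleftrightarrow> (\<forall>v. f v \<le> Suc 0) \<and> (\<forall>v. g v \<le> Suc 0) \<and> (\<forall>v. \<not> (f v \<noteq> 0 \<and> g v \<noteq> 0))"
    for f g :: "nat \<Rightarrow> nat"
  proof
    assume *: "\<forall>v. f v + g v \<le> Suc 0"
    have "f v \<le> Suc 0 \<and> g v \<le> Suc 0 \<and> \<not> (f v \<noteq> 0 \<and> g v \<noteq> 0)" for v
      using *[rule_format, of v] by auto
    then show "(\<forall>v. f v \<le> Suc 0) \<and> (\<forall>v. g v \<le> Suc 0) \<and> (\<forall>v. \<not> (f v \<noteq> 0 \<and> g v \<noteq> 0))" by blast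
  next
    assume *: "(\<forall>v. f v \<le> Suc 0) \<and> (\<forall>v. g v \<le> Suc 0) \<and> (\<forall>v. \<not> (f v \<noteq> 0 \<and> g v \<noteq> 0))"
    show "\<forall>v. f v + g v \<le> Suc 0"
    proof
      fix v
      have "f v \<le> Suc 0" "g v \<le> Suc 0" "f v = 0 \<or> g v = 0" using * by auto
      then show "f v + g v \<le> Suc 0" by auto
    qed
  qed
  from this[of "count (\<Sum>x\<in>#M. mset (snd x))" "count (\<Sum>x\<in>#N. mset (snd x))"] show ?thesis
    unfolding wf_slots_def disjoint_iff mem_slot_vertices
    by (simp only: image_mset_union sum_mset.union count_union set_mset_union ball_Un One_nat_def) blast
qed

lemma wf_slots_single:
  "wf_slots {#(A, us)#} \<longleftrightarrow> length us = length (pol A) \<and> distinct us"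
proof -
  have "(\<forall>v. count (mset us) v \<le> Suc 0) \<longleftrightarrow> distinct us"
  proof
    assume "\<forall>v. count (mset us) v \<le> Suc 0"
    then show "distinct us"
      by (simp add: distinct_count_atmost_1) (metis One_nat_def Suc_leI count_mset_0_iff le_antisym neq0_conv)
  qed (simp add: distinct_count_atmost_1)
  then show ?thesis by (simp add: wf_slots_def)
qed

lemma wf_slots_add:
  "wf_slots (add_mset (A, us) M) \<longleftrightarrow> length us = length (pol A) \<and> distinct us \<and>
     set us \<inter> slot_vertices M = {} \<and> wf_slots M"
  using wf_slots_union[of "{#(A, us)#}" M] by (auto simp: wf_slots_single)

lemma wf_slots_sources_Un_targets:
  "wf_slots M \<Longrightarrow> slot_sources M \<union> slot_targets M = slot_vertices M"
proof (induction M)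
  case (add x M)
  obtain A us where x: "x = (A, us)" by fastforce
  show ?case using add sources_Un_targets[of us "pol A"] by (auto simp: x wf_slots_add)
qed simp

lemma slot_sources_subset: "slot_sources M \<subseteq> slot_vertices M"
  and slot_targets_subset: "slot_targets M \<subseteq> slot_vertices M"
  using sources_subset targets_subset
  by (fastforce simp: slot_sources_def slot_targets_def slot_vertices_def)+

lemma wf_slots_sources_Int_targets:
  "wf_slots M \<Longrightarrow> slot_sources M \<inter> slot_targets M = {}"
proof (induction M)
  case (add x M)
  obtain A us where x: "x = (A, us)" by fastforce
  have "sources (pol A) us \<inter> slot_targets M = {}" "slot_sources M \<inter> targets (pol A) us = {}"
    using add.prems sources_subset[of "pol A" us] targets_subset[of "pol A" us]
      slot_sources_subset[of M] slot_targets_subset[of M] by (auto simp: x wf_slots_add)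
  then show ?case using add sources_Int_targets[of us "pol A"] by (auto simp: x wf_slots_add)
qed simp

lemma slot_sources_rename [simp]: "slot_sources (rename_slots g M) = g ` slot_sources M"
  by (induction M) (auto simp: sources_map)

lemma slot_targets_rename [simp]: "slot_targets (rename_slots g M) = g ` slot_targets M"
  by (induction M) (auto simp: targets_map)

lemma wf_slots_rename:
  "\<lbrakk>wf_slots M; inj_on g (slot_vertices M)\<rbrakk> \<Longrightarrow> wf_slots (rename_slots g M)"
proof (induction M)
  case (add x M)
  obtain A us where x: "x = (A, us)" by fastforce
  have "inj_on g (set us)" "inj_on g (slot_vertices M)"
    using add.prems(2) by (auto simp: x intro: inj_on_subset)
  moreover have "g ` set us \<inter> g ` slot_vertices M = {}"
    using add.prems by (auto simp: x wf_slots_add inj_on_def disjoint_iff)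
  ultimately show ?case using add by (auto simp: x wf_slots_add distinct_map)
qed simp

end

section \<open>Consecutive numbering of the vertices of a sequent\<close>

subsection \<open>The standard numbering of a sequent\<close>

definition block :: "nat \<Rightarrow> nat \<Rightarrow> nat list" where
  "block d n = [Suc d..<Suc (d + n)]"

lemma length_block [simp]: "length (block d n) = n"
  and set_block [simp]: "set (block d n) = {d<..d + n}"
  and distinct_block [simp]: "distinct (block d n)"
  by (auto simp: block_def)

lemma nth_block [simp]: "k < n \<Longrightarrow> block d n ! k = Suc (d + k)"
  by (simp add: block_def del: upt_Suc)

lemma map_block: "(\<And>v. d < v \<Longrightarrow> v \<le> d + n \<Longrightarrow> g v + d = v + d') \<Longrightarrow> map g (block d n) = block d' n"
proof (rule nth_equalityI)
  fix k assume g: "\<And>v. d < v \<Longrightarrow> v \<le> d + n \<Longrightarrow> g v + d = v + d'" and k: "k < length (map g (block d n))"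
  have "g (Suc (d + k)) + d = Suc (d + k) + d'" using k by (intro g) auto
  then show "map g (block d n) ! k = block d' n ! k" using k by simp
qed simp

lemma block_append: "block d m @ block (d + m) n = block d (m + n)"
  using upt_add_eq_append[of "Suc d" "Suc (d + m)" n] by (simp add: block_def add.assoc del: upt_Suc)

lemma sources_block: "sources (signs X) (block d (bsize X)) = (+) d ` lefts X"
proof -
  have "v \<in> sources (signs X) (block d (bsize X)) \<longleftrightarrow> v \<in> (+) d ` lefts X" for v
  proof
    assume "v \<in> (+) d ` lefts X"
    then obtain i where i: "i \<in> lefts X" "v = d + i" by auto
    then have "1 \<le> i" "i \<le> bsize X" using lefts_subset by force+
    then show "v \<in> sources (signs X) (block d (bsize X))"
      using i by (auto simp: mem_sources nth_signs intro!: exI[of _ "i - 1"])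
  qed (auto simp: mem_sources nth_signs)
  then show ?thesis by blast
qed

lemma targets_block: "targets (signs X) (block d (bsize X)) = (+) d ` rights X"
proof -
  have "v \<in> targets (signs X) (block d (bsize X)) \<longleftrightarrow> v \<in> (+) d ` rights X" for v
  proof
    assume "v \<in> (+) d ` rights X"
    then obtain i where i: "i \<notin> lefts X" "1 \<le> i" "i \<le> bsize X" "v = d + i" by (auto simp: rights_def)
    then show "v \<in> targets (signs X) (block d (bsize X))"
      by (auto simp: mem_targets nth_signs intro!: exI[of _ "i - 1"])
  qed (auto simp: mem_targets nth_signs rights_def)
  then show ?thesis by blast
qed

lemma lefts_btensor: "lefts (X \<otimes>\<^sub>b Y) = lefts X \<union> (+) (bsize X) ` lefts Y"
proof -
  have "i \<in> lefts X \<or> bsize X < i \<and> i - bsize X \<in> lefts Y \<longleftrightarrow> i \<in> lefts X \<union> (+) (bsize X) ` lefts Y" for i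
    using lefts_subset[of Y] by (auto simp: image_iff intro!: bexI[of _ "i - bsize X"])
  then show ?thesis by (intro set_eqI) (simp only: mem_lefts_btensor)
qed

lemma rights_btensor: "rights (X \<otimes>\<^sub>b Y) = rights X \<union> (+) (bsize X) ` rights Y"
proof -
  have "i \<in> rights (X \<otimes>\<^sub>b Y) \<longleftrightarrow> i \<in> rights X \<or> i \<in> (+) (bsize X) ` rights Y" for i
  proof (cases "i \<le> bsize X")
    case True
    then show ?thesis by (auto simp: rights_def mem_lefts_btensor)
  next
    case False
    then show ?thesis using lefts_subset[of X]
      by (auto simp: rights_def mem_lefts_btensor image_iff intro!: bexI[of _ "i - bsize X"])
  qed
  then show ?thesis by blast
qed

lemma bsize_bunit [simp]: "bsize bunit = 0" and lefts_bunit [simp]: "lefts bunit = {}"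
  by (transfer, simp)+

context boundaries
begin

abbreviation fsize :: "'n formula \<Rightarrow> nat" where
  "fsize A \<equiv> bsize (formula_boundary b A)"

abbreviation ssize :: "'n formula list \<Rightarrow> nat" where
  "ssize \<Gamma> \<equiv> bsize (sequent_boundary b \<Gamma>)"

lemma length_pol [simp]: "length (pol A) = fsize A"
  by (simp add: pol_def)

text \<open>The first formula receives the highest numbers, because boundaries of sequents are read
  from right to left. The offset \<open>d\<close> allows for a sequent that is only the left part of
  a larger one.\<close>

fun standard_slots :: "nat \<Rightarrow> 'n formula list \<Rightarrow> 'n slot list" where
  "standard_slots d [] = []"
| "standard_slots d (A # \<Gamma>) = (A, block (d + ssize \<Gamma>) (fsize A)) # standard_slots d \<Gamma>"

lemma ssize_append [simp]: "ssize (\<Gamma> @ \<Delta>) = ssize \<Gamma> + ssize \<Delta>"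
  by (induction \<Gamma>) auto

lemma standard_slots_append:
  "standard_slots d (\<Gamma> @ \<Delta>) = standard_slots (d + ssize \<Delta>) \<Gamma> @ standard_slots d \<Delta>"
  by (induction \<Gamma>) (auto simp: add_ac)

lemma map_fst_standard_slots [simp]: "map fst (standard_slots d \<Gamma>) = \<Gamma>"
  by (induction \<Gamma>) auto

lemma map_standard_slots:
  assumes "\<And>v. d < v \<Longrightarrow> v \<le> d + ssize \<Gamma> \<Longrightarrow> g v + d = v + d'"
  shows "map (\<lambda>(A, us). (A, map g us)) (standard_slots d \<Gamma>) = standard_slots d' \<Gamma>"
  using assms
proof (induction \<Gamma>)
  case (Cons A \<Gamma>)
  have "map g (block (d + ssize \<Gamma>) (fsize A)) = block (d' + ssize \<Gamma>) (fsize A)"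
  proof (rule map_block)
    fix v assume "d + ssize \<Gamma> < v" "v \<le> d + ssize \<Gamma> + fsize A"
    then show "g v + (d + ssize \<Gamma>) = v + (d' + ssize \<Gamma>)" using Cons.prems[of v] by simp
  qed
  then show ?case using Cons by simp
qed simp

lemma rename_standard_slots:
  assumes "\<And>v. d < v \<Longrightarrow> v \<le> d + ssize \<Gamma> \<Longrightarrow> g v + d = v + d'"
  shows "rename_slots g (mset (standard_slots d \<Gamma>)) = mset (standard_slots d' \<Gamma>)"
  using map_standard_slots[OF assms] by (simp add: rename_slots_def flip: mset_map)

lemma slot_vertices_standard_slots [simp]:
  "slot_vertices (mset (standard_slots d \<Gamma>)) = {d<..d + ssize \<Gamma>}"
  by (induction \<Gamma>) auto

lemma wf_standard_slots: "wf_slots (mset (standard_slots d \<Gamma>))"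
  by (induction \<Gamma>) (auto simp: wf_slots_add)

lemma slot_sources_standard_slots:
  "slot_sources (mset (standard_slots d \<Gamma>)) = (+) d ` lefts (sequent_boundary b \<Gamma>)"
  by (induction \<Gamma>) (auto simp: pol_def sources_block lefts_btensor image_Un image_image add_ac)

lemma slot_targets_standard_slots:
  "slot_targets (mset (standard_slots d \<Gamma>)) = (+) d ` rights (sequent_boundary b \<Gamma>)"
  by (induction \<Gamma>)
    (auto simp: pol_def targets_block rights_btensor image_Un image_image add_ac rights_def[of bunit])

end


section \<open>Axiom links and the rearrangement of nested pluggings\<close>

subsection \<open>Identity links\<close>

text \<open>The identity on a formula of polarity \<open>p\<close> whose vertices are named
  \<open>vs\<close>, while \<open>rev us\<close> names those of its dual: at a left end point the
  edge leaves \<open>vs\<close>, at a right one it enters \<open>vs\<close>.\<close>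

definition link :: "bool list \<Rightarrow> nat list \<Rightarrow> nat list \<Rightarrow> 't edge set" where
  "link p us vs = {(vs ! k, [], us ! k) | k. k < length p \<and> p ! k} \<union>
     {(us ! k, [], vs ! k) | k. k < length p \<and> \<not> p ! k}"

text \<open>Identity links are symmetric under exchanging a formula and its dual. This turns one
  output position in \<open>valid_link\<close> into the other.\<close>

lemma link_dual:
  assumes "length us = length p" "length vs = length p"
  shows "link (rev (map Not p)) (rev vs) (rev us) = link p us vs"
proof -
  have r: "(\<exists>k. P (n - Suc k) \<and> k < n) \<longleftrightarrow> (\<exists>k. P k \<and> k < n)" for P and n :: nat
  proof
    assume "\<exists>k. P k \<and> k < n"
    then obtain k where "P k" "k < n" by blast
    then have "P (n - Suc (n - Suc k)) \<and> n - Suc k < n" by (simp add: Suc_diff_Suc)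
    then show "\<exists>k. P (n - Suc k) \<and> k < n" by blast
  next
    assume "\<exists>k. P (n - Suc k) \<and> k < n"
    then obtain k where "P (n - Suc k)" "k < n" by blast
    then show "\<exists>k. P k \<and> k < n" by (intro exI[of _ "n - Suc k"]) auto
  qed
  have 1: "(i, w, j) \<in> link (rev (map Not p)) (rev vs) (rev us) \<longleftrightarrow>
     (\<exists>k. (i = us ! (length p - Suc k) \<and> w = [] \<and> j = vs ! (length p - Suc k) \<and> \<not> p ! (length p - Suc k)) \<and> k < length p) \<or>
     (\<exists>k. (i = vs ! (length p - Suc k) \<and> w = [] \<and> j = us ! (length p - Suc k) \<and> p ! (length p - Suc k)) \<and> k < length p)" for i w j
    using assms unfolding link_def by (auto simp: rev_nth)
  show ?thesis
    by (rule edge_set_eqI)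
       (unfold 1 r[of "\<lambda>k. _ = us ! k \<and> _ = [] \<and> _ = vs ! k \<and> \<not> p ! k"]
         r[of "\<lambda>k. _ = vs ! k \<and> _ = [] \<and> _ = us ! k \<and> p ! k"], auto simp: link_def)
qed

lemma matching_link:
  assumes "length us = length p" "length vs = length p" "distinct us" "distinct vs" "set us \<inter> set vs = {}"
  shows "matching (sources p vs \<union> targets p us) (targets p vs \<union> sources p us) (link p us vs)"
proof (rule matchingI)
  show "finite (sources p vs \<union> targets p us)" "finite (targets p vs \<union> sources p us)"
    using finite_subset[OF sources_subset] finite_subset[OF targets_subset] by auto
  have ne: "us ! k \<noteq> vs ! l" if "k < length p" "l < length p" for k l
    using assms that by (metis disjoint_iff nth_mem)
  have eq: "us ! k = us ! l \<longleftrightarrow> k = l" "vs ! k = vs ! l \<longleftrightarrow> k = l" if "k < length p" "l < length p" for k l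
    using assms that by (auto simp: nth_eq_iff_index_eq)
  show "w' = w \<and> j' = j" if "(i, w, j) \<in> link p us vs" "(i, w', j') \<in> link p us vs" for i w j w' j'
    using that ne eq unfolding link_def by (auto; metis)
  show "w' = w \<and> i' = i" if "(i, w, j) \<in> link p us vs" "(i', w', j) \<in> link p us vs" for i w j w' i'
    using that ne eq unfolding link_def by (auto; metis)
qed (use assms in \<open>auto simp: link_def mem_sources mem_targets\<close>)

text \<open>Every link edge joins a vertex of \<open>us\<close> to one of \<open>vs\<close>, so it
  can only prolong an edge of \<open>E\<close> by one step at either end. Plugging a link therefore
  amounts to renaming \<open>us\<close> to \<open>vs\<close>, and no cycle can arise.\<close>

lemma hide_link:
  assumes len: "length us = length p" "length vs = length p"
    and dist: "distinct us" "distinct vs" "set us \<inter> set vs = {}"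
    and E: "matching S T E" "S \<inter> set us = sources p us" "T \<inter> set us = targets p us"
    and g: "\<And>k. k < length p \<Longrightarrow> g (us ! k) = vs ! k" "\<And>v. v \<in> S \<union> T \<Longrightarrow> v \<notin> set us \<Longrightarrow> g v = v"
  shows "hide (set us) (E \<union> link p us vs) = rename g E" "\<not> cyc (set us) (E \<union> link p us vs)"
proof -
  let ?L = "link p us vs :: 'a edge set"
  have disj: "sources p us \<inter> targets p us = {}" using len dist by (simp add: sources_Int_targets)
  have L: "(a, w, c) \<in> ?L \<longleftrightarrow> w = [] \<and> (c \<in> sources p us \<and> a = g c \<or> a \<in> targets p us \<and> c = g a)" for a w c
    using len g(1) unfolding link_def by (fastforce simp: mem_sources mem_targets)
  have gv: "g v \<in> set vs" if "v \<in> set us" for v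
    using that g(1) len by (auto simp: in_set_conv_nth)
  have gu: "g v \<notin> set us" if "v \<in> set us" for v using gv[OF that] dist by auto
  have sub: "sources p us \<subseteq> set us" "targets p us \<subseteq> set us" by (rule sources_subset targets_subset)+
  \<comment> \<open>Paths through \<open>us\<close> have the form link, edge of \<open>E\<close>,
    link, where either link may be missing; two consecutive link edges would meet in
    \<open>vs\<close>, which is not internal.\<close>
  have char: "internal_path (set us) (E \<union> ?L) a w c \<Longrightarrow>
     (\<exists>i j. (i, w, j) \<in> E \<and> (a = i \<or> a = g i) \<and> (c = j \<or> c = g j)) \<or> (a, w, c) \<in> ?L" for a w c
  proof (induction rule: internal_path.induct)
    case (extend a w c u k)
    from extend.IH show ?case
    proof
      assume "\<exists>i j. (i, w, j) \<in> E \<and> (a = i \<or> a = g i) \<and> (c = j \<or> c = g j)"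
      then obtain i j where ij: "(i, w, j) \<in> E" "a = i \<or> a = g i" "c = j \<or> c = g j" by blast
      then have "j \<in> T" "i \<in> S" using matchingD[OF E(1)] by auto
      have c: "c = j"
      proof (rule ccontr)
        assume "c \<noteq> j"
        then have "c = g j" using ij by simp
        then show False using extend.hyps(2) gu g(2)[of j] \<open>j \<in> T\<close> \<open>c \<noteq> j\<close> by auto
      qed
      then have ct: "c \<in> targets p us" using \<open>j \<in> T\<close> extend.hyps(2) E(3) by blast
      then have "c \<notin> S" using E(2) disj sub by blast
      then have "(c, u, k) \<in> ?L" using extend.hyps(3) matchingD[OF E(1)] by blast
      then have "u = [] \<and> k = g c"
        using ct gu sub disj L[of c u k] by blast
      then show ?case using ij c by auto
    next
      assume "(a, w, c) \<in> ?L"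
      then have w: "w = []" and ac: "c \<in> sources p us" "a = g c"
        using L[of a w c] extend.hyps(2) gu sub by auto
      then have "c \<notin> targets p us" using disj by blast
      then have "(c, u, k) \<in> E" using extend.hyps(3) L[of c u k] ac extend.hyps(2) gu sub by auto
      then show ?case using w ac by auto
    qed
  qed auto
  show "\<not> cyc (set us) (E \<union> ?L)"
  proof
    assume "cyc (set us) (E \<union> ?L)"
    then obtain v w where v: "v \<in> set us" "internal_path (set us) (E \<union> ?L) v w v" by (auto simp: cyc_def)
    have "g v \<noteq> v" using gu[OF v(1)] v(1) by metis
    then have "(v, w, v) \<notin> ?L" using L[of v w v] by metis
    then obtain i j where ij: "(i, w, j) \<in> E" "v = i \<or> v = g i" "v = j \<or> v = g j" using char[OF v(2)] by blast
    then have "i \<in> S" "j \<in> T" using matchingD[OF E(1)] by auto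
    then have "v = i" "v = j" using ij v(1) gu g(2) by (metis UnCI)+
    then show False using \<open>i \<in> S\<close> \<open>j \<in> T\<close> E(2,3) v(1) disj by blast
  qed
  show "hide (set us) (E \<union> ?L) = rename g E"
  proof (rule edge_set_eqI)
    fix a w c
    show "(a, w, c) \<in> hide (set us) (E \<union> ?L) \<longleftrightarrow> (a, w, c) \<in> rename g E"
    proof
      assume "(a, w, c) \<in> hide (set us) (E \<union> ?L)"
      then have h: "internal_path (set us) (E \<union> ?L) a w c" "a \<notin> set us" "c \<notin> set us" by (auto simp: mem_hide)
      have "(a, w, c) \<notin> ?L" using L[of a w c] h sub by auto
      then obtain i j where ij: "(i, w, j) \<in> E" "a = i \<or> a = g i" "c = j \<or> c = g j" using char[OF h(1)] by blast
      then have "i \<in> S" "j \<in> T" using matchingD[OF E(1)] by auto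
      then have "a = g i" "c = g j" using ij h g(2) by (metis UnCI)+
      then show "(a, w, c) \<in> rename g E" using ij by (auto simp: mem_rename)
    next
      assume "(a, w, c) \<in> rename g E"
      then obtain i j where ij: "(i, w, j) \<in> E" "a = g i" "c = g j" by (auto simp: mem_rename)
      then have ST: "i \<in> S" "j \<in> T" using matchingD[OF E(1)] by auto
      have out: "a \<notin> set us" "c \<notin> set us" using ij ST gu g(2) by (metis UnCI)+
      have "internal_path (set us) (E \<union> ?L) i w j" using ij by (auto intro: internal_path.single)
      then have 1: "internal_path (set us) (E \<union> ?L) a w j"
      proof (cases "i \<in> set us")
        case True
        then have "i \<in> sources p us" using ST E(2) by blast
        then have "(a, [], i) \<in> ?L" using L ij by blast
        then have "internal_path (set us) (E \<union> ?L) a [] i" by (auto intro: internal_path.single)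
        then have "internal_path (set us) (E \<union> ?L) a ([] @ w) j"
          using ij True by (intro internal_path.extend) auto
        then show ?thesis by simp
      next
        case False
        then show ?thesis using ij ST g(2)[of i] by (auto intro: internal_path.single)
      qed
      have "internal_path (set us) (E \<union> ?L) a w c"
      proof (cases "j \<in> set us")
        case True
        then have "j \<in> targets p us" using ST E(3) by blast
        then have "(j, [], c) \<in> ?L" using L ij by blast
        then have "internal_path (set us) (E \<union> ?L) a (w @ []) c"
          using 1 True by (intro internal_path.extend) auto
        then show ?thesis by simp
      next
        case False
        then show ?thesis using 1 ij ST g(2)[of j] by auto
      qed
      then show "(a, w, c) \<in> hide (set us) (E \<union> ?L)" using out by (simp add: mem_hide)
    qed
  qed
qed

lemma edges_identity_mw:
  "edges (identity_mw X) = link (signs X) (rev (block (bsize X) (bsize X))) (block 0 (bsize X))"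
proof -
  let ?n = "bsize X"
  have nth: "rev (block ?n ?n) ! k = 2 * ?n - k" "block 0 ?n ! k = Suc k" if "k < ?n" for k
    using that by (auto simp: rev_nth)
  have 1: "{(i, [], 2 * ?n + 1 - i) |i. i \<in> lefts X} =
      {(Suc k, [], 2 * ?n - k) |k. k < ?n \<and> signs X ! k}" (is "?A = ?B")
  proof
    show "?A \<subseteq> ?B"
    proof
      fix e assume "e \<in> ?A"
      then obtain i where i: "i \<in> lefts X" "e = (i, [], 2 * ?n + 1 - i)" by blast
      then have "1 \<le> i" "i \<le> ?n" using lefts_subset by force+
      then show "e \<in> ?B" using i by (auto simp: nth_signs intro!: exI[of _ "i - 1"])
    qed
  qed (auto simp: nth_signs)
  have 2: "{(2 * ?n + 1 - i, [], i) |i. i \<in> rights X} =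
      {(2 * ?n - k, [], Suc k) |k. k < ?n \<and> \<not> signs X ! k}" (is "?A = ?B")
  proof
    show "?A \<subseteq> ?B"
    proof
      fix e assume "e \<in> ?A"
      then obtain i where i: "i \<notin> lefts X" "1 \<le> i" "i \<le> ?n" "e = (2 * ?n + 1 - i, [], i)"
        by (auto simp: rights_def)
      then show "e \<in> ?B" by (auto simp: nth_signs intro!: exI[of _ "i - 1"])
    qed
    show "?B \<subseteq> ?A" by (force simp: nth_signs rights_def)
  qed
  have 3: "{(block 0 ?n ! k, [], rev (block ?n ?n) ! k) |k. k < ?n \<and> signs X ! k} =
      {(Suc k, [], 2 * ?n - k) |k. k < ?n \<and> signs X ! k}"
    using nth by (intro Collect_cong ex_cong1) auto
  have 4: "{(rev (block ?n ?n) ! k, [], block 0 ?n ! k) |k. k < ?n \<and> \<not> signs X ! k} =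
      {(2 * ?n - k, [], Suc k) |k. k < ?n \<and> \<not> signs X ! k}"
    using nth by (intro Collect_cong ex_cong1) auto
  show ?thesis unfolding identity_mw_def link_def length_signs 3 4 by (simp only: multiword.sel 1 2)
qed

text \<open>The working form of \<open>hide_hide\<close> and \<open>cyc_Un\<close>: vertices that
  \<open>E\<close> does not touch can be hidden before \<open>E\<close> is attached. Pluggings
  inside pluggings are flattened and regrouped with it.\<close>

lemma plug_after_hide:
  assumes "vertices E \<inter> V1 = {}" "V1 \<inter> V2 = {}"
  shows "hide (V1 \<union> V2) (D \<union> E) = hide V2 (hide V1 D \<union> E)"
    and "cyc (V1 \<union> V2) (D \<union> E) \<longleftrightarrow> cyc V1 D \<or> cyc V2 (hide V1 D \<union> E)"
  using hide_Un_disjoint[OF assms(1), of D] cyc_Un_disjoint[OF assms(1), of D]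
    hide_hide[of V2 V1 "D \<union> E"] cyc_Un[of V2 V1 "D \<union> E"] assms(2)
  by (simp_all add: Un_commute Int_commute)

context boundaries
begin

text \<open>By duality the sources of the cut formula are the targets of its dual and vice versa.
  Hence the vertices in \<open>us\<close> are exactly those that become both source and target in
  the union, and these are contracted.\<close>

lemma cut_matching:
  assumes "wf_slots (add_mset (A, us) M1)" "wf_slots (add_mset (neg A, rev us) M2)"
    and m1: "matching (slot_sources (add_mset (A, us) M1)) (slot_targets (add_mset (A, us) M1)) E1"
    and m2: "matching (slot_sources (add_mset (neg A, rev us) M2)) (slot_targets (add_mset (neg A, rev us) M2)) E2"
    and disj: "slot_vertices M1 \<inter> slot_vertices M2 = {}" and nc: "\<not> cyc (set us) (E1 \<union> E2)"
  shows "wf_slots (M1 + M2)"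
    "matching (slot_sources (M1 + M2)) (slot_targets (M1 + M2)) (hide (set us) (E1 \<union> E2))"
proof -
  have w1: "wf_slots M1" "set us \<inter> slot_vertices M1 = {}" "length us = length (pol A)" "distinct us"
    using assms(1) by (auto simp: wf_slots_add)
  have w2: "wf_slots M2" "set us \<inter> slot_vertices M2 = {}"
    using assms(2) by (auto simp: wf_slots_add)
  show "wf_slots (M1 + M2)" using w1 w2 disj by (simp add: wf_slots_union)
  have dual: "sources (pol (neg A)) (rev us) = targets (pol A) us" "targets (pol (neg A)) (rev us) = sources (pol A) us"
    by (simp_all only: pol_neg sources_dual[OF w1(3)] targets_dual[OF w1(3)])
  note sub = slot_sources_subset[of M1] slot_sources_subset[of M2] slot_targets_subset[of M1]
    slot_targets_subset[of M2] sources_subset[of "pol A" us] targets_subset[of "pol A" us]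
  note un = sources_Un_targets[OF w1(3)] and int = sources_Int_targets[OF w1(3,4)]
  have "matching (slot_sources (add_mset (A, us) M1) \<union> slot_sources (add_mset (neg A, rev us) M2))
      (slot_targets (add_mset (A, us) M1) \<union> slot_targets (add_mset (neg A, rev us) M2)) (E1 \<union> E2)"
  proof (rule matching_Un[OF m1 m2])
    show "slot_sources (add_mset (A, us) M1) \<inter> slot_sources (add_mset (neg A, rev us) M2) = {}"
      "slot_targets (add_mset (A, us) M1) \<inter> slot_targets (add_mset (neg A, rev us) M2) = {}"
      using sub int w1(2) w2(2) disj unfolding slot_sources_simps slot_targets_simps fst_conv snd_conv dual by blast+
  qed
  then have "matching (slot_sources (add_mset (A, us) M1) \<union> slot_sources (add_mset (neg A, rev us) M2) - set us)
      (slot_targets (add_mset (A, us) M1) \<union> slot_targets (add_mset (neg A, rev us) M2) - set us) (hide (set us) (E1 \<union> E2))"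
    using nc un by (intro matching_hide) (auto simp: dual)
  moreover have "slot_sources (add_mset (A, us) M1) \<union> slot_sources (add_mset (neg A, rev us) M2) - set us = slot_sources (M1 + M2)"
    "slot_targets (add_mset (A, us) M1) \<union> slot_targets (add_mset (neg A, rev us) M2) - set us = slot_targets (M1 + M2)"
    using sub w1(2) w2(2) unfolding slot_sources_simps slot_targets_simps fst_conv snd_conv dual by blast+
  ultimately show "matching (slot_sources (M1 + M2)) (slot_targets (M1 + M2)) (hide (set us) (E1 \<union> E2))"
    by (simp only:)
qed

lemma tensor_matching:
  assumes "wf_slots (add_mset (A, us) M1)" "wf_slots (add_mset (B, vs) M2)"
    and m1: "matching (slot_sources (add_mset (A, us) M1)) (slot_targets (add_mset (A, us) M1)) E1"
    and m2: "matching (slot_sources (add_mset (B, vs) M2)) (slot_targets (add_mset (B, vs) M2)) E2"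
    and disj: "slot_vertices (add_mset (A, us) M1) \<inter> slot_vertices (add_mset (B, vs) M2) = {}"
  shows "wf_slots (add_mset (Tensor A B, us @ vs) (M1 + M2))"
    "matching (slot_sources (add_mset (Tensor A B, us @ vs) (M1 + M2)))
      (slot_targets (add_mset (Tensor A B, us @ vs) (M1 + M2))) (E1 \<union> E2)"
proof -
  have w1: "wf_slots M1" "set us \<inter> slot_vertices M1 = {}" "length us = length (pol A)" "distinct us"
    using assms(1) by (auto simp: wf_slots_add)
  have w2: "wf_slots M2" "set vs \<inter> slot_vertices M2 = {}" "length vs = length (pol B)" "distinct vs"
    using assms(2) by (auto simp: wf_slots_add)
  show "wf_slots (add_mset (Tensor A B, us @ vs) (M1 + M2))"
    using w1 w2 disj by (auto simp: wf_slots_union wf_slots_add)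
  have "slot_sources (add_mset (Tensor A B, us @ vs) (M1 + M2)) =
      slot_sources (add_mset (A, us) M1) \<union> slot_sources (add_mset (B, vs) M2)"
    "slot_targets (add_mset (Tensor A B, us @ vs) (M1 + M2)) =
      slot_targets (add_mset (A, us) M1) \<union> slot_targets (add_mset (B, vs) M2)"
    by (auto simp: pol_Tensor sources_append[OF w1(3)] targets_append[OF w1(3)])
  moreover have "slot_sources (add_mset (A, us) M1) \<inter> slot_sources (add_mset (B, vs) M2) = {}"
    "slot_targets (add_mset (A, us) M1) \<inter> slot_targets (add_mset (B, vs) M2) = {}"
    using disj slot_sources_subset slot_targets_subset by blast+
  ultimately show "matching (slot_sources (add_mset (Tensor A B, us @ vs) (M1 + M2)))
      (slot_targets (add_mset (Tensor A B, us @ vs) (M1 + M2))) (E1 \<union> E2)"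
    using matching_Un[OF m1 m2] by (simp only:)
qed

text \<open>\<open>F\<close> lives on the dual formulas, so it matches the vertices of
  \<open>M\<close> with sources and targets exchanged; in the union all of them can be contracted.
  The equation for label counts yields the linearity of the productions.\<close>

lemma plug_matching:
  assumes wf: "wf_slots (add_mset (X, us) M)"
    and E: "matching (slot_sources (add_mset (X, us) M)) (slot_targets (add_mset (X, us) M)) E"
    and F: "matching (slot_targets M) (slot_sources M) F"
    and nc: "\<not> cyc (slot_vertices M) (E \<union> F)"
  shows "matching (sources (pol X) us) (targets (pol X) us) (hide (slot_vertices M) (E \<union> F))"
    and "label_count x (hide (slot_vertices M) (E \<union> F)) = label_count x E + label_count x F"
proof -
  have w': "wf_slots M" "set us \<inter> slot_vertices M = {}" "slot_sources M \<union> slot_targets M = slot_vertices M"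
    using wf wf_slots_sources_Un_targets[of M] by (auto simp: wf_slots_add)
  have st: "sources (pol X) us \<inter> slot_vertices M = {}" "targets (pol X) us \<inter> slot_vertices M = {}"
    using w'(2) sources_subset[of "pol X" us] targets_subset[of "pol X" us] by auto
  have disj: "slot_sources (add_mset (X, us) M) \<inter> slot_targets M = {}" "slot_targets (add_mset (X, us) M) \<inter> slot_sources M = {}"
    using wf_slots_sources_Int_targets[OF wf] by auto
  have m: "matching (slot_sources (add_mset (X, us) M) \<union> slot_targets M)
      (slot_targets (add_mset (X, us) M) \<union> slot_sources M) (E \<union> F)"
    using disj by (intro matching_Un E F)
  have V: "slot_vertices M \<subseteq> slot_sources (add_mset (X, us) M) \<union> slot_targets M"
    "slot_vertices M \<subseteq> slot_targets (add_mset (X, us) M) \<union> slot_sources M"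
    using w'(3) by auto
  have "slot_sources (add_mset (X, us) M) \<union> slot_targets M - slot_vertices M = sources (pol X) us"
    "slot_targets (add_mset (X, us) M) \<union> slot_sources M - slot_vertices M = targets (pol X) us"
    using st w'(3) by auto
  then show "matching (sources (pol X) us) (targets (pol X) us) (hide (slot_vertices M) (E \<union> F))"
    using matching_hide[OF m V nc] by simp
  have "E \<inter> F = {}" using matchingD(1)[OF E] matchingD(1)[OF F] disj(1) by (fastforce simp: disjoint_iff)
  then have "label_count x (E \<union> F) = label_count x E + label_count x F"
    by (intro label_count_Un matching_finite[OF E] matching_finite[OF F])
  then show "label_count x (hide (slot_vertices M) (E \<union> F)) = label_count x E + label_count x F"
    using label_count_hide[OF m V nc] by simp
qed

end


section \<open>A model of linear logic in sets of labelled matchings\<close>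

section \<open>Realizability semantics\<close>

text \<open>The set of a literal and that of its dual are independent parameters; no orthogonality
  is imposed between them. Both grammar translations exploit this freedom, in different
  ways.\<close>

locale semantics = boundaries b for b :: "'n \<Rightarrow> boundary" +
  fixes lit :: "bool \<Rightarrow> 'n \<Rightarrow> nat list \<Rightarrow> 't edge set \<Rightarrow> bool"
  assumes lit_matching: "lit s P us E \<Longrightarrow> wf_slots {#(if s then Pos P else Neg P, us)#} \<and>
      matching (sources (pol (if s then Pos P else Neg P)) us) (targets (pol (if s then Pos P else Neg P)) us) E"
    and lit_rename: "\<lbrakk>lit s P us E; inj_on g (set us)\<rbrakk> \<Longrightarrow> lit s P (map g us) (rename g E)"
begin

text \<open>A par is tested in both directions, since for arbitrary literal sets neither condition
  implies the other. Tests that close a cycle are ignored, as their result would not be regular. The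
  recursive calls pass through \<open>neg\<close>, which preserves \<open>size\<close>, hence the
  measure.\<close>

function holds :: "'n formula \<Rightarrow> nat list \<Rightarrow> 't edge set \<Rightarrow> bool" where
  "holds (Pos P) us E \<longleftrightarrow> lit True P us E"
| "holds (Neg P) us E \<longleftrightarrow> lit False P us E"
| "holds (Tensor A B) us E \<longleftrightarrow> distinct us \<and> (\<exists>us1 us2 E1 E2. us = us1 @ us2 \<and> E = E1 \<union> E2 \<and>
      holds A us1 E1 \<and> holds B us2 E2)"
| "holds (Par A B) us E \<longleftrightarrow> wf_slots {#(Par A B, us)#} \<and>
      matching (sources (pol (Par A B)) us) (targets (pol (Par A B)) us) E \<and>
      (\<forall>us1 us2. us = us2 @ us1 \<and> length us1 = fsize A \<longrightarrow>
        (\<forall>F. holds (neg A) (rev us1) F \<and> \<not> cyc (set us1) (E \<union> F) \<longrightarrow>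
           holds B us2 (hide (set us1) (E \<union> F))) \<and>
        (\<forall>F. holds (neg B) (rev us2) F \<and> \<not> cyc (set us2) (E \<union> F) \<longrightarrow>
           holds A us1 (hide (set us2) (E \<union> F))))"
  by pat_completeness auto
termination
  by (relation "measure (\<lambda>(A, us, E). size A)") auto

lemma holds_matching:
  "holds A us E \<Longrightarrow> wf_slots {#(A, us)#} \<and> matching (sources (pol A) us) (targets (pol A) us) E"
proof (induction A arbitrary: us E)
  case (Pos P)
  then show ?case using lit_matching[of True P] by simp
next
  case (Neg P)
  then show ?case using lit_matching[of False P] by simp
next
  case (Tensor A B)
  then obtain us1 us2 E1 E2 where *: "us = us1 @ us2" "E = E1 \<union> E2" "holds A us1 E1" "holds B us2 E2" "distinct us"
    by auto
  note A = Tensor.IH(1)[OF *(3)] and B = Tensor.IH(2)[OF *(4)]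
  have len: "length us1 = length (pol A)" using A by (simp add: wf_slots_single)
  have "matching (sources (pol A) us1 \<union> sources (pol B) us2) (targets (pol A) us1 \<union> targets (pol B) us2) E"
    unfolding *(2) using A B *(1,5) sources_subset[of "pol A" us1] sources_subset[of "pol B" us2]
      targets_subset[of "pol A" us1] targets_subset[of "pol B" us2]
    by (intro matching_Un) (auto simp: disjoint_iff)
  then show ?case using A B *
    by (simp only: pol_Tensor sources_append[OF len] targets_append[OF len]) (simp add: wf_slots_single)
next
  case (Par A B)
  then show ?case by simp
qed

lemma holds_vertices: "holds A us E \<Longrightarrow> vertices E = set us"
  using holds_matching[of A us E] by (auto simp: matching_vertices wf_slots_single sources_Un_targets)

text \<open>In the par case a test given on the renamed vertices is pulled back along the inverse of
  \<open>g\<close>, applied there, and its result is pushed forward. The induction is on size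
  because the pulled-back test belongs to a dual formula.\<close>

lemma holds_rename: "\<lbrakk>holds A us E; inj_on g (set us)\<rbrakk> \<Longrightarrow> holds A (map g us) (rename g E)"
proof (induction "size A" arbitrary: A us E g rule: less_induct)
  case less
  show ?case
  proof (cases A)
    case (Pos P)
    then show ?thesis using less.prems lit_rename by simp
  next
    case (Neg P)
    then show ?thesis using less.prems lit_rename by simp
  next
    case (Tensor B C)
    then obtain us1 us2 E1 E2 where *: "us = us1 @ us2" "E = E1 \<union> E2" "holds B us1 E1" "holds C us2 E2" "distinct us"
      using less.prems by auto
    have "holds B (map g us1) (rename g E1)" "holds C (map g us2) (rename g E2)"
      using less.hyps[of B us1 E1 g] less.hyps[of C us2 E2 g] * less.prems(2) Tensor
      by (auto intro: inj_on_subset)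
    moreover have "distinct (map g us)" using *(5) less.prems(2) by (simp add: distinct_map)
    ultimately show ?thesis unfolding Tensor holds.simps *(1,2) map_append rename_Un by blast
  next
    case (Par B C)
    let ?k = "inv_into (set us) g"
    note h = less.prems(1)[unfolded Par holds.simps]
    have m: "matching (sources (pol A) us) (targets (pol A) us) E" and w: "wf_slots {#(A, us)#}"
      using h Par by auto
    have vE: "vertices E = set us"
      using matching_vertices[OF m] w by (simp add: wf_slots_single sources_Un_targets)
    have wf: "wf_slots {#(A, map g us)#}"
      using w less.prems(2) wf_slots_rename[of "{#(A, us)#}" g] by simp
    have mr: "matching (sources (pol A) (map g us)) (targets (pol A) (map g us)) (rename g E)"
      unfolding sources_map targets_map using m less.prems(2) w
      by (intro matching_rename) (simp_all add: sources_Un_targets wf_slots_single)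
    \<comment> \<open>Stated for a tested part \<open>X\<close> and a resulting part
      \<open>Y\<close>, so that it serves both directions of the par clause.\<close>
    have plug: "holds Y (map g ys) (hide (set (map g xs)) (rename g E \<union> F))"
      if IHX: "size (neg X) < size A" and IHY: "size Y < size A" and sub: "set xs \<subseteq> set us" "set ys \<subseteq> set us"
        and F: "holds (neg X) (rev (map g xs)) F" and nc: "\<not> cyc (set (map g xs)) (rename g E \<union> F)"
        and *: "\<And>F. holds (neg X) (rev xs) F \<and> \<not> cyc (set xs) (E \<union> F) \<Longrightarrow> holds Y ys (hide (set xs) (E \<union> F))"
      for X Y xs ys F
    proof -
      have kg: "?k (g v) = v" if "v \<in> set us" for v using that less.prems(2) by simp
      have "inj_on ?k (set (rev (map g xs)))" by (rule inj_on_inv_into) (use sub in auto)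
      then have "holds (neg X) (map ?k (rev (map g xs))) (rename ?k F)"
        by (rule less.hyps[OF IHX F])
      moreover have "map ?k (rev (map g xs)) = rev xs"
        using sub kg by (simp add: rev_map[symmetric] map_idI subset_iff)
      ultimately have F': "holds (neg X) (rev xs) (rename ?k F)" by simp
      have "vertices F \<subseteq> g ` set xs"
        using holds_matching[OF F] by (auto simp: matching_vertices wf_slots_single sources_Un_targets)
      then have "(g \<circ> ?k) v = v" if "v \<in> vertices F" for v
        using that sub(1) by (auto intro!: f_inv_into_f)
      then have gF: "rename g (rename ?k F) = F"
        unfolding rename_comp by (rule rename_ident)
      have vF: "vertices (rename ?k F) \<subseteq> set us"
        using holds_vertices[OF F'] sub by (simp del: vertices_rename)
      have eq: "rename g E \<union> F = rename g (E \<union> rename ?k F)" by (simp add: gF)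
      have inj: "inj_on g (vertices (E \<union> rename ?k F) \<union> set xs)"
        by (rule inj_on_subset[OF less.prems(2)]) (use vE vF sub in \<open>simp del: vertices_rename\<close>)
      have "\<not> cyc (set xs) (E \<union> rename ?k F)" using nc cyc_rename[OF inj] unfolding eq by simp
      then have "holds Y ys (hide (set xs) (E \<union> rename ?k F))" using * F' by blast
      then have "holds Y (map g ys) (rename g (hide (set xs) (E \<union> rename ?k F)))"
        using less.hyps[OF IHY] less.prems(2) sub by (auto intro: inj_on_subset)
      then show ?thesis unfolding eq using hide_rename[OF inj] by simp
    qed
    show ?thesis unfolding Par holds.simps
    proof (intro conjI allI impI)
      fix vs1 vs2 F
      assume s: "map g us = vs2 @ vs1 \<and> length vs1 = fsize B"
      then obtain us1 us2 where us: "us = us2 @ us1" "vs1 = map g us1" "vs2 = map g us2"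
        by (auto simp: map_eq_append_conv)
      then have us1: "us = us2 @ us1 \<and> length us1 = fsize B" using s by simp
      {
        assume "holds (neg B) (rev vs1) F \<and> \<not> cyc (set vs1) (rename g E \<union> F)"
        then show "holds C vs2 (hide (set vs1) (rename g E \<union> F))"
          using h us1 unfolding us(2,3) by (intro plug) (auto simp: Par us(1))
      next
        assume "holds (neg C) (rev vs2) F \<and> \<not> cyc (set vs2) (rename g E \<union> F)"
        then show "holds B vs1 (hide (set vs2) (rename g E \<union> F))"
          using h us1 unfolding us(2,3) by (intro plug) (auto simp: Par us(1))
      }
    qed (use wf mr in \<open>simp_all add: Par\<close>)
  qed
qed

text \<open>Each slot has an element of the dual formula attached, on the reversed list of names. A
  multiset of slots with attached choices, in place of a function on slots, respects
  multiplicities.\<close>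

definition tests :: "'n slot multiset \<Rightarrow> 't edge set \<Rightarrow> bool" where
  "tests M F \<longleftrightarrow> (\<exists>N. M = image_mset (\<lambda>(A, us, F). (A, us)) N \<and>
     (\<forall>(A, us, F) \<in># N. holds (neg A) (rev us) F) \<and> F = (\<Union>(A, us, F) \<in> set_mset N. F))"

lemma tests_empty [simp]: "tests {#} F \<longleftrightarrow> F = {}"
  by (auto simp: tests_def)

lemma tests_add:
  "tests (add_mset (A, us) M) F \<longleftrightarrow> (\<exists>F1 F2. holds (neg A) (rev us) F1 \<and> tests M F2 \<and> F = F1 \<union> F2)"
proof
  assume "tests (add_mset (A, us) M) F"
  then obtain N where N: "add_mset (A, us) M = image_mset (\<lambda>(A, us, F). (A, us)) N"
    "\<forall>(A, us, F) \<in># N. holds (neg A) (rev us) F" "F = (\<Union>(A, us, F) \<in> set_mset N. F)"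
    unfolding tests_def by blast
  from N(1) obtain N' x where N': "N = add_mset x N'" "(\<lambda>(A, us, F). (A, us)) x = (A, us)"
    "M = image_mset (\<lambda>(A, us, F). (A, us)) N'"
    using msed_map_invR[of "\<lambda>(A, us, F). (A, us)" N "(A, us)" M] by auto
  obtain F1 where x: "x = (A, us, F1)" using N'(2) by (cases x) auto
  have "tests M (\<Union>(A, us, F) \<in> set_mset N'. F)" unfolding tests_def using N N' by auto
  then show "\<exists>F1 F2. holds (neg A) (rev us) F1 \<and> tests M F2 \<and> F = F1 \<union> F2"
    using N N' x by auto
next
  assume "\<exists>F1 F2. holds (neg A) (rev us) F1 \<and> tests M F2 \<and> F = F1 \<union> F2"
  then obtain F1 F2 N where "holds (neg A) (rev us) F1" "F = F1 \<union> F2" "M = image_mset (\<lambda>(A, us, F). (A, us)) N"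
    "\<forall>(A, us, F) \<in># N. holds (neg A) (rev us) F" "F2 = (\<Union>(A, us, F) \<in> set_mset N. F)"
    unfolding tests_def by blast
  then show "tests (add_mset (A, us) M) F"
    unfolding tests_def by (intro exI[of _ "add_mset (A, us, F1) N"]) auto
qed

lemma tests_union: "tests (M + N) F \<longleftrightarrow> (\<exists>F1 F2. tests M F1 \<and> tests N F2 \<and> F = F1 \<union> F2)"
proof (induction M arbitrary: F)
  case (add x M)
  obtain A us where x: "x = (A, us)" by fastforce
  show ?case unfolding x union_mset_add_mset_left tests_add add.IH
    by (metis (no_types, lifting) Un_assoc)
qed simp

lemma tests_matching:
  "\<lbrakk>tests M F; wf_slots M\<rbrakk> \<Longrightarrow> matching (slot_targets M) (slot_sources M) F"
proof (induction M arbitrary: F)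
  case (add x M)
  obtain A us where x: "x = (A, us)" by fastforce
  obtain F1 F2 where F: "holds (neg A) (rev us) F1" "tests M F2" "F = F1 \<union> F2"
    using add.prems by (auto simp: x tests_add)
  have w: "length us = length (pol A)" "set us \<inter> slot_vertices M = {}" "wf_slots M"
    using add.prems by (auto simp: x wf_slots_add)
  have "matching (targets (pol A) us) (sources (pol A) us) F1"
    using holds_matching[OF F(1)] by (simp only: pol_neg sources_dual[OF w(1)] targets_dual[OF w(1)])
  then show ?case unfolding F(3) x
    using add.IH[OF F(2) w(3)] w(2) sources_subset[of "pol A" us] targets_subset[of "pol A" us]
      slot_sources_subset[of M] slot_targets_subset[of M]
    by simp (intro matching_Un, auto)
qed simp

lemma tests_vertices: "\<lbrakk>tests M F; wf_slots M\<rbrakk> \<Longrightarrow> vertices F = slot_vertices M"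
  using matching_vertices[OF tests_matching] wf_slots_sources_Un_targets by blast

lemma tests_rename:
  "\<lbrakk>tests M F; inj_on g (slot_vertices M)\<rbrakk> \<Longrightarrow> tests (rename_slots g M) (rename g F)"
proof (induction M arbitrary: F)
  case (add x M)
  obtain A us where x: "x = (A, us)" by fastforce
  obtain F1 F2 where F: "holds (neg A) (rev us) F1" "tests M F2" "F = F1 \<union> F2"
    using add.prems by (auto simp: x tests_add)
  have "holds (neg A) (rev (map g us)) (rename g F1)"
    using holds_rename[OF F(1)] add.prems(2) by (auto simp: x rev_map intro: inj_on_subset)
  moreover have "tests (rename_slots g M) (rename g F2)"
    using add.IH[OF F(2)] add.prems(2) by (auto simp: x intro: inj_on_subset)
  ultimately show ?case using F(3) by (auto simp: x tests_add)
qed simp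

text \<open>Any slot may be the output, since after a cut the output may come from either premise.
  Pluggings that close a cycle are exempt, in accordance with \<open>holds\<close>.\<close>

definition valid :: "'n slot multiset \<Rightarrow> 't edge set \<Rightarrow> bool" where
  "valid M E \<longleftrightarrow> wf_slots M \<and> matching (slot_sources M) (slot_targets M) E \<and>
     (\<forall>A us M' F. M = add_mset (A, us) M' \<longrightarrow> tests M' F \<longrightarrow> \<not> cyc (slot_vertices M') (E \<union> F) \<longrightarrow>
        holds A us (hide (slot_vertices M') (E \<union> F)))"

lemma validD:
  assumes "valid M E"
  shows "wf_slots M" "matching (slot_sources M) (slot_targets M) E" "vertices E = slot_vertices M"
  using assms matching_vertices[of "slot_sources M" "slot_targets M" E] wf_slots_sources_Un_targets[of M]
  by (auto simp: valid_def)

lemma valid_holds: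
  assumes "valid (add_mset (A, us) M) E" "tests M F" "\<not> cyc (slot_vertices M) (E \<union> F)"
  shows "holds A us (hide (slot_vertices M) (E \<union> F))"
  using assms by (auto simp: valid_def)

text \<open>As in \<open>holds_rename\<close>, tests are pulled back along the inverse of
  \<open>g\<close>; the sets of tests are closed under renaming as well.\<close>

lemma valid_rename:
  assumes v: "valid M E" and g: "inj_on g (slot_vertices M)"
  shows "valid (rename_slots g M) (rename g E)"
  unfolding valid_def
proof (intro conjI allI impI)
  show "wf_slots (rename_slots g M)" using wf_slots_rename validD[OF v] g by blast
  show "matching (slot_sources (rename_slots g M)) (slot_targets (rename_slots g M)) (rename g E)"
    using matching_rename[OF validD(2)[OF v]] g wf_slots_sources_Un_targets[OF validD(1)[OF v]] by simp
next
  fix A ws M' F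
  assume M': "rename_slots g M = add_mset (A, ws) M'" and F: "tests M' F"
    and nc: "\<not> cyc (slot_vertices M') (rename g E \<union> F)"
  obtain M0 us where M: "M = add_mset (A, us) M0" "ws = map g us" "M' = rename_slots g M0"
    using M' msed_map_invR[of "\<lambda>(A, us). (A, map g us)" M "(A, ws)" M'] unfolding rename_slots_def by auto
  let ?k = "inv_into (slot_vertices M) g"
  have kg: "?k (g x) = x" if "x \<in> slot_vertices M" for x using that g by simp
  have "inj_on ?k (slot_vertices M')" by (rule inj_on_inv_into) (auto simp: M)
  then have F': "tests (rename_slots ?k M') (rename ?k F)" using tests_rename[OF F] by simp
  have "rename_slots ?k M' = M0"
  proof -
    have "rename_slots ?k M' = image_mset (\<lambda>x. x) M0"
      unfolding M(3) rename_slots_def multiset.map_comp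
    proof (rule image_mset_cong)
      fix x assume x: "x \<in># M0"
      obtain C ts where C: "x = (C, ts)" by fastforce
      have "set ts \<subseteq> slot_vertices M" using x C by (force simp: M slot_vertices_def)
      then have "map (?k \<circ> g) ts = ts" using kg by (intro map_idI) auto
      then show "((\<lambda>(A, us). (A, map ?k us)) \<circ> (\<lambda>(A, us). (A, map g us))) x = x" by (simp add: C)
    qed
    then show ?thesis by simp
  qed
  with F' have F0: "tests M0 (rename ?k F)" by simp
  have wM: "wf_slots M0" using validD(1)[OF v] by (simp add: M wf_slots_add)
  have wM': "wf_slots M'" using wf_slots_rename[OF validD(1)[OF v] g] by (simp add: M wf_slots_add)
  have vF: "vertices F = g ` slot_vertices M0" using tests_vertices[OF F wM'] by (simp add: M)
  have gF: "rename g (rename ?k F) = F"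
    unfolding rename_comp using vF kg by (intro rename_ident) (auto simp: M)
  have eq: "rename g E \<union> F = rename g (E \<union> rename ?k F)" by (simp add: gF)
  have inj: "inj_on g (vertices (E \<union> rename ?k F) \<union> slot_vertices M0)"
    using g validD(3)[OF v] tests_vertices[OF F0 wM] by (auto simp: M intro: inj_on_subset)
  have "\<not> cyc (slot_vertices M0) (E \<union> rename ?k F)"
    using nc cyc_rename[OF inj] unfolding eq M(3) slot_vertices_rename by simp
  then have "holds A us (hide (slot_vertices M0) (E \<union> rename ?k F))"
    using valid_holds[OF v[unfolded M(1)] F0] by blast
  then have "holds A (map g us) (rename g (hide (slot_vertices M0) (E \<union> rename ?k F)))"
    by (rule holds_rename) (rule inj_on_subset[OF g], simp add: M)
  then show "holds A ws (hide (slot_vertices M') (rename g E \<union> F))"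
    unfolding eq M(2,3) slot_vertices_rename hide_rename[OF inj] .
qed

text \<open>The output is in the second premise. Testing the other slots of the first premise leaves
  an element of \<open>A\<close>; as \<open>A\<close> is the dual of \<open>neg A\<close>, this
  element is itself a test for the slot \<open>neg A\<close> of the second premise.\<close>

lemma cut_holds:
  assumes v1: "valid (add_mset (A, us) M1) E1" and v2: "valid (add_mset (neg A, rev us) (add_mset (C, ws) M2)) E2"
    and disj: "slot_vertices M1 \<inter> slot_vertices (add_mset (C, ws) M2) = {}"
    and F1: "tests M1 F1" and F2: "tests M2 F2"
    and V: "V = slot_vertices M1 \<union> (set us \<union> slot_vertices M2)"
    and nc: "\<not> cyc V ((E1 \<union> F1) \<union> (E2 \<union> F2))"
  shows "holds C ws (hide V ((E1 \<union> F1) \<union> (E2 \<union> F2)))"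
proof -
  have w1: "wf_slots M1" "set us \<inter> slot_vertices M1 = {}"
    using validD(1)[OF v1] by (auto simp: wf_slots_add)
  have w2: "wf_slots M2" using validD(1)[OF v2] by (auto simp: wf_slots_add)
  have d: "vertices (E2 \<union> F2) \<inter> slot_vertices M1 = {}"
    using validD(3)[OF v2] tests_vertices[OF F2 w2] disj w1(2) by auto
  have d': "slot_vertices M1 \<inter> (set us \<union> slot_vertices M2) = {}" using disj w1(2) by auto
  let ?H = "hide (slot_vertices M1) (E1 \<union> F1)"
  note plug = plug_after_hide[OF d d', of "E1 \<union> F1", folded V]
  have H: "holds A us ?H" using valid_holds[OF v1 F1] nc plug(2) by blast
  then have T: "tests (add_mset (neg A, rev us) M2) (?H \<union> F2)"
    using F2 unfolding tests_add by (intro exI[of _ ?H] exI[of _ F2]) simp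
  have v2': "valid (add_mset (C, ws) (add_mset (neg A, rev us) M2)) E2" using v2 by (simp add: add_mset_commute)
  have "holds C ws (hide (slot_vertices (add_mset (neg A, rev us) M2)) (E2 \<union> (?H \<union> F2)))"
    using valid_holds[OF v2' T] nc plug(2) by (simp add: Un_ac)
  then show ?thesis using plug(1) by (simp add: Un_ac)
qed

lemma valid_cut:
  assumes v1: "valid (add_mset (A, us) M1) E1" and v2: "valid (add_mset (neg A, rev us) M2) E2"
    and disj: "slot_vertices M1 \<inter> slot_vertices M2 = {}" and nc: "\<not> cyc (set us) (E1 \<union> E2)"
  shows "valid (M1 + M2) (hide (set us) (E1 \<union> E2))"
  unfolding valid_def
proof (intro conjI allI impI)
  have w1: "wf_slots M1" "set us \<inter> slot_vertices M1 = {}" "length us = length (pol A)" "distinct us"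
    using validD(1)[OF v1] by (auto simp: wf_slots_add)
  have w2: "wf_slots M2" "set us \<inter> slot_vertices M2 = {}"
    using validD(1)[OF v2] by (auto simp: wf_slots_add)
  show wf: "wf_slots (M1 + M2)" using w1 w2 disj by (simp add: wf_slots_union)
  show "matching (slot_sources (M1 + M2)) (slot_targets (M1 + M2)) (hide (set us) (E1 \<union> E2))"
    by (rule cut_matching[OF validD(1)[OF v1] validD(1)[OF v2] validD(2)[OF v1] validD(2)[OF v2] disj nc])
  fix C ws M' F
  assume M': "M1 + M2 = add_mset (C, ws) M'" and F: "tests M' F"
    and nc': "\<not> cyc (slot_vertices M') (hide (set us) (E1 \<union> E2) \<union> F)"
  have wM': "wf_slots M'" using wf unfolding M' by (simp add: wf_slots_add)
  have "slot_vertices M' \<subseteq> slot_vertices (M1 + M2)" unfolding M' by auto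
  then have d: "vertices F \<inter> set us = {}" "set us \<inter> slot_vertices M' = {}"
    using tests_vertices[OF F wM'] w1(2) w2(2) by auto
  note plug = plug_after_hide[OF d, of "E1 \<union> E2"]
  have nc'': "\<not> cyc (set us \<union> slot_vertices M') (E1 \<union> E2 \<union> F)" using plug(2) nc nc' by blast
  have "(C, ws) \<in># M1 + M2" unfolding M' by simp
  then consider "(C, ws) \<in># M1" | "(C, ws) \<in># M2" by auto
  then have "holds C ws (hide (set us \<union> slot_vertices M') (E1 \<union> E2 \<union> F))"
  proof cases
    case 1
    then obtain K where K: "M1 = add_mset (C, ws) K" by (metis mset_add)
    then have KM: "M' = K + M2" using M' by auto
    then obtain F1 F2 where F12: "tests K F1" "tests M2 F2" "F = F1 \<union> F2" using F tests_union by auto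
    \<comment> \<open>Double negation and double reversal give the first premise the form that
      \<open>cut_holds\<close> demands of the second, so it applies with the premises
      exchanged.\<close>
    have v1': "valid (add_mset (neg (neg A), rev (rev us)) (add_mset (C, ws) K)) E1" using v1 K by simp
    have "set us \<union> slot_vertices M' = slot_vertices M2 \<union> (set (rev us) \<union> slot_vertices K)"
      by (auto simp: KM)
    from cut_holds[OF v2 v1' _ F12(2,1) this] nc'' disj show ?thesis by (simp add: K F12(3) Un_ac Int_commute)
  next
    case 2
    then obtain K where K: "M2 = add_mset (C, ws) K" by (metis mset_add)
    then have KM: "M' = M1 + K" using M' by auto
    then obtain F1 F2 where F12: "tests M1 F1" "tests K F2" "F = F1 \<union> F2" using F tests_union by auto
    have "set us \<union> slot_vertices M' = slot_vertices M1 \<union> (set us \<union> slot_vertices K)"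
      by (auto simp: KM)
    from cut_holds[OF v1 v2[unfolded K] _ F12(1,2) this] nc'' disj show ?thesis by (simp add: K F12(3) Un_ac)
  qed
  then show "holds C ws (hide (slot_vertices M') (hide (set us) (E1 \<union> E2) \<union> F))"
    using plug(1) by simp
qed

text \<open>The output is in the premise of \<open>A\<close>. A test of the tensor slot is an
  element \<open>R\<close> of the par of the duals: the element of \<open>B\<close> left by the
  other premise is plugged into it, which gives a test for \<open>A\<close>. The hidden vertices are
  eliminated in this order: those of \<open>M2\<close>, then \<open>vs\<close>, then
  \<open>us\<close> with those of \<open>M1\<close>.\<close>

lemma tensor_holds:
  assumes v1: "valid (add_mset (A, us) (add_mset (C, ws) M1)) E1" and v2: "valid (add_mset (B, vs) M2) E2"
    and disj: "slot_vertices (add_mset (A, us) (add_mset (C, ws) M1)) \<inter> slot_vertices (add_mset (B, vs) M2) = {}"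
    and R: "\<And>F. \<lbrakk>holds B vs F; \<not> cyc (set vs) (R \<union> F)\<rbrakk> \<Longrightarrow> holds (neg A) (rev us) (hide (set vs) (R \<union> F))"
    and vR: "vertices R = set us \<union> set vs"
    and F1: "tests M1 F1" and F2: "tests M2 F2"
    and V: "V = slot_vertices M2 \<union> (set vs \<union> (set us \<union> slot_vertices M1))"
    and nc: "\<not> cyc V ((E2 \<union> F2) \<union> (R \<union> (E1 \<union> F1)))"
  shows "holds C ws (hide V ((E2 \<union> F2) \<union> (R \<union> (E1 \<union> F1))))"
proof -
  have w1: "wf_slots M1" using validD(1)[OF v1] by (auto simp: wf_slots_add)
  have w2: "wf_slots M2" "set vs \<inter> slot_vertices M2 = {}" using validD(1)[OF v2] by (auto simp: wf_slots_add)
  have vE1: "vertices (E1 \<union> F1) \<subseteq> slot_vertices (add_mset (A, us) (add_mset (C, ws) M1))"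
    using validD(3)[OF v1] tests_vertices[OF F1 w1] by auto
  have d: "vertices (R \<union> (E1 \<union> F1)) \<inter> slot_vertices M2 = {}"
    "slot_vertices M2 \<inter> (set vs \<union> (set us \<union> slot_vertices M1)) = {}"
    using vE1 disj w2(2) vR by auto
  let ?H = "hide (slot_vertices M2) (E2 \<union> F2)"
  note plug = plug_after_hide[OF d, of "E2 \<union> F2", folded V]
  have H: "holds B vs ?H" using valid_holds[OF v2 F2] nc plug(2) by blast
  have d': "vertices (E1 \<union> F1) \<inter> set vs = {}" "set vs \<inter> (set us \<union> slot_vertices M1) = {}"
    using vE1 disj by auto
  note plug' = plug_after_hide[OF d', of "R \<union> ?H"]
  have eq: "?H \<union> (R \<union> (E1 \<union> F1)) = (R \<union> ?H) \<union> (E1 \<union> F1)" by auto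
  let ?R = "hide (set vs) (R \<union> ?H)"
  have "holds (neg A) (rev us) ?R" using R[OF H] nc plug(2) plug'(2) unfolding eq by blast
  then have T: "tests (add_mset (A, us) M1) (?R \<union> F1)"
    using F1 unfolding tests_add by (intro exI[of _ ?R] exI[of _ F1]) simp
  have v1': "valid (add_mset (C, ws) (add_mset (A, us) M1)) E1" using v1 by (simp add: add_mset_commute)
  have eq': "E1 \<union> (?R \<union> F1) = ?R \<union> (E1 \<union> F1)" by auto
  have "holds C ws (hide (set us \<union> slot_vertices M1) (?R \<union> (E1 \<union> F1)))"
    using valid_holds[OF v1' T] nc plug(2) plug'(2) unfolding eq eq' by simp
  then show ?thesis unfolding plug(1) eq plug'(1) .
qed

lemma valid_tensor:
  assumes v1: "valid (add_mset (A, us) M1) E1" and v2: "valid (add_mset (B, vs) M2) E2"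
    and disj: "slot_vertices (add_mset (A, us) M1) \<inter> slot_vertices (add_mset (B, vs) M2) = {}"
  shows "valid (add_mset (Tensor A B, us @ vs) (M1 + M2)) (E1 \<union> E2)"
  unfolding valid_def
proof (intro conjI allI impI)
  have w1: "wf_slots M1" "set us \<inter> slot_vertices M1 = {}" "length us = length (pol A)" "distinct us"
    using validD(1)[OF v1] by (auto simp: wf_slots_add)
  have w2: "wf_slots M2" "set vs \<inter> slot_vertices M2 = {}" "length vs = length (pol B)" "distinct vs"
    using validD(1)[OF v2] by (auto simp: wf_slots_add)
  show wf: "wf_slots (add_mset (Tensor A B, us @ vs) (M1 + M2))"
    using w1 w2 disj by (auto simp: wf_slots_union wf_slots_add)
  show "matching (slot_sources (add_mset (Tensor A B, us @ vs) (M1 + M2)))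
      (slot_targets (add_mset (Tensor A B, us @ vs) (M1 + M2))) (E1 \<union> E2)"
    by (rule tensor_matching[OF validD(1)[OF v1] validD(1)[OF v2] validD(2)[OF v1] validD(2)[OF v2] disj])
  fix C ws M' F
  assume M': "add_mset (Tensor A B, us @ vs) (M1 + M2) = add_mset (C, ws) M'" and F: "tests M' F"
    and nc: "\<not> cyc (slot_vertices M') (E1 \<union> E2 \<union> F)"
  show "holds C ws (hide (slot_vertices M') (E1 \<union> E2 \<union> F))"
  proof (cases "(C, ws) = (Tensor A B, us @ vs)")
    \<comment> \<open>The tensor itself is the output: the premises are tested separately, and their
      results do not interact.\<close>
    case True
    then have "M' = M1 + M2" using M' by simp
    then obtain F1 F2 where F12: "tests M1 F1" "tests M2 F2" "F = F1 \<union> F2" using F tests_union by auto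
    have d: "vertices (E2 \<union> F2) \<inter> slot_vertices M1 = {}" "slot_vertices M1 \<inter> slot_vertices M2 = {}"
      "vertices (E1 \<union> F1) \<inter> slot_vertices M2 = {}"
      using validD(3)[OF v1] validD(3)[OF v2] tests_vertices[OF F12(1) w1(1)] tests_vertices[OF F12(2) w2(1)] disj by auto
    have d': "vertices (hide (slot_vertices M1) (E1 \<union> F1)) \<inter> slot_vertices M2 = {}"
      using vertices_hide[of "slot_vertices M1" "E1 \<union> F1"] d(3) by blast
    note plug = plug_after_hide[OF d(1,2), of "E1 \<union> F1"]
    have eq: "E1 \<union> E2 \<union> F = (E1 \<union> F1) \<union> (E2 \<union> F2)" using F12 by auto
    have eq': "hide (slot_vertices M2) (hide (slot_vertices M1) (E1 \<union> F1) \<union> (E2 \<union> F2)) =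
        hide (slot_vertices M1) (E1 \<union> F1) \<union> hide (slot_vertices M2) (E2 \<union> F2)"
      using hide_Un_disjoint[OF d', of "E2 \<union> F2"] by (simp only: Un_commute)
    have nc2: "\<not> cyc (slot_vertices M1) (E1 \<union> F1)" "\<not> cyc (slot_vertices M2) (E2 \<union> F2)"
      using nc plug(2) cyc_Un_disjoint[OF d', of "E2 \<union> F2"] unfolding \<open>M' = M1 + M2\<close> eq
      by (simp_all add: Un_commute)
    have "holds A us (hide (slot_vertices M1) (E1 \<union> F1))" "holds B vs (hide (slot_vertices M2) (E2 \<union> F2))"
      using valid_holds[OF v1 F12(1) nc2(1)] valid_holds[OF v2 F12(2) nc2(2)] by auto
    moreover have "distinct (us @ vs)" using w1 w2 disj by auto
    ultimately show ?thesis
      using True plug(1) eq' by (auto simp: \<open>M' = M1 + M2\<close> eq)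
  next
    case False
    then obtain K where K: "M1 + M2 = add_mset (C, ws) K" "M' = add_mset (Tensor A B, us @ vs) K"
      using M' unfolding add_eq_conv_ex by blast
    obtain R F0 where R: "holds (Par (neg A) (neg B)) (rev vs @ rev us) R" "tests K F0" "F = R \<union> F0"
      using F unfolding K(2) tests_add by auto
    have vR: "vertices R = set us \<union> set vs"
      using holds_matching[OF R(1)] w1 w2 by (auto simp: matching_vertices sources_Un_targets wf_slots_single)
    have lenA: "length (rev us) = fsize (neg A)" using w1(3) length_pol_neg[of A] by simp
    \<comment> \<open>The two directions of the par clause, one for each premise that may contain
      the output.\<close>
    have RA: "holds (neg A) (rev us) (hide (set vs) (R \<union> F))" if "holds B vs F" "\<not> cyc (set vs) (R \<union> F)" for F
      using R(1) that lenA unfolding holds.simps(4) by (metis neg_neg rev_rev_ident set_rev)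
    have RB: "holds (neg B) (rev vs) (hide (set us) (R \<union> F))" if "holds A us F" "\<not> cyc (set us) (R \<union> F)" for F
      using R(1) that lenA unfolding holds.simps(4) by (metis neg_neg rev_rev_ident set_rev)
    have "(C, ws) \<in># M1 + M2" unfolding K by simp
    then consider "(C, ws) \<in># M1" | "(C, ws) \<in># M2" by auto
    then show ?thesis
    proof cases
      case 1
      then obtain K1 where K1: "M1 = add_mset (C, ws) K1" by (metis mset_add)
      then have KM: "K = K1 + M2" using K by auto
      then obtain F1 F2 where F12: "tests K1 F1" "tests M2 F2" "F0 = F1 \<union> F2" using R(2) tests_union by auto
      have V: "slot_vertices M' = slot_vertices M2 \<union> (set vs \<union> (set us \<union> slot_vertices K1))"
        by (auto simp: K KM)
      have eq: "E1 \<union> E2 \<union> F = (E2 \<union> F2) \<union> (R \<union> (E1 \<union> F1))" using R F12 by auto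
      show ?thesis unfolding eq
        by (rule tensor_holds[OF v1[unfolded K1] v2 disj[unfolded K1] RA vR F12(1,2) V nc[unfolded eq]])
    next
      case 2
      then obtain K2 where K2: "M2 = add_mset (C, ws) K2" by (metis mset_add)
      then have KM: "K = M1 + K2" using K by auto
      then obtain F1 F2 where F12: "tests M1 F1" "tests K2 F2" "F0 = F1 \<union> F2" using R(2) tests_union by auto
      have V: "slot_vertices M' = slot_vertices M1 \<union> (set us \<union> (set vs \<union> slot_vertices K2))"
        by (auto simp: K KM)
      have eq: "E1 \<union> E2 \<union> F = (E1 \<union> F1) \<union> (R \<union> (E2 \<union> F2))" using R F12 by auto
      have disj': "slot_vertices (add_mset (B, vs) (add_mset (C, ws) K2)) \<inter> slot_vertices (add_mset (A, us) M1) = {}"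
        using disj unfolding K2 by blast
      have vR': "vertices R = set vs \<union> set us" using vR by blast
      show ?thesis unfolding eq
        by (rule tensor_holds[OF v2[unfolded K2] v1 disj' RB vR' F12(2,1) V nc[unfolded eq]])
    qed
  qed
qed

text \<open>If the par is the output, testing the other slots first and one half afterwards is the
  same as testing everything at once. If another slot is the output, the test of the par is a tensor
  and splits into a test for each half.\<close>

lemma valid_par:
  assumes v: "valid (add_mset (A, us1) (add_mset (B, us2) M)) E"
  shows "valid (add_mset (Par A B, us2 @ us1) M) E"
  unfolding valid_def
proof (intro conjI allI impI)
  have w: "wf_slots M" "length us1 = length (pol A)" "length us2 = length (pol B)" "distinct us1" "distinct us2"
    "set us1 \<inter> set us2 = {}" "set us1 \<inter> slot_vertices M = {}" "set us2 \<inter> slot_vertices M = {}"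
    using validD(1)[OF v] by (auto simp: wf_slots_add)
  show wf: "wf_slots (add_mset (Par A B, us2 @ us1) M)"
    using w by (auto simp: wf_slots_add)
  have "slot_sources (add_mset (Par A B, us2 @ us1) M) = slot_sources (add_mset (A, us1) (add_mset (B, us2) M))"
    "slot_targets (add_mset (Par A B, us2 @ us1) M) = slot_targets (add_mset (A, us1) (add_mset (B, us2) M))"
    by (auto simp: pol_Par sources_append[OF w(3)] targets_append[OF w(3)])
  then show m: "matching (slot_sources (add_mset (Par A B, us2 @ us1) M))
      (slot_targets (add_mset (Par A B, us2 @ us1) M)) E"
    using validD(2)[OF v] by (simp only:)
  fix C ws M' F
  assume M': "add_mset (Par A B, us2 @ us1) M = add_mset (C, ws) M'" and F: "tests M' F"
    and nc: "\<not> cyc (slot_vertices M') (E \<union> F)"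
  show "holds C ws (hide (slot_vertices M') (E \<union> F))"
  proof (cases "(C, ws) = (Par A B, us2 @ us1)")
    case True
    then have M: "M' = M" using M' by simp
    let ?H = "hide (slot_vertices M) (E \<union> F)"
    have plug: "holds Y ys (hide (set xs) (?H \<union> G))"
      if vv: "valid (add_mset (X, xs) (add_mset (Y, ys) M)) E" and G: "holds (neg X) (rev xs) G"
        and ncG: "\<not> cyc (set xs) (?H \<union> G)" for X Y xs ys G
    proof -
      have ww: "length xs = length (pol X)" "set xs \<inter> slot_vertices M = {}"
        using validD(1)[OF vv] by (auto simp: wf_slots_add)
      have vG: "vertices G = set xs"
        using holds_matching[OF G] by (auto simp: matching_vertices sources_Un_targets wf_slots_single)
      have d: "vertices G \<inter> slot_vertices M = {}" "slot_vertices M \<inter> set xs = {}" using vG ww by auto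
      note plug = plug_after_hide[OF d, of "E \<union> F"]
      have T: "tests (add_mset (X, xs) M) (G \<union> F)" using F G unfolding M tests_add by blast
      have vv': "valid (add_mset (Y, ys) (add_mset (X, xs) M)) E" using vv by (simp add: add_mset_commute)
      show ?thesis
        using valid_holds[OF vv' T] plug nc ncG unfolding M by (simp add: Un_ac)
    qed
    have v': "valid (add_mset (B, us2) (add_mset (A, us1) M)) E" using v by (simp add: add_mset_commute)
    have "holds (Par A B) (us2 @ us1) ?H" unfolding holds.simps
    proof (intro conjI allI impI)
      show "wf_slots {#(Par A B, us2 @ us1)#}" using w by (simp add: wf_slots_single Int_commute)
      show "matching (sources (pol (Par A B)) (us2 @ us1)) (targets (pol (Par A B)) (us2 @ us1)) ?H"
        using plug_matching(1)[OF wf m tests_matching[OF F[unfolded M] w(1)] nc[unfolded M]] .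
    next
      fix vs1 vs2 G assume s: "us2 @ us1 = vs2 @ vs1 \<and> length vs1 = fsize A"
      then have vs: "vs1 = us1" "vs2 = us2" using w(2) by auto
      show "holds B vs2 (hide (set vs1) (?H \<union> G))" if "holds (neg A) (rev vs1) G \<and> \<not> cyc (set vs1) (?H \<union> G)"
        using plug[OF v] that vs by blast
      show "holds A vs1 (hide (set vs2) (?H \<union> G))" if "holds (neg B) (rev vs2) G \<and> \<not> cyc (set vs2) (?H \<union> G)"
        using plug[OF v'] that vs by blast
    qed
    then show ?thesis using True M by simp
  next
    case False
    then obtain K where K: "M = add_mset (C, ws) K" "M' = add_mset (Par A B, us2 @ us1) K"
      using M' unfolding add_eq_conv_ex by blast
    obtain R F0 where R: "holds (Tensor (neg A) (neg B)) (rev us1 @ rev us2) R" "tests K F0" "F = R \<union> F0"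
      using F unfolding K(2) tests_add neg.simps rev_append by blast
    then obtain xs ys R1 R2 where RR: "rev us1 @ rev us2 = xs @ ys" "R = R1 \<union> R2" "holds (neg A) xs R1" "holds (neg B) ys R2"
      by auto
    have "length xs = length us1" using holds_matching[OF RR(3)] w(2) length_pol_neg[of A] by (simp add: wf_slots_single)
    then have xy: "xs = rev us1" "ys = rev us2" using RR(1) by auto
    have T: "tests (add_mset (A, us1) (add_mset (B, us2) K)) F"
      unfolding tests_add using R RR xy by (metis Un_assoc)
    have v': "valid (add_mset (C, ws) (add_mset (A, us1) (add_mset (B, us2) K))) E"
      using v unfolding K(1) by (simp add: add_mset_commute)
    have "slot_vertices M' = slot_vertices (add_mset (A, us1) (add_mset (B, us2) K))" by (auto simp: K)
    then show ?thesis using valid_holds[OF v' T] nc by simp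
  qed
qed

text \<open>Plugging an element into a link only renames it, and \<open>holds\<close> is closed
  under renaming. This covers compound formulas directly, with no expansion of axioms to
  literals.\<close>

lemma valid_link:
  assumes len: "length us = fsize A" "length vs = fsize A" and dist: "distinct us" "distinct vs" "set us \<inter> set vs = {}"
  shows "valid {#(neg A, rev us), (A, vs)#} (link (pol A) us vs)"
  unfolding valid_def
proof (intro conjI allI impI)
  have l: "length us = length (pol A)" "length vs = length (pol A)" using len by simp_all
  show "wf_slots {#(neg A, rev us), (A, vs)#}"
    using l dist length_pol_neg[of A] by (simp add: wf_slots_add wf_slots_single)
  have dual: "sources (pol (neg A)) (rev us) = targets (pol A) us" "targets (pol (neg A)) (rev us) = sources (pol A) us"
    by (simp_all only: pol_neg sources_dual[OF l(1)] targets_dual[OF l(1)])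
  show "matching (slot_sources {#(neg A, rev us), (A, vs)#}) (slot_targets {#(neg A, rev us), (A, vs)#}) (link (pol A) us vs)"
    using matching_link[OF l dist] by (simp add: dual Un_commute)
  have plug: "holds B ys (hide (set xs) (link (pol B) xs ys \<union> F))"
    if l: "length xs = length (pol B)" "length ys = length (pol B)" and dist: "distinct xs" "distinct ys" "set xs \<inter> set ys = {}"
      and F: "holds B xs F" for B xs ys and F :: "'t edge set"
  proof -
    define g where "g v = (if v \<in> set xs then ys ! (THE k. k < length xs \<and> xs ! k = v) else v)" for v
    have g: "g (xs ! k) = ys ! k" if k: "k < length xs" for k
    proof -
      have "(THE j. j < length xs \<and> xs ! j = xs ! k) = k"
        using k dist(1) by (intro the_equality) (auto simp: nth_eq_iff_index_eq)
      then show ?thesis using k by (simp add: g_def)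
    qed
    have mp: "map g xs = ys" using g l by (intro nth_equalityI) auto
    have m: "matching (sources (pol B) xs) (targets (pol B) xs) F" using holds_matching[OF F] by simp
    have "hide (set xs) (F \<union> link (pol B) xs ys) = rename g F"
      using sources_subset[of "pol B" xs] targets_subset[of "pol B" xs] g l
      by (intro hide_link(1)[OF l dist m]) (auto simp: g_def)
    moreover have "holds B (map g xs) (rename g F)"
      using F dist(2) mp by (intro holds_rename) (auto simp: distinct_map)
    ultimately show ?thesis using mp by (simp add: Un_commute)
  qed
  fix C ws M' and F :: "'t edge set"
  assume M': "{#(neg A, rev us), (A, vs)#} = add_mset (C, ws) M'" and F: "tests M' F"
  then consider "(C, ws) = (A, vs)" "M' = {#(neg A, rev us)#}" | "(C, ws) = (neg A, rev us)" "M' = {#(A, vs)#}"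
    by (auto simp: add_eq_conv_ex)
  then show "holds C ws (hide (slot_vertices M') (link (pol A) us vs \<union> F))"
  proof cases
    case 1
    then show ?thesis using F plug[OF l dist, of F] by (auto simp: tests_add)
  next
    case 2
    have "holds (neg A) (rev vs) F" using F 2 by (auto simp: tests_add)
    moreover have "(link (pol (neg A)) (rev vs) (rev us) :: 't edge set) = link (pol A) us vs"
      unfolding pol_neg by (rule link_dual[OF l])
    ultimately show ?thesis using 2 plug[of "rev vs" "neg A" "rev us" F] l dist length_pol_neg[of A]
      by (simp add: Int_commute)
  qed
qed

end

section \<open>Soundness of the model for derivations\<close>

subsection \<open>The rules in the standard numbering\<close>

lemma inj_on_cut_embed: "inj_on (cut_embed d a) {0<..}"
  by (auto simp: inj_on_def cut_embed_def split: if_splits)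

lemma map_cut_embed_block: "map (cut_embed d a) (block 0 a) = rev (block d a)"
  by (rule nth_equalityI) (auto simp: cut_embed_def rev_nth)

definition exchange_map :: "nat \<Rightarrow> nat \<Rightarrow> nat \<Rightarrow> nat \<Rightarrow> nat" where
  "exchange_map d a b v =
     (if v \<le> d then v else if v \<le> d + b then v + a else if v \<le> d + b + a then v - b else v)"

lemma inj_exchange_map: "inj (exchange_map d a b)"
  by (auto simp: inj_def exchange_map_def split: if_splits)

lemma exchange_mw_eq: "exchange_mw d a b = renumber (exchange_map d a b)"
  unfolding exchange_mw_def exchange_map_def ..

definition tensor_left :: "nat \<Rightarrow> nat \<Rightarrow> nat \<Rightarrow> nat \<Rightarrow> nat" where
  "tensor_left d a b v = (if v \<le> a then d + v else d + b + v)"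

definition tensor_right :: "nat \<Rightarrow> nat \<Rightarrow> nat \<Rightarrow> nat" where
  "tensor_right d a v = (if v \<le> d then v else a + v)"

lemma tensor_mw_eq:
  "tensor_mw d a b \<sigma> \<tau> = mw_union (renumber (tensor_left d a b) \<sigma>) (renumber (tensor_right d a) \<tau>)"
  unfolding tensor_mw_def tensor_left_def tensor_right_def ..

lemma inj_tensor_left: "inj (tensor_left d a b)" and inj_tensor_right: "inj (tensor_right d a)"
  by (auto simp: inj_def tensor_left_def tensor_right_def split: if_splits)

text \<open>Removes the \<open>2 * a\<close> numbers taken by the two cut blocks. It is injective on
  the vertices that remain after hiding, all of which avoid these blocks.\<close>

definition cut_close :: "nat \<Rightarrow> nat \<Rightarrow> nat \<Rightarrow> nat" where
  "cut_close d a v = (if v \<le> d then v else v - 2 * a)"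

lemma inj_on_cut_close: "inj_on (cut_close d a) ({0<..d} \<union> {d + 2 * a<..})"
  by (auto simp: inj_on_def cut_close_def split: if_splits)

context boundaries
begin

lemma fsize_neg [simp]: "fsize (neg A) = fsize A"
  by (simp add: formula_boundary_neg)

lemma rename_cut_embed:
  assumes "a = fsize A"
  shows "rename_slots (cut_embed d a) (mset (standard_slots 0 (\<Gamma> @ [A]))) =
    add_mset (A, rev (block d a)) (mset (standard_slots (d + 2 * a) \<Gamma>))"
proof -
  have "rename_slots (cut_embed d a) (mset (standard_slots a \<Gamma>)) = mset (standard_slots (d + 2 * a) \<Gamma>)"
    by (rule rename_standard_slots) (auto simp: cut_embed_def)
  then show ?thesis using assms by (simp add: standard_slots_append map_cut_embed_block)
qed

lemma rename_cut_close:
  assumes "d = ssize \<Delta>"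
  shows "rename_slots (cut_close d a) (mset (standard_slots (d + 2 * a) \<Gamma>) + mset (standard_slots 0 \<Delta>)) =
    mset (standard_slots 0 (\<Gamma> @ \<Delta>))"
proof -
  have "rename_slots (cut_close d a) (mset (standard_slots (d + 2 * a) \<Gamma>)) = mset (standard_slots d \<Gamma>)"
    by (rule rename_standard_slots) (auto simp: cut_close_def)
  moreover have "rename_slots (cut_close d a) (mset (standard_slots 0 \<Delta>)) = mset (standard_slots 0 \<Delta>)"
    by (rule rename_standard_slots) (auto simp: cut_close_def assms)
  ultimately show ?thesis using assms by (simp add: standard_slots_append)
qed

lemma rename_exchange_map:
  assumes "d = ssize \<Delta>" "a = fsize A" "c = fsize B"
  shows "rename_slots (exchange_map d a c) (mset (standard_slots (d + c + a) \<Gamma>)) = mset (standard_slots (d + a + c) \<Gamma>)"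
    "rename_slots (exchange_map d a c) (mset (standard_slots 0 \<Delta>)) = mset (standard_slots 0 \<Delta>)"
    "map (exchange_map d a c) (block (d + c) a) = block d a"
    "map (exchange_map d a c) (block d c) = block (d + a) c"
  using assms by (auto intro!: rename_standard_slots map_block simp: exchange_map_def)

lemma rename_tensor_left:
  assumes "a = fsize A"
  shows "rename_slots (tensor_left d a c) (mset (standard_slots a \<Gamma>)) = mset (standard_slots (d + (a + c)) \<Gamma>)"
    "map (tensor_left d a c) (block 0 a) = block d a"
  using assms by (auto intro!: rename_standard_slots map_block simp: tensor_left_def)

lemma rename_tensor_right:
  assumes "d = ssize \<Delta>"
  shows "rename_slots (tensor_right d a) (mset (standard_slots 0 \<Delta>)) = mset (standard_slots 0 \<Delta>)"
    "map (tensor_right d a) (block d c) = block (d + a) c"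
  using assms by (auto intro!: rename_standard_slots map_block simp: tensor_right_def)

lemma cut_mw_standard:
  fixes \<sigma> \<tau> :: "'t multiword"
  assumes E1: "matching (slot_sources (mset (standard_slots 0 (\<Gamma> @ [A])))) (slot_targets (mset (standard_slots 0 (\<Gamma> @ [A])))) (edges \<sigma>)"
    and E2: "matching (slot_sources (mset (standard_slots 0 (neg A # \<Delta>)))) (slot_targets (mset (standard_slots 0 (neg A # \<Delta>)))) (edges \<tau>)"
    and d: "d = ssize \<Delta>" and a: "a = fsize A"
  defines "H \<equiv> rename (cut_embed d a) (edges \<sigma>) \<union> edges \<tau>"
  shows "edges (cut_mw d a \<sigma> \<tau>) = rename (cut_close d a) (hide {d<..d + a} H)"
    and "regular (cut_mw d a \<sigma> \<tau>) \<longleftrightarrow> regular \<sigma> \<and> regular \<tau> \<and> \<not> cyc {d<..d + a} H"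
proof -
  note st = wf_slots_sources_Un_targets[OF wf_standard_slots]
  have pos: "0 \<notin> slot_sources (mset (standard_slots 0 (\<Gamma> @ [A]))) \<union> slot_targets (mset (standard_slots 0 (\<Gamma> @ [A])))"
    unfolding st slot_vertices_standard_slots by simp
  have le: "v \<le> d + a"
    if "v \<in> slot_sources (mset (standard_slots 0 (neg A # \<Delta>))) \<union> slot_targets (mset (standard_slots 0 (neg A # \<Delta>)))" for v
    using that unfolding st slot_vertices_standard_slots by (simp add: d a)
  note cut = cut_mw_eq_hide[OF E1 E2 wf_slots_sources_Int_targets[OF wf_standard_slots]
      wf_slots_sources_Int_targets[OF wf_standard_slots] pos le]
  show "edges (cut_mw d a \<sigma> \<tau>) = rename (cut_close d a) (hide {d<..d + a} H)"
    using cut(1) unfolding H_def cut_close_def[abs_def] .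
  show "regular (cut_mw d a \<sigma> \<tau>) \<longleftrightarrow> regular \<sigma> \<and> regular \<tau> \<and> \<not> cyc {d<..d + a} H"
    using cut(2) unfolding H_def .
qed

end

text \<open>Gluing and union only add to the singular part, so regularity passes from the conclusion
  to the premises. The soundness induction can thus be restricted to regular multiwords.\<close>

lemma regular_cut_mwD: "regular (cut_mw d a \<sigma> \<tau>) \<Longrightarrow> regular \<sigma> \<and> regular \<tau>"
  by (auto simp: cut_mw_def regular_def renumber_def glue_def mw_union_def)

text \<open>Soundness of the model. For a sequent with a single formula nothing remains to be
  plugged, so validity says that the derived multiword belongs to the set of that formula.\<close>

theorem (in semantics) adequacy:
  fixes G :: "('n, 't) llg"
  assumes G: "llg_boundary G = b"
    and lex: "\<And>\<sigma> \<Gamma>. \<lbrakk>(\<sigma>, \<Gamma>) \<in> llg_lexicon G; regular \<sigma>\<rbrakk> \<Longrightarrow> valid (mset (standard_slots 0 \<Gamma>)) (edges \<sigma>)"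
  shows "\<lbrakk>llg_derivable G \<sigma> \<Gamma>; regular \<sigma>\<rbrakk> \<Longrightarrow> valid (mset (standard_slots 0 \<Gamma>)) (edges \<sigma>)"
proof (induction rule: llg_derivable.induct)
  case (Lexicon \<sigma> \<Gamma>)
  then show ?case using lex by blast
next
  case (Id A)
  let ?n = "fsize A"
  have "valid {#(neg A, rev (rev (block ?n ?n))), (A, block 0 ?n)#} (link (pol A) (rev (block ?n ?n)) (block 0 ?n))"
    by (rule valid_link) auto
  then show ?case unfolding G edges_identity_mw pol_def by simp
next
  case (Cut \<sigma> \<Gamma> A \<tau> \<Delta>)
  let ?d = "ssize \<Delta>" and ?a = "fsize A"
  have reg: "regular \<sigma>" "regular \<tau>" using regular_cut_mwD[OF Cut.prems] by auto
  note v1 = Cut.IH(1)[OF reg(1)] and v2 = Cut.IH(2)[OF reg(2)]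
  let ?H = "rename (cut_embed ?d ?a) (edges \<sigma>) \<union> edges \<tau>"
  \<comment> \<open>Acyclicity of this cut comes from the regularity of its conclusion.\<close>
  have edges: "edges (cut_mw ?d ?a \<sigma> \<tau>) = rename (cut_close ?d ?a) (hide {?d<..?d + ?a} ?H)"
    and nc: "\<not> cyc {?d<..?d + ?a} ?H"
    using cut_mw_standard[OF validD(2)[OF v1] validD(2)[OF v2] refl refl] Cut.prems by (simp_all add: G)
  have "valid (add_mset (A, rev (block ?d ?a)) (mset (standard_slots (?d + 2 * ?a) \<Gamma>))) (rename (cut_embed ?d ?a) (edges \<sigma>))"
  proof -
    have "inj_on (cut_embed ?d ?a) (slot_vertices (mset (standard_slots 0 (\<Gamma> @ [A]))))"
      by (rule inj_on_subset[OF inj_on_cut_embed]) auto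
    from valid_rename[OF v1 this] show ?thesis unfolding rename_cut_embed[OF refl] .
  qed
  moreover have "valid (add_mset (neg A, rev (rev (block ?d ?a))) (mset (standard_slots 0 \<Delta>))) (edges \<tau>)"
    using v2 by simp
  ultimately have "valid (mset (standard_slots (?d + 2 * ?a) \<Gamma>) + mset (standard_slots 0 \<Delta>))
      (hide (set (rev (block ?d ?a))) ?H)"
    by (rule valid_cut) (use nc in auto)
  then have "valid (rename_slots (cut_close ?d ?a) (mset (standard_slots (?d + 2 * ?a) \<Gamma>) + mset (standard_slots 0 \<Delta>)))
      (rename (cut_close ?d ?a) (hide (set (rev (block ?d ?a))) ?H))"
    by (rule valid_rename) (rule inj_on_subset[OF inj_on_cut_close], auto)
  then show ?case unfolding rename_cut_close[OF refl] G edges by simp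
next
  case (Ex \<sigma> \<Gamma> A B \<Delta>)
  let ?f = "exchange_map (ssize \<Delta>) (fsize A) (fsize B)"
  note r = rename_exchange_map[OF refl refl refl, of \<Delta> A B]
  have "valid (mset (standard_slots 0 (\<Gamma> @ [A, B] @ \<Delta>))) (edges \<sigma>)"
    using Ex by (simp add: exchange_mw_eq)
  then have "valid (rename_slots ?f (mset (standard_slots 0 (\<Gamma> @ [A, B] @ \<Delta>)))) (rename ?f (edges \<sigma>))"
    by (rule valid_rename) (rule inj_on_subset[OF inj_exchange_map], simp)
  moreover have "rename_slots ?f (mset (standard_slots 0 (\<Gamma> @ [A, B] @ \<Delta>))) = mset (standard_slots 0 (\<Gamma> @ [B, A] @ \<Delta>))"
    by (simp add: standard_slots_append add.assoc[symmetric] r)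
  ultimately show ?case unfolding exchange_mw_eq G by simp
next
  case (Par \<sigma> \<Gamma> A B)
  then have "valid (add_mset (A, block (fsize B) (fsize A)) (add_mset (B, block 0 (fsize B))
      (mset (standard_slots (fsize B + fsize A) \<Gamma>)))) (edges \<sigma>)"
    by (simp add: standard_slots_append)
  from valid_par[OF this] show ?case
    using block_append[of 0 "fsize B" "fsize A"] by (simp add: standard_slots_append)
next
  case (Tensor \<sigma> \<Gamma> A \<tau> B \<Delta>)
  let ?d = "ssize \<Delta>" and ?a = "fsize A" and ?c = "fsize B"
  have reg: "regular \<sigma>" "regular \<tau>" using Tensor.prems by (auto simp: tensor_mw_eq)
  have v1: "valid (add_mset (A, block 0 ?a) (mset (standard_slots ?a \<Gamma>))) (edges \<sigma>)"
    using Tensor.IH(1)[OF reg(1)] by (simp add: standard_slots_append)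
  have v2: "valid (add_mset (B, block ?d ?c) (mset (standard_slots 0 \<Delta>))) (edges \<tau>)"
    using Tensor.IH(2)[OF reg(2)] by simp
  have "valid (add_mset (A, block ?d ?a) (mset (standard_slots (?d + (?a + ?c)) \<Gamma>))) (rename (tensor_left ?d ?a ?c) (edges \<sigma>))"
    using valid_rename[OF v1 inj_on_subset[OF inj_tensor_left[of ?d ?a ?c]]] by (simp add: rename_tensor_left)
  moreover have "valid (add_mset (B, block (?d + ?a) ?c) (mset (standard_slots 0 \<Delta>))) (rename (tensor_right ?d ?a) (edges \<tau>))"
    using valid_rename[OF v2 inj_on_subset[OF inj_tensor_right[of ?d ?a]]] by (simp add: rename_tensor_right)
  ultimately have "valid (add_mset (Tensor A B, block ?d ?a @ block (?d + ?a) ?c)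
      (mset (standard_slots (?d + (?a + ?c)) \<Gamma>) + mset (standard_slots 0 \<Delta>)))
      (rename (tensor_left ?d ?a ?c) (edges \<sigma>) \<union> rename (tensor_right ?d ?a) (edges \<tau>))"
    by (rule valid_tensor) auto
  then show ?case
    by (simp add: standard_slots_append tensor_mw_eq G block_append)
qed

lemma is_regular_multiword_matching:
  assumes r: "is_regular_multiword T X E"
  shows "matching (lefts X) (rights X) E"
proof (rule matchingI)
  have bounds: "lefts X \<subseteq> {1..bsize X}" "rights X \<subseteq> {1..bsize X}" "lefts X \<inter> rights X = {}"
    using lefts_subset by (auto simp: rights_def)
  have E: "i \<in> lefts X \<and> j \<in> rights X" if "(i, w, j) \<in> E" for i w j
    using r that by (auto simp: is_regular_multiword_def)
  have ex1: "\<exists>!e. e \<in> E \<and> (edge_source e = v \<or> edge_target e = v)" if "v \<in> lefts X \<union> rights X" for v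
    using r that bounds unfolding is_regular_multiword_def by blast
  have uniq: "e = e'" if "v \<in> lefts X \<union> rights X" "e \<in> E" "edge_source e = v \<or> edge_target e = v"
      "e' \<in> E" "edge_source e' = v \<or> edge_target e' = v" for v e e'
    using ex1[OF that(1)] that(2-5) by blast
  show "finite (lefts X)" "finite (rights X)"
    using finite_subset[OF bounds(1)] finite_subset[OF bounds(2)] by auto
  show "i \<in> lefts X \<and> j \<in> rights X" if "(i, w, j) \<in> E" for i w j using E that by blast
  show "\<exists>w j. (i, w, j) \<in> E" if i: "i \<in> lefts X" for i
  proof -
    obtain e where "e \<in> E" "edge_source e = i \<or> edge_target e = i" using ex1[of i] i by blast
    then show ?thesis using E[of "fst e" "fst (snd e)" "snd (snd e)"] i bounds(3) by (cases e) auto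
  qed
  show "\<exists>i w. (i, w, j) \<in> E" if j: "j \<in> rights X" for j
  proof -
    obtain e where "e \<in> E" "edge_source e = j \<or> edge_target e = j" using ex1[of j] j by blast
    then show ?thesis using E[of "fst e" "fst (snd e)" "snd (snd e)"] j bounds(3) by (cases e) auto
  qed
  show "w' = w \<and> j' = j" if "(i, w, j) \<in> E" "(i, w', j') \<in> E" for i w j w' j'
    using uniq[of i "(i, w, j)" "(i, w', j')"] E[OF that(1)] that by simp
  show "w' = w \<and> i' = i" if "(i, w, j) \<in> E" "(i', w', j) \<in> E" for i w j w' i'
    using uniq[of j "(i, w, j)" "(i', w', j)"] E[OF that(1)] that by simp
qed

section \<open>The derivation rules for multiwords with named vertices\<close>

section \<open>Derivability up to renaming of vertices\<close>

lemma rename_slots_comp: "rename_slots g (rename_slots h M) = rename_slots (g \<circ> h) M"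
  by (simp add: rename_slots_def multiset.map_comp o_def case_prod_beta')

lemma rename_slots_cong:
  assumes "\<And>v. v \<in> slot_vertices M \<Longrightarrow> g v = h v"
  shows "rename_slots g M = rename_slots h M"
  unfolding rename_slots_def
proof (rule image_mset_cong)
  fix x assume x: "x \<in># M"
  obtain A us where A: "x = (A, us)" by fastforce
  have "set us \<subseteq> slot_vertices M" using x A by (force simp: slot_vertices_def)
  then show "(\<lambda>(A, us). (A, map g us)) x = (\<lambda>(A, us). (A, map h us)) x" using assms A by auto
qed

lemma rename_slots_ident: "(\<And>v. v \<in> slot_vertices M \<Longrightarrow> g v = v) \<Longrightarrow> rename_slots g M = M"
  using rename_slots_cong[of M g id] by (simp add: rename_slots_def)

lemma distinct_map_exists:
  assumes "length xs = length ys" "distinct xs" "distinct ys"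
  obtains g where "map g xs = ys" "inj_on g (set xs)"
proof -
  define g where "g x = the (map_of (zip xs ys) x)" for x
  have "g (xs ! k) = ys ! k" if "k < length xs" for k
    using that assms by (simp add: g_def map_of_zip_nth)
  then have "map g xs = ys" using assms(1) by (intro nth_equalityI) auto
  then show thesis using that assms(3) by (metis distinct_map)
qed

locale named_derivability = boundaries "llg_boundary G" for G :: "('n, 't) llg"
begin

text \<open>The order of the formulas and the numbering of the vertices are quantified away, which
  makes Ex and all renumberings invisible. Rules can then be applied to multisets of slots whose
  premises share names.\<close>

definition derivable :: "'n slot multiset \<Rightarrow> 't edge set \<Rightarrow> bool" where
  "derivable M E \<longleftrightarrow> wf_slots M \<and> matching (slot_sources M) (slot_targets M) E \<and>
     (\<exists>g \<Gamma>. inj_on g (slot_vertices M) \<and> rename_slots g M = mset (standard_slots 0 \<Gamma>) \<and>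
        llg_derivable G (Multiword (rename g E) {#}) \<Gamma>)"

lemma derivableD:
  assumes "derivable M E"
  shows "wf_slots M" "matching (slot_sources M) (slot_targets M) E" "vertices E = slot_vertices M"
  using assms matching_vertices[of "slot_sources M" "slot_targets M" E] wf_slots_sources_Un_targets[of M]
  by (auto simp: derivable_def)

lemma derivable_lexicon:
  assumes "(\<sigma>, \<Gamma>) \<in> llg_lexicon G" "regular \<sigma>" "is_judgement G (\<sigma>, \<Gamma>)"
  shows "derivable (mset (standard_slots 0 \<Gamma>)) (edges \<sigma>)"
proof -
  let ?X = "sequent_boundary (llg_boundary G) \<Gamma>"
  have "matching (lefts ?X) (rights ?X) (edges \<sigma>)"
    using assms(3) by (intro is_regular_multiword_matching[of "llg_terminals G"])
      (simp add: is_judgement_def is_multiword_def)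
  moreover have "Multiword (rename id (edges \<sigma>)) {#} = \<sigma>"
    using assms(2) by (cases \<sigma>) (auto simp: regular_def rename_def)
  moreover have "rename_slots id (mset (standard_slots 0 \<Gamma>)) = mset (standard_slots 0 \<Gamma>)"
    by (rule rename_slots_ident) simp
  ultimately show ?thesis
    unfolding derivable_def using assms(1) llg_derivable.Lexicon[of \<sigma> \<Gamma> G] wf_standard_slots
    by (auto simp: slot_sources_standard_slots slot_targets_standard_slots
        simp del: id_apply intro!: exI[of _ id] exI[of _ \<Gamma>])
qed

lemma derivable_rename:
  assumes "derivable M E" "inj_on h (slot_vertices M)"
  shows "derivable (rename_slots h M) (rename h E)"
proof -
  obtain g \<Gamma> where g: "inj_on g (slot_vertices M)" "rename_slots g M = mset (standard_slots 0 \<Gamma>)"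
    "llg_derivable G (Multiword (rename g E) {#}) \<Gamma>" using assms(1) by (auto simp: derivable_def)
  let ?k = "inv_into (slot_vertices M) h"
  have k: "?k (h v) = v" if "v \<in> slot_vertices M" for v using that assms(2) by simp
  have "rename (g \<circ> ?k) (rename h E) = rename g E"
    unfolding rename_comp using derivableD(3)[OF assms(1)] k by (intro rename_cong) simp
  moreover have "rename_slots (g \<circ> ?k) (rename_slots h M) = rename_slots g M"
    unfolding rename_slots_comp using k by (intro rename_slots_cong) simp
  moreover have "inj_on (g \<circ> ?k) (slot_vertices (rename_slots h M))"
    using g(1) k by (auto simp: inj_on_def)
  moreover have "matching (slot_sources (rename_slots h M)) (slot_targets (rename_slots h M)) (rename h E)"
    using matching_rename[OF derivableD(2)[OF assms(1)]] assms(2)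
      wf_slots_sources_Un_targets[OF derivableD(1)[OF assms(1)]] by simp
  ultimately show ?thesis
    unfolding derivable_def using g wf_slots_rename[OF derivableD(1)[OF assms(1)] assms(2)]
    by (intro conjI exI[of _ "g \<circ> ?k"] exI[of _ \<Gamma>]) simp_all
qed

text \<open>Fixes the position of one formula, between \<Gamma> and \<Delta>, and leaves the order
  of the others open. It is the invariant for moving a formula by exchanges to the end or to the
  front, where Cut and Tensor expect it.\<close>

definition placed :: "'n formula \<Rightarrow> nat list \<Rightarrow> 'n slot multiset \<Rightarrow> 't edge set \<Rightarrow> 'n formula list \<Rightarrow> 'n formula list \<Rightarrow> bool" where
  "placed A us M E \<Gamma> \<Delta> \<longleftrightarrow> (\<exists>g. inj_on g (set us \<union> slot_vertices M) \<and> map g us = block (ssize \<Delta>) (fsize A) \<and>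
     rename_slots g M = mset (standard_slots (ssize \<Delta> + fsize A) \<Gamma>) + mset (standard_slots 0 \<Delta>) \<and>
     llg_derivable G (Multiword (rename g E) {#}) (\<Gamma> @ A # \<Delta>))"

lemma exchange_Multiword: "exchange_mw d a c (Multiword E {#}) = Multiword (rename (exchange_map d a c) E) {#}"
  by (simp add: exchange_mw_eq renumber_def rename_def)

lemma derivable_placed:
  assumes "derivable (add_mset (A, us) M) E"
  shows "\<exists>\<Gamma> \<Delta>. placed A us M E \<Gamma> \<Delta>"
proof -
  obtain g \<Gamma> where g: "inj_on g (set us \<union> slot_vertices M)"
    "add_mset (A, map g us) (rename_slots g M) = mset (standard_slots 0 \<Gamma>)"
    "llg_derivable G (Multiword (rename g E) {#}) \<Gamma>" using assms by (auto simp: derivable_def)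
  then have "(A, map g us) \<in> set (standard_slots 0 \<Gamma>)"
    by (metis set_mset_mset union_single_eq_member)
  then obtain l1 l2 where l: "standard_slots 0 \<Gamma> = l1 @ (A, map g us) # l2" by (meson split_list)
  have "\<Gamma> = map fst (standard_slots 0 \<Gamma>)" by simp
  also have "\<dots> = map fst l1 @ A # map fst l2" by (simp add: l)
  finally have \<Gamma>: "\<Gamma> = map fst l1 @ A # map fst l2" .
  have "standard_slots 0 \<Gamma> = standard_slots (ssize (A # map fst l2)) (map fst l1) @
      (A, block (ssize (map fst l2)) (fsize A)) # standard_slots 0 (map fst l2)"
    by (subst \<Gamma>) (simp add: standard_slots_append)
  moreover have "length (standard_slots d \<Delta>) = length \<Delta>" for d \<Delta>
    by (metis length_map map_fst_standard_slots)
  ultimately have "l1 = standard_slots (ssize (A # map fst l2)) (map fst l1)"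
      "map g us = block (ssize (map fst l2)) (fsize A)" "l2 = standard_slots 0 (map fst l2)"
    using l by (auto simp: append_eq_append_conv)
  moreover have "rename_slots g M = mset l1 + mset l2" using g(2) l by simp
  ultimately have "placed A us M E (map fst l1) (map fst l2)"
    unfolding placed_def using g(1,3) \<Gamma> by (intro exI[of _ g]) (simp add: add.commute)
  then show ?thesis by blast
qed

lemma placed_right:
  assumes "placed A us M E \<Gamma> (B # \<Delta>)"
  shows "placed A us M E (\<Gamma> @ [B]) \<Delta>"
proof -
  let ?f = "exchange_map (ssize \<Delta>) (fsize A) (fsize B)"
  note r = rename_exchange_map[OF refl refl refl, of \<Delta> A B]
  obtain g where g: "inj_on g (set us \<union> slot_vertices M)" "map g us = block (ssize \<Delta> + fsize B) (fsize A)"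
    "rename_slots g M = mset (standard_slots (ssize \<Delta> + fsize B + fsize A) \<Gamma>) + mset (standard_slots 0 (B # \<Delta>))"
    "llg_derivable G (Multiword (rename g E) {#}) (\<Gamma> @ [A, B] @ \<Delta>)"
    using assms by (auto simp: placed_def)
  have "inj_on (?f \<circ> g) (set us \<union> slot_vertices M)"
    using g(1) inj_exchange_map by (intro comp_inj_on) (auto intro: inj_on_subset)
  moreover have "map (?f \<circ> g) us = block (ssize \<Delta>) (fsize A)"
    using g(2) r(3) by (simp flip: map_map)
  moreover have "rename_slots (?f \<circ> g) M =
      mset (standard_slots (ssize \<Delta> + fsize A) (\<Gamma> @ [B])) + mset (standard_slots 0 \<Delta>)"
    unfolding rename_slots_comp[symmetric] g(3) using r by (simp add: standard_slots_append)
  moreover have "llg_derivable G (Multiword (rename (?f \<circ> g) E) {#}) ((\<Gamma> @ [B]) @ A # \<Delta>)"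
    using llg_derivable.Ex[OF g(4)] unfolding exchange_Multiword rename_comp by simp
  ultimately show ?thesis unfolding placed_def by blast
qed

lemma placed_left:
  assumes "placed A us M E (\<Gamma> @ [B]) \<Delta>"
  shows "placed A us M E \<Gamma> (B # \<Delta>)"
proof -
  let ?f = "exchange_map (ssize \<Delta>) (fsize B) (fsize A)"
  note r = rename_exchange_map[OF refl refl refl, of \<Delta> B A]
  obtain g where g: "inj_on g (set us \<union> slot_vertices M)" "map g us = block (ssize \<Delta>) (fsize A)"
    "rename_slots g M = mset (standard_slots (ssize \<Delta> + fsize A) (\<Gamma> @ [B])) + mset (standard_slots 0 \<Delta>)"
    "llg_derivable G (Multiword (rename g E) {#}) (\<Gamma> @ [B, A] @ \<Delta>)"
    using assms by (auto simp: placed_def)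
  have "inj_on (?f \<circ> g) (set us \<union> slot_vertices M)"
    using g(1) inj_exchange_map by (intro comp_inj_on) (auto intro: inj_on_subset)
  moreover have "map (?f \<circ> g) us = block (ssize (B # \<Delta>)) (fsize A)"
    using g(2) r(4) by (simp flip: map_map)
  moreover have "rename_slots (?f \<circ> g) M =
      mset (standard_slots (ssize (B # \<Delta>) + fsize A) \<Gamma>) + mset (standard_slots 0 (B # \<Delta>))"
    unfolding rename_slots_comp[symmetric] g(3) using r by (simp add: standard_slots_append)
  moreover have "llg_derivable G (Multiword (rename (?f \<circ> g) E) {#}) (\<Gamma> @ A # B # \<Delta>)"
    using llg_derivable.Ex[OF g(4)] unfolding exchange_Multiword rename_comp by simp
  ultimately show ?thesis unfolding placed_def by blast
qed

lemma derivable_placed_last: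
  assumes "derivable (add_mset (A, us) M) E"
  shows "\<exists>\<Gamma>. placed A us M E \<Gamma> []"
proof -
  have "placed A us M E \<Gamma> \<Delta> \<Longrightarrow> \<exists>\<Gamma>. placed A us M E \<Gamma> []" for \<Gamma> \<Delta>
    by (induction \<Delta> arbitrary: \<Gamma>) (auto dest: placed_right)
  then show ?thesis using derivable_placed[OF assms] by blast
qed

lemma derivable_placed_first:
  assumes "derivable (add_mset (A, us) M) E"
  shows "\<exists>\<Delta>. placed A us M E [] \<Delta>"
proof -
  have "placed A us M E \<Gamma> \<Delta> \<Longrightarrow> \<exists>\<Delta>. placed A us M E [] \<Delta>" for \<Gamma> \<Delta>
    by (induction \<Gamma> arbitrary: \<Delta> rule: rev_induct) (auto dest: placed_left)
  then show ?thesis using derivable_placed[OF assms] by blast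
qed

text \<open>The rule takes the last formula of one premise and the first of the other, so the cut
  slots are moved there. Their common names \<open>us\<close> already express the identification
  that \<open>cut_mw\<close> carries out on numbers.\<close>

lemma derivable_cut:
  assumes d1: "derivable (add_mset (A, us) M1) E1" and d2: "derivable (add_mset (neg A, rev us) M2) E2"
    and disj: "slot_vertices M1 \<inter> slot_vertices M2 = {}" and nc: "\<not> cyc (set us) (E1 \<union> E2)"
  shows "derivable (M1 + M2) (hide (set us) (E1 \<union> E2))"
proof -
  let ?a = "fsize A"
  obtain \<Gamma> g1 where g1: "inj_on g1 (set us \<union> slot_vertices M1)" "map g1 us = block 0 ?a"
    "rename_slots g1 M1 = mset (standard_slots ?a \<Gamma>)"
    "llg_derivable G (Multiword (rename g1 E1) {#}) (\<Gamma> @ [A])"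
    using derivable_placed_last[OF d1] by (auto simp: placed_def)
  obtain \<Delta> g2 where g2: "inj_on g2 (set us \<union> slot_vertices M2)" "map g2 (rev us) = block (ssize \<Delta>) ?a"
    "rename_slots g2 M2 = mset (standard_slots 0 \<Delta>)"
    "llg_derivable G (Multiword (rename g2 E2) {#}) (neg A # \<Delta>)"
    using derivable_placed_first[OF d2] by (auto simp: placed_def)
  let ?d = "ssize \<Delta>"
  \<comment> \<open>One renaming for both premises together. It is consistent on \<open>us\<close>,
    where both numberings agree by \<open>map_cut_embed_block\<close>.\<close>
  define k where "k v = (if v \<in> set us \<union> slot_vertices M2 then g2 v else cut_embed ?d ?a (g1 v))" for v
  have w: "set us \<inter> slot_vertices M1 = {}" "set us \<inter> slot_vertices M2 = {}"
    using derivableD(1)[OF d1] derivableD(1)[OF d2] by (auto simp: wf_slots_add)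
  have img1: "g1 ` slot_vertices M1 = {?a<..?a + ssize \<Gamma>}" "g1 ` set us = {0<..?a}"
    using arg_cong[OF g1(3), of slot_vertices] arg_cong[OF g1(2), of set] by simp_all
  have img2: "g2 ` slot_vertices M2 = {0<..?d}" "g2 ` set us = {?d<..?d + ?a}"
    using arg_cong[OF g2(3), of slot_vertices] arg_cong[OF g2(2), of set] by simp_all
  have "map (cut_embed ?d ?a \<circ> g1) us = map g2 us"
    using g1(2) g2(2) map_cut_embed_block[of ?d ?a] by (metis map_map rev_map rev_rev_ident)
  then have us: "cut_embed ?d ?a (g1 v) = g2 v" if "v \<in> set us" for v using that by auto
  have k1: "k v = cut_embed ?d ?a (g1 v)" if "v \<in> set us \<union> slot_vertices M1" for v
    using that us disj by (auto simp: k_def)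
  have k2: "k v = g2 v" if "v \<in> set us \<union> slot_vertices M2" for v
    using that by (simp add: k_def)
  have imgk: "k ` slot_vertices M1 = cut_embed ?d ?a ` {?a<..?a + ssize \<Gamma>}"
    using k1 img1(1) by (metis (no_types, lifting) UnCI image_cong image_image)
  have ge: "k v > ?d + 2 * ?a" if "v \<in> slot_vertices M1" for v
  proof -
    have "k v \<in> cut_embed ?d ?a ` {?a<..?a + ssize \<Gamma>}" using imgk that by blast
    then show ?thesis by (auto simp: cut_embed_def)
  qed
  have le: "k v \<le> ?d + ?a \<and> 0 < k v" if "v \<in> set us \<union> slot_vertices M2" for v
  proof -
    have "g2 v \<in> g2 ` set us \<union> g2 ` slot_vertices M2" using that by blast
    then show ?thesis unfolding img2 using k2[OF that] by auto
  qed
  have inj1: "inj_on k (slot_vertices M1)"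
  proof -
    have "inj_on (cut_embed ?d ?a \<circ> g1) (slot_vertices M1)"
    proof (rule comp_inj_on)
      show "inj_on g1 (slot_vertices M1)" using g1(1) by (auto intro: inj_on_subset)
      show "inj_on (cut_embed ?d ?a) (g1 ` slot_vertices M1)"
        unfolding img1 by (rule inj_on_subset[OF inj_on_cut_embed]) auto
    qed
    then show ?thesis using k1 by (simp add: inj_on_def)
  qed
  have inj2: "inj_on k (set us \<union> slot_vertices M2)"
    using g2(1) k2 by (simp add: inj_on_def)
  have injk: "inj_on k (set us \<union> slot_vertices M1 \<union> slot_vertices M2)"
  proof (rule inj_onI)
    fix x y assume xy: "x \<in> set us \<union> slot_vertices M1 \<union> slot_vertices M2" "y \<in> set us \<union> slot_vertices M1 \<union> slot_vertices M2" "k x = k y"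
    then consider "x \<in> slot_vertices M1" "y \<in> slot_vertices M1"
      | "x \<in> set us \<union> slot_vertices M2" "y \<in> set us \<union> slot_vertices M2"
      | "x \<in> slot_vertices M1" "y \<in> set us \<union> slot_vertices M2"
      | "y \<in> slot_vertices M1" "x \<in> set us \<union> slot_vertices M2" by blast
    then show "x = y"
      using xy(3) inj1 inj2 ge[of x] ge[of y] le[of x] le[of y] by cases (auto simp: inj_on_def)
  qed
  have vE: "vertices E1 = set us \<union> slot_vertices M1" "vertices E2 = set us \<union> slot_vertices M2"
    using derivableD(3)[OF d1] derivableD(3)[OF d2] by simp_all
  have H: "rename (cut_embed ?d ?a) (rename g1 E1) \<union> rename g2 E2 = rename k (E1 \<union> E2)"
    unfolding rename_comp rename_Un using k1 k2 vE
    by (intro arg_cong2[where f = "(\<union>)"] rename_cong) simp_all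
  have kus: "{?d<..?d + ?a} = k ` set us" using img2(2) k2 by (metis UnCI image_cong)
  have injH: "inj_on k (vertices (E1 \<union> E2) \<union> set us)" using injk vE by (auto intro: inj_on_subset)
  have std1: "rename_slots g1 (add_mset (A, us) M1) = mset (standard_slots 0 (\<Gamma> @ [A]))"
    using g1 by (simp add: standard_slots_append)
  have std2: "rename_slots g2 (add_mset (neg A, rev us) M2) = mset (standard_slots 0 (neg A # \<Delta>))"
    using g2 by simp
  have m1: "matching (slot_sources (mset (standard_slots 0 (\<Gamma> @ [A])))) (slot_targets (mset (standard_slots 0 (\<Gamma> @ [A])))) (rename g1 E1)"
    unfolding std1[symmetric] slot_sources_rename slot_targets_rename using g1(1) wf_slots_sources_Un_targets[OF derivableD(1)[OF d1]]
    by (intro matching_rename derivableD(2)[OF d1]) simp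
  have m2: "matching (slot_sources (mset (standard_slots 0 (neg A # \<Delta>)))) (slot_targets (mset (standard_slots 0 (neg A # \<Delta>)))) (rename g2 E2)"
    unfolding std2[symmetric] slot_sources_rename slot_targets_rename using g2(1) wf_slots_sources_Un_targets[OF derivableD(1)[OF d2]]
    by (intro matching_rename derivableD(2)[OF d2]) simp
  let ?\<sigma> = "Multiword (rename g1 E1) {#}" and ?\<tau> = "Multiword (rename g2 E2) {#}"
  note cut = cut_mw_standard[where \<sigma> = ?\<sigma> and \<tau> = ?\<tau>, unfolded multiword.sel, OF m1 m2 refl refl]
  have "edges (cut_mw ?d ?a ?\<sigma> ?\<tau>) = rename (cut_close ?d ?a \<circ> k) (hide (set us) (E1 \<union> E2))"
    unfolding cut(1) H kus hide_rename[OF injH] by (rule rename_comp)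
  moreover have "regular (cut_mw ?d ?a ?\<sigma> ?\<tau>)"
    unfolding cut(2) H kus cyc_rename[OF injH] using nc by (simp add: regular_def)
  ultimately have mw: "cut_mw ?d ?a ?\<sigma> ?\<tau> = Multiword (rename (cut_close ?d ?a \<circ> k) (hide (set us) (E1 \<union> E2))) {#}"
    by (simp add: regular_def multiword.expand)
  have "llg_derivable G (cut_mw ?d ?a ?\<sigma> ?\<tau>) (\<Gamma> @ \<Delta>)"
    by (rule llg_derivable.Cut[OF g1(4) g2(4)])
  moreover have "rename_slots (cut_close ?d ?a \<circ> k) (M1 + M2) = mset (standard_slots 0 (\<Gamma> @ \<Delta>))"
  proof -
    have "rename_slots k M1 = rename_slots (cut_embed ?d ?a) (rename_slots g1 M1)"
      unfolding rename_slots_comp using k1 by (intro rename_slots_cong) simp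
    also have "\<dots> = mset (standard_slots (?d + 2 * ?a) \<Gamma>)"
      unfolding g1(3) by (rule rename_standard_slots) (auto simp: cut_embed_def)
    finally have "rename_slots k (M1 + M2) = mset (standard_slots (?d + 2 * ?a) \<Gamma>) + mset (standard_slots 0 \<Delta>)"
      using rename_slots_cong[of M2 k g2] k2 g2(3) by simp
    then show ?thesis unfolding rename_slots_comp[symmetric] using rename_cut_close[OF refl] by simp
  qed
  \<comment> \<open>With \<open>us\<close> hidden, the remaining vertices lie at most at
    \<open>d\<close> or beyond \<open>d + 2 * a\<close>, so that closing the gap merges none of
    them.\<close>
  moreover have "inj_on (cut_close ?d ?a \<circ> k) (slot_vertices (M1 + M2))"
  proof (rule comp_inj_on)
    show "inj_on k (slot_vertices (M1 + M2))" using injk by (auto intro: inj_on_subset)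
    have "k ` slot_vertices M2 = {0<..?d}" using img2(1) k2 by (metis UnCI image_cong)
    then have "k ` slot_vertices (M1 + M2) \<subseteq> {0<..?d} \<union> {?d + 2 * ?a<..}"
      using ge by (auto simp: image_Un)
    then show "inj_on (cut_close ?d ?a) (k ` slot_vertices (M1 + M2))"
      by (rule inj_on_subset[OF inj_on_cut_close])
  qed
  ultimately show ?thesis
    unfolding derivable_def mw
    using cut_matching[OF derivableD(1)[OF d1] derivableD(1)[OF d2] derivableD(2)[OF d1] derivableD(2)[OF d2] disj nc]
    by blast
qed

end

lemma link_image:
  "link p us vs = (\<lambda>k. if p ! k then (vs ! k, [], us ! k) else (us ! k, [], vs ! k)) ` {..<length p}"
  by (auto simp: link_def image_iff)

lemma rename_link:
  assumes "length us = length p" "length vs = length p"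
  shows "rename g (link p us vs) = link p (map g us) (map g vs)"
  unfolding link_image rename_def image_image using assms by (intro image_cong) auto

lemma link_append:
  assumes "length us = length p" "length vs = length p"
  shows "link (p @ q) (us @ us') (vs @ vs') = link p us vs \<union> link q us' vs'"
proof -
  let ?f = "\<lambda>p us vs k. if p ! k then (vs ! k, [], us ! k) else (us ! k, [], vs ! k)"
  have "(+) (length p) ` {..<length q} = {length p..<length p + length q}"
    using image_add_atLeastLessThan[of "length p" 0 "length q"] by (simp add: atLeast0LessThan add.commute)
  then have "{..<length (p @ q)} = {..<length p} \<union> (+) (length p) ` {..<length q}" by auto
  then have "link (p @ q) (us @ us') (vs @ vs') = ?f (p @ q) (us @ us') (vs @ vs') ` {..<length p} \<union>
      (\<lambda>k. ?f (p @ q) (us @ us') (vs @ vs') (length p + k)) ` {..<length q}"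
    unfolding link_image by (simp only: image_Un image_image)
  also have "?f (p @ q) (us @ us') (vs @ vs') ` {..<length p} = link p us vs"
    unfolding link_image using assms by (intro image_cong) (auto simp: nth_append)
  also have "(\<lambda>k. ?f (p @ q) (us @ us') (vs @ vs') (length p + k)) ` {..<length q} = link q us' vs'"
    unfolding link_image using assms by (intro image_cong) (auto simp: nth_append)
  finally show ?thesis .
qed

lemma inj_on_UnI: "\<lbrakk>inj_on k X; inj_on k Y; k ` X \<inter> k ` Y = {}\<rbrakk> \<Longrightarrow> inj_on k (X \<union> Y)"
  by (auto simp: inj_on_Un)

context named_derivability
begin

lemma derivable_tensor:
  assumes d1: "derivable (add_mset (A, us) M1) E1" and d2: "derivable (add_mset (B, vs) M2) E2"
    and disj: "slot_vertices (add_mset (A, us) M1) \<inter> slot_vertices (add_mset (B, vs) M2) = {}"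
  shows "derivable (add_mset (Tensor A B, us @ vs) (M1 + M2)) (E1 \<union> E2)"
proof -
  let ?a = "fsize A" and ?c = "fsize B"
  obtain \<Gamma> g1 where g1: "inj_on g1 (set us \<union> slot_vertices M1)" "map g1 us = block 0 ?a"
    "rename_slots g1 M1 = mset (standard_slots ?a \<Gamma>)"
    "llg_derivable G (Multiword (rename g1 E1) {#}) (\<Gamma> @ [A])"
    using derivable_placed_last[OF d1] by (auto simp: placed_def)
  obtain \<Delta> g2 where g2: "inj_on g2 (set vs \<union> slot_vertices M2)" "map g2 vs = block (ssize \<Delta>) ?c"
    "rename_slots g2 M2 = mset (standard_slots 0 \<Delta>)"
    "llg_derivable G (Multiword (rename g2 E2) {#}) (B # \<Delta>)"
    using derivable_placed_first[OF d2] by (auto simp: placed_def)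
  let ?d = "ssize \<Delta>"
  let ?l = "tensor_left ?d ?a ?c" and ?r = "tensor_right ?d ?a"
  define k where "k v = (if v \<in> set us \<union> slot_vertices M1 then ?l (g1 v) else ?r (g2 v))" for v
  have k1: "k v = (?l \<circ> g1) v" if "v \<in> set us \<union> slot_vertices M1" for v
    using that by (simp add: k_def)
  have k2: "k v = (?r \<circ> g2) v" if "v \<in> set vs \<union> slot_vertices M2" for v
    using that disj by (auto simp: k_def)
  have M1: "rename_slots k M1 = mset (standard_slots (?d + (?a + ?c)) \<Gamma>)"
    using rename_slots_cong[of M1 k "?l \<circ> g1"] k1 g1(3) rename_tensor_left(1)[OF refl, of ?d A]
    by (simp flip: rename_slots_comp)
  have M2: "rename_slots k M2 = mset (standard_slots 0 \<Delta>)"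
    using rename_slots_cong[of M2 k "?r \<circ> g2"] k2 g2(3) rename_tensor_right(1)[OF refl, of \<Delta>]
    by (simp flip: rename_slots_comp)
  have kus: "map k us = block ?d ?a"
    using g1(2) k1 rename_tensor_left(2)[OF refl, of ?d A] by (metis (no_types, lifting) UnCI map_cong map_map)
  have kvs: "map k vs = block (?d + ?a) ?c"
    using g2(2) k2 rename_tensor_right(2)[OF refl, of \<Delta>] by (metis (no_types, lifting) UnCI map_cong map_map)
  have std: "rename_slots k (add_mset (Tensor A B, us @ vs) (M1 + M2)) = mset (standard_slots 0 (\<Gamma> @ [Tensor A B] @ \<Delta>))"
    using M1 M2 kus kvs by (simp add: standard_slots_append block_append)
  have "k ` slot_vertices M1 = {?d + (?a + ?c)<..?d + (?a + ?c) + ssize \<Gamma>}" "k ` set us = {?d<..?d + ?a}"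
    "k ` slot_vertices M2 = {0<..?d}" "k ` set vs = {?d + ?a<..?d + ?a + ?c}"
    using arg_cong[OF M1, of slot_vertices] arg_cong[OF M2, of slot_vertices] arg_cong[OF kus, of set] arg_cong[OF kvs, of set]
    by simp_all
  then have kimg: "k ` (set us \<union> slot_vertices M1) \<inter> k ` (set vs \<union> slot_vertices M2) = {}"
    unfolding image_Un by auto
  have "inj_on (?l \<circ> g1) (set us \<union> slot_vertices M1)"
    by (rule comp_inj_on[OF g1(1) inj_on_subset[OF inj_tensor_left]]) simp
  then have i1: "inj_on k (set us \<union> slot_vertices M1)" using k1 by (simp add: inj_on_def)
  have "inj_on (?r \<circ> g2) (set vs \<union> slot_vertices M2)"
    by (rule comp_inj_on[OF g2(1) inj_on_subset[OF inj_tensor_right]]) simp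
  then have i2: "inj_on k (set vs \<union> slot_vertices M2)" using k2 by (simp add: inj_on_def)
  have "inj_on k ((set us \<union> slot_vertices M1) \<union> (set vs \<union> slot_vertices M2))"
    by (rule inj_on_UnI[OF i1 i2 kimg])
  then have injk: "inj_on k (slot_vertices (add_mset (Tensor A B, us @ vs) (M1 + M2)))"
    by (rule inj_on_subset) auto
  have vE: "vertices E1 = set us \<union> slot_vertices M1" "vertices E2 = set vs \<union> slot_vertices M2"
    using derivableD(3)[OF d1] derivableD(3)[OF d2] by simp_all
  have "rename ?l (rename g1 E1) = rename k E1" "rename ?r (rename g2 E2) = rename k E2"
    unfolding rename_comp using k1 k2 vE by (auto intro!: rename_cong)
  then have "tensor_mw ?d ?a ?c (Multiword (rename g1 E1) {#}) (Multiword (rename g2 E2) {#}) =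
      Multiword (rename k (E1 \<union> E2)) {#}"
    by (simp add: tensor_mw_eq mw_union_def renumber_def flip: rename_def)
  then have "llg_derivable G (Multiword (rename k (E1 \<union> E2)) {#}) (\<Gamma> @ [Tensor A B] @ \<Delta>)"
    using llg_derivable.Tensor[OF g1(4) g2(4)] by simp
  then show ?thesis unfolding derivable_def
    using std injk tensor_matching[OF derivableD(1)[OF d1] derivableD(1)[OF d2] derivableD(2)[OF d1] derivableD(2)[OF d2] disj]
    by blast
qed

lemma derivable_link:
  assumes A: "set_formula A \<subseteq> llg_literals G"
    and len: "length us = fsize A" "length vs = fsize A" and dist: "distinct us" "distinct vs" "set us \<inter> set vs = {}"
  shows "derivable {#(neg A, rev us), (A, vs)#} (link (pol A) us vs)"
proof -
  let ?n = "fsize A"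
  have l: "length us = length (pol A)" "length vs = length (pol A)" using len by simp_all
  obtain g where g: "map g (us @ vs) = rev (block ?n ?n) @ block 0 ?n" "inj_on g (set (us @ vs))"
    using distinct_map_exists[of "us @ vs" "rev (block ?n ?n) @ block 0 ?n"] len dist by auto
  then have g': "map g us = rev (block ?n ?n)" "map g vs = block 0 ?n" using len by auto
  have rl: "rename g (link (pol A) us vs) = (link (pol A) (rev (block ?n ?n)) (block 0 ?n) :: 't edge set)"
    unfolding rename_link[OF l] g' ..
  have "llg_derivable G (Multiword (rename g (link (pol A) us vs)) {#}) [neg A, A]"
  proof -
    have "(identity_mw (formula_boundary (llg_boundary G) A) :: 't multiword) = Multiword (rename g (link (pol A) us vs)) {#}"
    proof (rule multiword.expand, intro conjI)
      show "(edges (identity_mw (formula_boundary (llg_boundary G) A)) :: 't edge set) = edges (Multiword (rename g (link (pol A) us vs)) {#})"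
        unfolding edges_identity_mw multiword.sel rl unfolding pol_def ..
    qed (simp add: identity_mw_def)
    then show ?thesis using llg_derivable.Id[OF A] by simp
  qed
  moreover have "rename_slots g {#(neg A, rev us), (A, vs)#} = mset (standard_slots 0 [neg A, A])"
    using g' by (simp add: rev_map[symmetric])
  moreover have "inj_on g (slot_vertices {#(neg A, rev us), (A, vs)#})" using g(2) by simp
  moreover have "wf_slots {#(neg A, rev us), (A, vs)#}"
    using l dist by (simp add: wf_slots_add wf_slots_single)
  moreover have "matching (slot_sources {#(neg A, rev us), (A, vs)#}) (slot_targets {#(neg A, rev us), (A, vs)#}) (link (pol A) us vs :: 't edge set)"
    using matching_link[OF l dist, where ?'a = 't]
    by (simp add: pol_neg sources_dual[OF l(1)] targets_dual[OF l(1)] Un_commute)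
  ultimately show ?thesis unfolding derivable_def by blast
qed

text \<open>Invertibility of par by a cut against the tensor of two identity links, which proves
  \<open>neg A\<close> tensor \<open>neg B\<close> together with \<open>A\<close> and
  \<open>B\<close>. By \<open>hide_link\<close> the cut merely gives the vertices fresh names, which
  are then renamed back.\<close>

lemma derivable_par_inverse:
  assumes d: "derivable (add_mset (Par A B, us2 @ us1) M) E" and len: "length us1 = fsize A"
    and lits: "set_formula A \<subseteq> llg_literals G" "set_formula B \<subseteq> llg_literals G"
  shows "derivable (add_mset (A, us1) (add_mset (B, us2) M)) E"
proof -
  have w: "wf_slots (add_mset (Par A B, us2 @ us1) M)" by (rule derivableD(1)[OF d])
  have len2: "length us2 = fsize B" and dist: "distinct us1" "distinct us2" "set us1 \<inter> set us2 = {}"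
    and dM: "set us1 \<inter> slot_vertices M = {}" "set us2 \<inter> slot_vertices M = {}"
    using w len by (auto simp: wf_slots_add)
  \<comment> \<open>An upper bound of all names in use; blocks that start above it are
    fresh.\<close>
  define n where "n = Max (insert 0 (set us1 \<union> set us2 \<union> slot_vertices M))"
  have le: "v \<le> n" if "v \<in> set us1 \<union> set us2 \<union> slot_vertices M" for v
    unfolding n_def using that by (intro Max_ge) auto
  define vs1 where "vs1 = block n (fsize A)"
  define vs2 where "vs2 = block (n + fsize A) (fsize B)"
  have vs: "length vs1 = fsize A" "length vs2 = fsize B" "distinct vs1" "distinct vs2" "set vs1 \<inter> set vs2 = {}"
    by (auto simp: vs1_def vs2_def)
  have gt: "n < v" if "v \<in> set vs1 \<union> set vs2" for v using that by (auto simp: vs1_def vs2_def)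
  have fresh: "set vs1 \<inter> (set us1 \<union> set us2 \<union> slot_vertices M) = {}" "set vs2 \<inter> (set us1 \<union> set us2 \<union> slot_vertices M) = {}"
    using le gt by (fastforce simp: disjoint_iff)+
  have "derivable {#(neg A, rev us1), (A, vs1)#} (link (pol A) us1 vs1)"
    using lits len vs dist fresh by (intro derivable_link) auto
  moreover have "derivable {#(neg B, rev us2), (B, vs2)#} (link (pol B) us2 vs2)"
    using lits len2 vs dist fresh by (intro derivable_link) auto
  ultimately have "derivable (add_mset (Tensor (neg A) (neg B), rev us1 @ rev us2) ({#(A, vs1)#} + {#(B, vs2)#}))
      (link (pol A) us1 vs1 \<union> link (pol B) us2 vs2)"
    by (rule derivable_tensor) (use dist vs fresh in auto)
  moreover have "(link (pol A) us1 vs1 \<union> link (pol B) us2 vs2 :: 't edge set) = link (pol (Par A B)) (us2 @ us1) (vs2 @ vs1)"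
    unfolding pol_Par using len2 vs by (subst link_append) auto
  ultimately have d2: "derivable (add_mset (neg (Par A B), rev (us2 @ us1)) {#(A, vs1), (B, vs2)#})
      (link (pol (Par A B)) (us2 @ us1) (vs2 @ vs1))"
    by (simp add: add_mset_commute)
  obtain h where h: "map h (us2 @ us1) = vs2 @ vs1" "inj_on h (set (us2 @ us1))"
    using distinct_map_exists[of "us2 @ us1" "vs2 @ vs1"] len len2 vs dist by auto
  define g where "g v = (if v \<in> set (us2 @ us1) then h v else v)" for v
  have gh: "map g (us2 @ us1) = vs2 @ vs1" unfolding h(1)[symmetric] by (auto simp: g_def)
  let ?us = "us2 @ us1" and ?vs = "vs2 @ vs1" and ?p = "pol (Par A B)"
  have lp: "length ?us = length ?p" "length ?vs = length ?p" using len len2 vs by auto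
  have g: "g (?us ! k) = ?vs ! k" if "k < length ?p" for k
    using that lp gh by (metis nth_map)
  have S: "slot_sources (add_mset (Par A B, ?us) M) \<inter> set ?us = sources ?p ?us"
    "slot_targets (add_mset (Par A B, ?us) M) \<inter> set ?us = targets ?p ?us"
    using slot_sources_subset[of M] slot_targets_subset[of M] dM sources_subset[of ?p ?us] targets_subset[of ?p ?us] by auto
  have du: "distinct ?us" "distinct ?vs" "set ?us \<inter> set ?vs = {}" using dist vs fresh by auto
  have gid: "g v = v" if "v \<in> slot_sources (add_mset (Par A B, ?us) M) \<union> slot_targets (add_mset (Par A B, ?us) M)"
    "v \<notin> set ?us" for v using that(2) by (simp add: g_def)
  have hl: "hide (set ?us) (E \<union> link ?p ?us ?vs) = rename g E" "\<not> cyc (set ?us) (E \<union> link ?p ?us ?vs)"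
    using hide_link[OF lp du derivableD(2)[OF d] S, of g] g gid by blast+
  have "derivable (M + {#(A, vs1), (B, vs2)#}) (hide (set ?us) (E \<union> link ?p ?us ?vs))"
    by (rule derivable_cut[OF d d2 _ hl(2)]) (use fresh in auto)
  then have d3: "derivable (M + {#(A, vs1), (B, vs2)#}) (rename g E)" unfolding hl(1) .
  \<comment> \<open>The inverse of \<open>g\<close>: it returns the fresh names to the original
    ones.\<close>
  define r where "r v = (if v \<in> set ?vs then inv_into (set ?us) h v else v)" for v
  have rg: "r (g v) = v" if "v \<in> set ?us \<union> slot_vertices M" for v
  proof (cases "v \<in> set ?us")
    case True
    then have "g v \<in> set ?vs" using gh by (metis image_eqI list.set_map)
    then show ?thesis using True h(2) by (simp add: r_def g_def)
  next
    case False
    then have "v \<notin> set ?vs" using that fresh by auto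
    then show ?thesis using False by (simp add: r_def g_def)
  qed
  have inj: "inj_on r (slot_vertices (M + {#(A, vs1), (B, vs2)#}))"
  proof -
    have "slot_vertices (M + {#(A, vs1), (B, vs2)#}) = g ` (set ?us \<union> slot_vertices M)"
    proof -
      have "g ` set ?us = set ?vs" using gh by (metis list.set_map)
      moreover have "g ` slot_vertices M = slot_vertices M"
        using dM by (intro image_cong[where g = "\<lambda>v. v", simplified]) (auto simp: g_def)
      ultimately show ?thesis by (auto simp: image_Un)
    qed
    then show ?thesis using rg by (auto intro!: inj_onI)
  qed
  have us: "map r vs1 = us1" "map r vs2 = us2"
  proof -
    have "map r (map g ?us) = ?us" unfolding map_map using rg by (intro map_idI) auto
    then have "map r vs2 @ map r vs1 = us2 @ us1" unfolding gh by simp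
    then show "map r vs1 = us1" "map r vs2 = us2" using len2 vs by auto
  qed
  have "rename r (rename g E) = E"
    unfolding rename_comp using rg derivableD(3)[OF d] by (intro rename_ident) auto
  moreover have "rename_slots r M = M"
    using fresh by (intro rename_slots_ident) (auto simp: r_def)
  ultimately show ?thesis
    using derivable_rename[OF d3 inj] us by simp
qed

text \<open>Iterated Cut against multiwords over single formulas. Acyclicity is assumed for the
  plugging as a whole and passes to each single cut by \<open>plug_after_hide\<close>.\<close>

lemma derivable_plug:
  assumes "derivable (add_mset (X, us) (image_mset (\<lambda>(A, us, F). (A, us)) N)) E"
    and "\<And>A us F. (A, us, F) \<in># N \<Longrightarrow> derivable {#(neg A, rev us)#} F"
    and "\<not> cyc (slot_vertices (image_mset (\<lambda>(A, us, F). (A, us)) N)) (E \<union> (\<Union>(A, us, F) \<in> set_mset N. F))"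
  shows "derivable {#(X, us)#}
    (hide (slot_vertices (image_mset (\<lambda>(A, us, F). (A, us)) N)) (E \<union> (\<Union>(A, us, F) \<in> set_mset N. F)))"
  using assms
proof (induction N arbitrary: E)
  case (add x N)
  obtain A vs F where x: "x = (A, vs, F)" by (cases x) auto
  let ?M = "image_mset (\<lambda>(A, us, F). (A, us)) N" and ?F = "\<Union>(A, us, F) \<in> set_mset N. F"
  have w: "set vs \<inter> slot_vertices ?M = {}"
    using derivableD(1)[OF add.prems(1)] by (auto simp: x wf_slots_add)
  have vF: "vertices ?F \<subseteq> slot_vertices ?M"
  proof
    fix v assume "v \<in> vertices ?F"
    then obtain B ws F' where "(B, ws, F') \<in># N" "v \<in> vertices F'" by (force simp: vertices_def)
    then show "v \<in> slot_vertices ?M"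
      using derivableD(3)[OF add.prems(2)[of B ws F']] by (force simp: slot_vertices_def)
  qed
  then have "vertices ?F \<inter> set vs = {}" using w by blast
  note plug = plug_after_hide[OF this w, of "E \<union> F"]
  have V: "slot_vertices (image_mset (\<lambda>(A, us, F). (A, us)) (add_mset x N)) = set vs \<union> slot_vertices ?M"
    and F: "E \<union> (\<Union>(A, us, F) \<in> set_mset (add_mset x N). F) = E \<union> F \<union> ?F"
    by (auto simp: x)
  have nc: "\<not> cyc (set vs) (E \<union> F)" "\<not> cyc (slot_vertices ?M) (hide (set vs) (E \<union> F) \<union> ?F)"
    using add.prems(3) unfolding V F plug(2) by auto
  have "derivable (add_mset (A, vs) (add_mset (X, us) ?M)) E" "derivable (add_mset (neg A, rev vs) {#}) F"
    using add.prems(1,2) by (auto simp: x add_mset_commute)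
  then have "derivable (add_mset (X, us) ?M + {#}) (hide (set vs) (E \<union> F))"
    by (rule derivable_cut) (use nc in auto)
  then show ?case unfolding V F plug(1) using add.IH[of "hide (set vs) (E \<union> F)"] add.prems(2) nc by auto
qed simp

lemma derivable_single:
  assumes "derivable {#(A, us)#} E"
  obtains g where "llg_derivable G (Multiword (rename g E) {#}) [A]"
proof -
  obtain g \<Gamma> where g: "{#(A, map g us)#} = mset (standard_slots 0 \<Gamma>)"
    "llg_derivable G (Multiword (rename g E) {#}) \<Gamma>"
    using assms by (auto simp: derivable_def)
  have "standard_slots 0 \<Gamma> = [(A, map g us)]" using g(1) by (metis mset_single_iff_right)
  then have "\<Gamma> = [A]" using map_fst_standard_slots[of 0 \<Gamma>] by simp
  then show thesis using g(2) that by blast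
qed

end

section \<open>Shapes of matchings, separated from their labels\<close>

section \<open>Patterns\<close>

text \<open>The pairs of \<pi> are positions in \<open>us\<close>, counted from 0, so a shape is
  independent of vertex names; the words form a separate tuple in the same order. This is the form
  in which a labelled matching becomes a tuple of a nonterminal.\<close>

definition pattern_edges :: "(nat \<times> nat) list \<Rightarrow> 't list list \<Rightarrow> nat list \<Rightarrow> 't edge set" where
  "pattern_edges \<pi> ws us = (\<lambda>m. (us ! fst (\<pi> ! m), ws ! m, us ! snd (\<pi> ! m))) ` {..<length \<pi>}"

lemma mem_pattern_edges: "(i, w, j) \<in> pattern_edges \<pi> ws us \<longleftrightarrow>
    (\<exists>m < length \<pi>. i = us ! fst (\<pi> ! m) \<and> w = ws ! m \<and> j = us ! snd (\<pi> ! m))"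
  by (auto simp: pattern_edges_def)

text \<open>The first components enumerate the left positions and the second ones the right
  positions. The order of the pairs is free, so one matching has several patterns, each with its own
  order of the tuple.\<close>

definition is_pattern :: "bool list \<Rightarrow> (nat \<times> nat) list \<Rightarrow> bool" where
  "is_pattern p \<pi> \<longleftrightarrow> distinct (map fst \<pi>) \<and> distinct (map snd \<pi>) \<and>
     fst ` set \<pi> = {k. k < length p \<and> p ! k} \<and> snd ` set \<pi> = {k. k < length p \<and> \<not> p ! k}"

lemma is_pattern_less:
  assumes "is_pattern p \<pi>" "m < length \<pi>"
  shows "fst (\<pi> ! m) < length p" "snd (\<pi> ! m) < length p" "p ! fst (\<pi> ! m)" "\<not> p ! snd (\<pi> ! m)"
proof -
  have "fst (\<pi> ! m) \<in> fst ` set \<pi>" "snd (\<pi> ! m) \<in> snd ` set \<pi>" using assms(2) by auto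
  then show "fst (\<pi> ! m) < length p" "snd (\<pi> ! m) < length p" "p ! fst (\<pi> ! m)" "\<not> p ! snd (\<pi> ! m)"
    using assms(1) by (auto simp: is_pattern_def)
qed

lemma is_pattern_inj:
  assumes "is_pattern p \<pi>" "m < length \<pi>" "n < length \<pi>"
  shows "fst (\<pi> ! m) = fst (\<pi> ! n) \<longleftrightarrow> m = n" "snd (\<pi> ! m) = snd (\<pi> ! n) \<longleftrightarrow> m = n"
proof -
  have "distinct (map fst \<pi>)" "distinct (map snd \<pi>)" using assms(1) by (auto simp: is_pattern_def)
  then show "fst (\<pi> ! m) = fst (\<pi> ! n) \<longleftrightarrow> m = n" "snd (\<pi> ! m) = snd (\<pi> ! n) \<longleftrightarrow> m = n"
    using assms(2,3) nth_eq_iff_index_eq[of "map fst \<pi>" m n] nth_eq_iff_index_eq[of "map snd \<pi>" m n] by auto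
qed

lemma finite_patterns: "finite {\<pi>. is_pattern p \<pi>}"
proof (rule finite_subset)
  let ?A = "{..<length p} \<times> {..<length p}"
  have "a < length p \<and> c < length p" if "is_pattern p \<pi>" "(a, c) \<in> set \<pi>" for \<pi> a c
  proof -
    have "a \<in> fst ` set \<pi>" "c \<in> snd ` set \<pi>" using that(2) by force+
    then show ?thesis using that(1) by (auto simp: is_pattern_def)
  qed
  moreover have "distinct \<pi>" if "is_pattern p \<pi>" for \<pi>
    using that unfolding is_pattern_def distinct_map by blast
  ultimately show "{\<pi>. is_pattern p \<pi>} \<subseteq> {\<pi>. set \<pi> \<subseteq> ?A \<and> distinct \<pi>}" by fastforce
  show "finite {\<pi>. set \<pi> \<subseteq> ?A \<and> distinct \<pi>}" using finite_subset_distinct[of ?A] by simp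
qed

lemma pattern_edges_matching:
  assumes \<pi>: "is_pattern p \<pi>" and us: "length us = length p" "distinct us"
  shows "matching (sources p us) (targets p us) (pattern_edges \<pi> ws us)"
proof (rule matchingI)
  show "finite (sources p us)" "finite (targets p us)"
    using finite_subset[OF sources_subset] finite_subset[OF targets_subset] by auto
  show "i \<in> sources p us \<and> j \<in> targets p us" if "(i, w, j) \<in> pattern_edges \<pi> ws us" for i w j
    using that is_pattern_less[OF \<pi>] unfolding mem_pattern_edges mem_sources[OF us(1)] mem_targets[OF us(1)] by blast
  show "\<exists>w j. (i, w, j) \<in> pattern_edges \<pi> ws us" if i: "i \<in> sources p us" for i
  proof -
    obtain k where k: "k < length p" "i = us ! k" "p ! k" using i by (auto simp: mem_sources[OF us(1)])
    then have "k \<in> fst ` set \<pi>" using \<pi> by (auto simp: is_pattern_def)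
    then obtain m where "m < length \<pi>" "k = fst (\<pi> ! m)" by (auto simp: in_set_conv_nth)
    then show ?thesis using k by (auto simp: pattern_edges_def)
  qed
  show "\<exists>i w. (i, w, j) \<in> pattern_edges \<pi> ws us" if j: "j \<in> targets p us" for j
  proof -
    obtain k where k: "k < length p" "j = us ! k" "\<not> p ! k" using j by (auto simp: mem_targets[OF us(1)])
    then have "k \<in> snd ` set \<pi>" using \<pi> by (auto simp: is_pattern_def)
    then obtain m where "m < length \<pi>" "k = snd (\<pi> ! m)" by (auto simp: in_set_conv_nth)
    then show ?thesis using k by (auto simp: pattern_edges_def)
  qed
  have eq: "us ! k = us ! l \<longleftrightarrow> k = l" if "k < length p" "l < length p" for k l
    using that us by (simp add: nth_eq_iff_index_eq)
  show "w' = w \<and> j' = j" if "(i, w, j) \<in> pattern_edges \<pi> ws us" "(i, w', j') \<in> pattern_edges \<pi> ws us" for i w j w' j'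
    using that is_pattern_less[OF \<pi>] is_pattern_inj[OF \<pi>] eq unfolding mem_pattern_edges by metis
  show "w' = w \<and> i' = i" if "(i, w, j) \<in> pattern_edges \<pi> ws us" "(i', w', j) \<in> pattern_edges \<pi> ws us" for i w j w' i'
    using that is_pattern_less[OF \<pi>] is_pattern_inj[OF \<pi>] eq unfolding mem_pattern_edges by metis
qed

lemma rename_pattern_edges:
  assumes "is_pattern p \<pi>" "length us = length p"
  shows "rename g (pattern_edges \<pi> ws us) = pattern_edges \<pi> ws (map g us)"
  unfolding pattern_edges_def rename_def image_image
  using assms(2) is_pattern_less[OF assms(1)] by (intro image_cong) auto

lemma relabel_pattern_edges:
  "length ws = length \<pi> \<Longrightarrow> relabel f (pattern_edges \<pi> ws us) = pattern_edges \<pi> (map f ws) us"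
  unfolding pattern_edges_def relabel_def image_image by (intro image_cong) auto

text \<open>Any enumeration of the edges gives a pattern and the corresponding tuple of labels. It
  provides the shape of the result of a plugging, hence the head of a production.\<close>

lemma matching_pattern:
  assumes E: "matching (sources p us) (targets p us) E" and us: "length us = length p" "distinct us"
  shows "\<exists>\<pi> ws. is_pattern p \<pi> \<and> length ws = length \<pi> \<and> E = pattern_edges \<pi> ws us"
proof -
  obtain es where es: "set es = E" "distinct es" using finite_distinct_list[OF matching_finite[OF E]] by blast
  define ix where "ix v = (THE k. k < length us \<and> us ! k = v)" for v
  have ix: "ix (us ! k) = k" if "k < length us" for k
    unfolding ix_def using that us by (intro the_equality) (auto simp: nth_eq_iff_index_eq)
  define \<pi> where "\<pi> = map (\<lambda>e. (ix (edge_source e), ix (edge_target e))) es"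
  have src: "\<exists>k < length p. edge_source e = us ! k \<and> p ! k" and tgt: "\<exists>k < length p. edge_target e = us ! k \<and> \<not> p ! k"
    if "e \<in> E" for e
    using that matchingD[OF E, of "fst e" "fst (snd e)" "snd (snd e)"]
    by (auto simp: mem_sources[OF us(1)] mem_targets[OF us(1)])
  have uix: "us ! ix (edge_source e) = edge_source e" "us ! ix (edge_target e) = edge_target e"
    if "e \<in> E" for e using src[OF that] tgt[OF that] ix us(1) by auto
  have "E = pattern_edges \<pi> (map edge_label es) us"
  proof -
    have "pattern_edges \<pi> (map edge_label es) us = (\<lambda>m. es ! m) ` {..<length es}"
      unfolding pattern_edges_def
    proof (rule image_cong)
      fix m assume "m \<in> {..<length es}"
      then have m: "m < length es" "es ! m \<in> E" using es(1) by auto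
      then show "(us ! fst (\<pi> ! m), map edge_label es ! m, us ! snd (\<pi> ! m)) = es ! m"
        using uix[OF m(2)] by (simp add: \<pi>_def)
    qed (simp add: \<pi>_def)
    also have "\<dots> = E" using es(1) by (auto simp: set_conv_nth)
    finally show ?thesis ..
  qed
  moreover have "is_pattern p \<pi>" unfolding is_pattern_def
  proof (intro conjI)
    have "inj_on (\<lambda>e. ix (edge_source e)) E"
    proof (rule inj_onI)
      fix e e' assume ee: "e \<in> E" "e' \<in> E" "ix (edge_source e) = ix (edge_source e')"
      then have "edge_source e = edge_source e'" using uix(1) by metis
      then show "e = e'" using matching_source_unique[OF E, of "fst e" "fst (snd e)" "snd (snd e)"] ee(1,2)
        by (metis prod.collapse)
    qed
    then show "distinct (map fst \<pi>)" using es by (simp add: \<pi>_def distinct_map o_def)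
    have "inj_on (\<lambda>e. ix (edge_target e)) E"
    proof (rule inj_onI)
      fix e e' assume ee: "e \<in> E" "e' \<in> E" "ix (edge_target e) = ix (edge_target e')"
      then have "edge_target e = edge_target e'" using uix(2) by metis
      then show "e = e'" using matching_target_unique[OF E, of "fst e" "fst (snd e)" "snd (snd e)"] ee(1,2)
        by (metis prod.collapse)
    qed
    then show "distinct (map snd \<pi>)" using es by (simp add: \<pi>_def distinct_map o_def)
    have "fst ` set \<pi> = (\<lambda>e. ix (edge_source e)) ` E" using es by (auto simp: \<pi>_def image_image)
    also have "\<dots> = {k. k < length p \<and> p ! k}"
    proof
      show "(\<lambda>e. ix (edge_source e)) ` E \<subseteq> {k. k < length p \<and> p ! k}" using src ix us(1) by fastforce
      show "{k. k < length p \<and> p ! k} \<subseteq> (\<lambda>e. ix (edge_source e)) ` E"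
      proof
        fix k assume k: "k \<in> {k. k < length p \<and> p ! k}"
        then have "us ! k \<in> sources p us" by (auto simp: mem_sources[OF us(1)])
        then obtain w j where "(us ! k, w, j) \<in> E" using matching_source_exists[OF E] by blast
        then show "k \<in> (\<lambda>e. ix (edge_source e)) ` E" using k ix us(1) by (force intro: image_eqI[rotated])
      qed
    qed
    finally show "fst ` set \<pi> = {k. k < length p \<and> p ! k}" .
    have "snd ` set \<pi> = (\<lambda>e. ix (edge_target e)) ` E" using es by (auto simp: \<pi>_def image_image)
    also have "\<dots> = {k. k < length p \<and> \<not> p ! k}"
    proof
      show "(\<lambda>e. ix (edge_target e)) ` E \<subseteq> {k. k < length p \<and> \<not> p ! k}" using tgt ix us(1) by fastforce
      show "{k. k < length p \<and> \<not> p ! k} \<subseteq> (\<lambda>e. ix (edge_target e)) ` E"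
      proof
        fix k assume k: "k \<in> {k. k < length p \<and> \<not> p ! k}"
        then have "us ! k \<in> targets p us" by (auto simp: mem_targets[OF us(1)])
        then obtain i w where "(i, w, us ! k) \<in> E" using matching_target_exists[OF E] by blast
        then show "k \<in> (\<lambda>e. ix (edge_target e)) ` E" using k ix us(1) by (force intro: image_eqI[rotated])
      qed
    qed
    finally show "snd ` set \<pi> = {k. k < length p \<and> \<not> p ! k}" .
  qed
  moreover have "length (map edge_label es) = length \<pi>" by (simp add: \<pi>_def)
  ultimately show ?thesis by blast
qed

lemma pattern_edges_eq_iff:
  assumes \<pi>: "is_pattern p \<pi>" and us: "length us = length p" "distinct us"
    and ws: "length ws = length \<pi>" "length ws' = length \<pi>"
    and eq: "pattern_edges \<pi> ws us = pattern_edges \<pi> ws' us"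
  shows "ws = ws'"
proof (rule nth_equalityI)
  fix m assume m: "m < length ws"
  have "(us ! fst (\<pi> ! m), ws ! m, us ! snd (\<pi> ! m)) \<in> pattern_edges \<pi> ws us"
    "(us ! fst (\<pi> ! m), ws' ! m, us ! snd (\<pi> ! m)) \<in> pattern_edges \<pi> ws' us"
    using m ws unfolding mem_pattern_edges by (auto simp: eq mem_pattern_edges)
  then show "ws ! m = ws' ! m"
    using matching_source_unique[OF pattern_edges_matching[OF \<pi> us]] unfolding eq by metis
qed (use ws in simp)

lemma matching_is_regular_multiword:
  assumes E: "matching (lefts X) (rights X) E" and T: "\<And>i w j. (i, w, j) \<in> E \<Longrightarrow> w \<in> lists T"
  shows "is_regular_multiword T X E"
  unfolding is_regular_multiword_def
proof (intro conjI ballI)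
  show "case e of (i, w, j) \<Rightarrow> i \<in> lefts X \<and> w \<in> lists T \<and> j \<in> rights X" if "e \<in> E" for e
    using that matchingD[OF E, of "fst e" "fst (snd e)" "snd (snd e)"] T by (cases e) auto
  fix v assume v: "v \<in> {1..bsize X}"
  have disj: "lefts X \<inter> rights X = {}" by (auto simp: rights_def)
  show "\<exists>!e. e \<in> E \<and> (edge_source e = v \<or> edge_target e = v)"
  proof (cases "v \<in> lefts X")
    case True
    then obtain w j where e: "(v, w, j) \<in> E" using matching_source_exists[OF E] by blast
    show ?thesis
    proof (rule ex1I[of _ "(v, w, j)"])
      fix e' assume e': "e' \<in> E \<and> (edge_source e' = v \<or> edge_target e' = v)"
      then have "edge_target e' \<in> rights X" using matchingD(2)[OF E, of "fst e'" "fst (snd e')" "snd (snd e')"] by simp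
      then have "edge_source e' = v" using e' True disj by blast
      then show "e' = (v, w, j)" using matching_source_unique[OF E e, of "fst (snd e')" "snd (snd e')"] e' by (cases e') auto
    qed (use e in simp)
  next
    case False
    then have "v \<in> rights X" using v by (auto simp: rights_def)
    then obtain i w where e: "(i, w, v) \<in> E" using matching_target_exists[OF E] by blast
    show ?thesis
    proof (rule ex1I[of _ "(i, w, v)"])
      fix e' assume e': "e' \<in> E \<and> (edge_source e' = v \<or> edge_target e' = v)"
      then have "edge_source e' \<in> lefts X" using matchingD(1)[OF E, of "fst e'" "fst (snd e')" "snd (snd e')"] by simp
      then have "edge_target e' = v" using e' False by blast
      then show "e' = (i, w, v)" using matching_target_unique[OF E e, of "fst e'" "fst (snd e')"] e' by (cases e') auto
    qed (use e in simp)
  qed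
qed

lemma matching_UN:
  assumes "finite I" "\<And>i. i \<in> I \<Longrightarrow> matching (S i) (T i) (E i)"
    "\<And>i j. \<lbrakk>i \<in> I; j \<in> I; i \<noteq> j\<rbrakk> \<Longrightarrow> S i \<inter> S j = {} \<and> T i \<inter> T j = {}"
  shows "matching (\<Union>i\<in>I. S i) (\<Union>i\<in>I. T i) (\<Union>i\<in>I. E i)"
  using assms
proof (induction I)
  case (insert i I)
  have "matching (S i \<union> (\<Union>i\<in>I. S i)) (T i \<union> (\<Union>i\<in>I. T i)) (E i \<union> (\<Union>i\<in>I. E i))"
  proof (rule matching_Un)
    show "matching (S i) (T i) (E i)" "matching (\<Union>i\<in>I. S i) (\<Union>i\<in>I. T i) (\<Union>i\<in>I. E i)"
      using insert by auto
    show "S i \<inter> (\<Union>i\<in>I. S i) = {}" "T i \<inter> (\<Union>i\<in>I. T i) = {}"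
      using insert.hyps(2) insert.prems(2)[of i] by auto
  qed
  then show ?case by simp
qed simp

text \<open>Each part has a territory \<open>W i\<close> of its own, which contains its vertices and
  its hidden ones. No path leaves a territory, so the parts are eliminated independently.\<close>

lemma hide_UN:
  assumes "finite I" "\<And>i. i \<in> I \<Longrightarrow> \<not> cyc (V i) (E i)"
    "\<And>i. i \<in> I \<Longrightarrow> V i \<subseteq> W i \<and> vertices (E i) \<subseteq> W i"
    "\<And>i j. \<lbrakk>i \<in> I; j \<in> I; i \<noteq> j\<rbrakk> \<Longrightarrow> W i \<inter> W j = {}"
  shows "hide (\<Union>i\<in>I. V i) (\<Union>i\<in>I. E i) = (\<Union>i\<in>I. hide (V i) (E i)) \<and> \<not> cyc (\<Union>i\<in>I. V i) (\<Union>i\<in>I. E i)"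
  using assms
proof (induction I)
  case (insert i I)
  let ?V = "\<Union>i\<in>I. V i" and ?E = "\<Union>i\<in>I. E i"
  have W: "W i \<inter> W j = {}" if "j \<in> I" for j using insert.hyps(2) insert.prems(3)[of i j] that by auto
  have VW: "?V \<subseteq> (\<Union>j\<in>I. W j)" using insert.prems(2) by blast
  have EW: "vertices ?E \<subseteq> (\<Union>j\<in>I. W j)"
  proof
    fix v assume "v \<in> vertices ?E"
    then obtain j where "j \<in> I" "v \<in> vertices (E j)" by (auto simp: vertices_def)
    then show "v \<in> (\<Union>j\<in>I. W j)" using insert.prems(2)[of j] by blast
  qed
  have i: "V i \<subseteq> W i" "vertices (E i) \<subseteq> W i" using insert.prems(2)[of i] by auto
  have d: "vertices ?E \<inter> V i = {}" "V i \<inter> ?V = {}" using W i VW EW by blast+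
  have d': "vertices (hide (V i) (E i)) \<inter> ?V = {}" using vertices_hide[of "V i" "E i"] W i VW by blast
  have IH: "hide ?V ?E = (\<Union>i\<in>I. hide (V i) (E i))" "\<not> cyc ?V ?E" using insert by auto
  have un: "(\<Union>j\<in>insert i I. V j) = V i \<union> ?V" "(\<Union>j\<in>insert i I. E j) = E i \<union> ?E" by auto
  show ?case
    unfolding un plug_after_hide[OF d] Un_commute[of "hide (V i) (E i)"] hide_Un_disjoint[OF d'] cyc_Un_disjoint[OF d'] IH(1)
    using IH(2) insert.prems(1)[of i] by auto
qed simp

section \<open>Productions as lexical entries\<close>

section \<open>From multiple context-free grammars to linear logic grammars\<close>

definition pairs :: "('a \<Rightarrow> 'b) \<Rightarrow> ('a \<Rightarrow> 'b) \<Rightarrow> 'a list \<Rightarrow> 'b list" where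
  "pairs f g xs = concat (map (\<lambda>x. [f x, g x]) xs)"

lemma pairs_simps [simp]: "pairs f g [] = []" "pairs f g (x # xs) = f x # g x # pairs f g xs"
  by (simp_all add: pairs_def)

lemma length_pairs [simp]: "length (pairs f g xs) = 2 * length xs"
  by (induction xs) auto

lemma set_pairs: "set (pairs f g xs) = f ` set xs \<union> g ` set xs"
  by (induction xs) auto

lemma nth_pairs: "m < length xs \<Longrightarrow> pairs f g xs ! (2 * m) = f (xs ! m) \<and> pairs f g xs ! Suc (2 * m) = g (xs ! m)"
proof (induction xs arbitrary: m)
  case (Cons x xs)
  then show ?case by (cases m) auto
qed simp

lemma sources_pairs: "sources (pairs (\<lambda>_. True) (\<lambda>_. False) ys) (pairs f g xs) = f ` set (take (length ys) xs)"
proof (induction ys arbitrary: xs)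
  case (Cons y ys)
  then show ?case by (cases xs) (auto simp: sources_def)
qed (simp add: sources_def)

lemma targets_pairs: "targets (pairs (\<lambda>_. True) (\<lambda>_. False) ys) (pairs f g xs) = g ` set (take (length ys) xs)"
proof (induction ys arbitrary: xs)
  case (Cons y ys)
  then show ?case by (cases xs) (auto simp: targets_def)
qed (simp add: targets_def)

text \<open>The boundary of a predicate symbol of arity \<open>k\<close>: left and right end points
  alternate, and component \<open>m\<close>, counted from 0, runs from vertex
  \<open>2 * m + 1\<close> to vertex \<open>2 * m + 2\<close>.\<close>

lift_definition word_boundary :: "nat \<Rightarrow> boundary" is "\<lambda>k. (2 * k, {2 * m + 1 | m. m < k})"
  by auto

lemma bsize_word_boundary [simp]: "bsize (word_boundary k) = 2 * k"
  by transfer simp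

lemma lefts_word_boundary: "lefts (word_boundary k) = {2 * m + 1 | m. m < k}"
  by transfer simp

definition word_signs :: "nat \<Rightarrow> bool list" where
  "word_signs k = pairs (\<lambda>_. True) (\<lambda>_. False) [0..<k]"

lemma nth_word_signs: "i < 2 * k \<Longrightarrow> word_signs k ! i \<longleftrightarrow> even i"
  using nth_pairs[of "i div 2" "[0..<k]" "\<lambda>_. True" "\<lambda>_. False"]
  by (cases "even i") (auto elim!: evenE oddE simp: word_signs_def)

lemma signs_word_boundary: "signs (word_boundary k) = word_signs k"
proof (rule nth_equalityI)
  fix i assume i: "i < length (signs (word_boundary k))"
  then have "signs (word_boundary k) ! i \<longleftrightarrow> (\<exists>m < k. i = 2 * m)"
    by (auto simp: nth_signs lefts_word_boundary)
  also have "\<dots> \<longleftrightarrow> even i" using i by (auto elim!: evenE)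
  finally show "signs (word_boundary k) ! i = word_signs k ! i" using i by (simp add: nth_word_signs)
qed (simp add: word_signs_def)

definition word_pattern :: "nat \<Rightarrow> (nat \<times> nat) list" where
  "word_pattern k = map (\<lambda>m. (2 * m, Suc (2 * m))) [0..<k]"

lemma is_pattern_word_pattern: "is_pattern (word_signs k) (word_pattern k)"
proof -
  have "fst ` set (word_pattern k) = {i. i < 2 * k \<and> even i}"
    by (auto simp: word_pattern_def image_image elim!: evenE)
  moreover have "snd ` set (word_pattern k) = {i. i < 2 * k \<and> odd i}"
    by (auto simp: word_pattern_def image_image elim!: oddE)
  moreover have "length (word_signs k) = 2 * k" by (simp add: word_signs_def)
  ultimately show ?thesis
    unfolding is_pattern_def
    by (auto simp: nth_word_signs word_pattern_def distinct_map inj_on_def)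
qed

lemma pattern_edges_word_pattern:
  "length xs = k \<Longrightarrow> pattern_edges (word_pattern k) ws (pairs f g xs) = (\<lambda>m. (f (xs ! m), ws ! m, g (xs ! m))) ` {..<k}"
  unfolding pattern_edges_def by (intro image_cong) (auto simp: word_pattern_def nth_pairs)

lemma (in boundaries) wf_slots_distinct: "wf_slots (mset c) \<Longrightarrow> distinct (concat (map snd c))"
proof (induction c)
  case (Cons x c)
  then show ?case by (cases x) (auto simp: wf_slots_add slot_vertices_def disjoint_iff)
qed simp

text \<open>Boundaries fix the length of each block, so a list of slots and its standard numbering
  have the same layout and their names correspond one by one.\<close>

lemma standard_renaming_exists:
  assumes "boundaries.wf_slots b (mset c)"
  shows "\<exists>g. inj_on g (slot_vertices (mset c)) \<and>
    map (\<lambda>(A, us). (A, map g us)) c = boundaries.standard_slots b 0 (map fst c)"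
proof -
  interpret boundaries b .
  let ?s = "standard_slots 0 (map fst c)"
  have len: "length ?s = length c" by (metis length_map map_fst_standard_slots)
  have lens: "length (snd (?s ! i)) = length (snd (c ! i))" if "i < length c" for i
  proof -
    have "fst (?s ! i) = fst (c ! i)" using that len by (metis map_fst_standard_slots nth_map)
    moreover have "?s ! i \<in># mset ?s" "c ! i \<in># mset c" using that len by auto
    ultimately show ?thesis
      using assms wf_standard_slots[of 0 "map fst c"] unfolding wf_slots_def by metis
  qed
  obtain g where g: "map g (concat (map snd c)) = concat (map snd ?s)" "inj_on g (set (concat (map snd c)))"
  proof (rule distinct_map_exists)
    show "length (concat (map snd c)) = length (concat (map snd ?s))"
      unfolding length_concat map_map using len lens by (intro arg_cong[where f = sum_list] nth_equalityI) auto
    show "distinct (concat (map snd c))" "distinct (concat (map snd ?s))"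
      using wf_slots_distinct assms wf_standard_slots by auto
  qed
  have "map (map g) (map snd c) = map snd ?s"
    using g(1) len lens by (subst (asm) map_concat, subst (asm) concat_eq_concat_iff)
      (auto simp: in_set_zip)
  then have snds: "map g (snd (c ! i)) = snd (?s ! i)" if "i < length c" for i
    using that len by (metis (no_types, lifting) length_map nth_map)
  have "map (\<lambda>(A, us). (A, map g us)) c = ?s"
  proof (rule nth_equalityI)
    fix i assume "i < length (map (\<lambda>(A, us). (A, map g us)) c)"
    then have i: "i < length c" by simp
    have "fst (?s ! i) = map fst ?s ! i" using i len by (simp del: map_fst_standard_slots)
    also have "\<dots> = fst (c ! i)" using i by simp
    finally have "fst (?s ! i) = fst (c ! i)" .
    then show "map (\<lambda>(A, us). (A, map g us)) c ! i = ?s ! i"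
      using i snds[OF i] by (simp add: case_prod_beta prod_eq_iff)
  qed (simp add: len)
  moreover have "slot_vertices (mset c) = set (concat (map snd c))" by (auto simp: slot_vertices_def)
  ultimately show ?thesis using g(2) by auto
qed

text \<open>
  The variable \<open>x\<close> of a production owns the vertices \<open>4 * x\<close> and \<open>4 * x + 1\<close>, the argument number \<open>m\<close>
  of its head owns \<open>4 * m + 2\<close> and \<open>4 * m + 3\<close>.
\<close>

fun word_edges :: "nat \<Rightarrow> 't list \<Rightarrow> 't symbol list \<Rightarrow> nat \<Rightarrow> 't edge set" where
  "word_edges a w [] c = {(a, w, c)}"
| "word_edges a w (Term t # s) c = word_edges a (w @ [t]) s c"
| "word_edges a w (Var x # s) c = insert (a, w, 4 * x) (word_edges (4 * x + 1) [] s c)"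

definition word_vars :: "'t symbol list \<Rightarrow> nat set" where
  "word_vars s = {x. Var x \<in> set s}"

lemma word_vars_simps [simp]:
  "word_vars [] = {}" "word_vars (Term t # s) = word_vars s" "word_vars (Var x # s) = insert x (word_vars s)"
  by (auto simp: word_vars_def)

definition var_vertices :: "nat set \<Rightarrow> nat set" where
  "var_vertices X = (\<lambda>x. 4 * x) ` X \<union> (\<lambda>x. 4 * x + 1) ` X"

lemma mem_var_vertices [simp]: "4 * x \<in> var_vertices X \<longleftrightarrow> x \<in> X" "Suc (4 * x) \<in> var_vertices X \<longleftrightarrow> x \<in> X"
  by (auto simp: var_vertices_def) presburger+

lemma var_vertices_insert: "var_vertices (insert x X) = {4 * x, 4 * x + 1} \<union> var_vertices X"
  by (auto simp: var_vertices_def)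

definition var_edges :: "(nat \<Rightarrow> 't list) \<Rightarrow> nat set \<Rightarrow> 't edge set" where
  "var_edges \<theta> X = (\<lambda>x. (4 * x, \<theta> x, 4 * x + 1)) ` X"

lemma vertices_var_edges: "vertices (var_edges \<theta> X) = var_vertices X"
  by (auto simp: var_edges_def var_vertices_def vertices_def image_image)

text \<open>A variable \<open>x\<close> interrupts the word: one edge ends at \<open>4 * x\<close>
  and the next one starts at \<open>4 * x + 1\<close>. Since \<open>x\<close> occurs at most once,
  neither vertex is used a second time.\<close>

lemma word_edges_matching:
  assumes "\<And>x. count_list s (Var x) \<le> 1" "a \<notin> (\<lambda>x. 4 * x + 1) ` word_vars s" "c \<notin> (\<lambda>x. 4 * x) ` word_vars s"
  shows "matching (insert a ((\<lambda>x. 4 * x + 1) ` word_vars s)) (insert c ((\<lambda>x. 4 * x) ` word_vars s)) (word_edges a w s c)"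
  using assms
proof (induction a w s c rule: word_edges.induct)
  case (1 a w c)
  then show ?case by (simp add: matching_single)
next
  case (2 a w t s c)
  then show ?case by (simp add: count_list.simps)
next
  case (3 a w x s c)
  have x: "x \<notin> word_vars s" using 3(2)[of x] by (auto simp: word_vars_def count_list_0_iff)
  have c: "count_list s (Var y) \<le> 1" for y using 3(2)[of y] by (auto split: if_splits)
  have "matching ({a} \<union> insert (4 * x + 1) ((\<lambda>x. 4 * x + 1) ` word_vars s))
      ({4 * x} \<union> insert c ((\<lambda>x. 4 * x) ` word_vars s)) ({(a, w, 4 * x)} \<union> word_edges (4 * x + 1) [] s c)"
  proof (rule matching_Un[OF matching_single 3(1)[OF c]])
    show "4 * x + 1 \<notin> (\<lambda>x. 4 * x + 1) ` word_vars s" using x by auto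
    show "c \<notin> (\<lambda>x. 4 * x) ` word_vars s" using 3(4) by simp
    show "{a} \<inter> insert (4 * x + 1) ((\<lambda>x. 4 * x + 1) ` word_vars s) = {}" using 3(3) by auto
    show "{4 * x} \<inter> insert c ((\<lambda>x. 4 * x) ` word_vars s) = {}" using 3(4) x by auto
  qed
  then show ?case by (simp add: insert_commute)
qed

lemma hide_three_edges:
  assumes "a \<noteq> p" "a \<noteq> q" "p \<noteq> q" "c \<noteq> p" "c \<noteq> q"
  shows "hide {p, q} {(a, w, p), (p, u, q), (q, v, c)} = {(a, w @ u @ v, c)}"
    and "\<not> cyc {p, q} {(a, w, p), (p, u, q), (q, v, c)}"
proof -
  let ?E = "{(a, w, p), (p, u, q), (q, v, c)}"
  have paths: "internal_path {p, q} ?E i x j \<Longrightarrow> (i, x, j) \<in>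
      {(a, w, p), (p, u, q), (q, v, c), (a, w @ u, q), (p, u @ v, c), (a, w @ u @ v, c)}" for i x j
    by (induction rule: internal_path.induct) (use assms in auto)
  have "internal_path {p, q} ?E a w p" by (rule internal_path.single) simp
  then have "internal_path {p, q} ?E a (w @ u) q" by (rule internal_path.extend) auto
  then have "internal_path {p, q} ?E a ((w @ u) @ v) c" by (rule internal_path.extend) auto
  then show "hide {p, q} ?E = {(a, w @ u @ v, c)}"
    using paths assms by (intro edge_set_eqI) (auto simp: mem_hide)
  show "\<not> cyc {p, q} ?E" using paths assms unfolding cyc_def by blast
qed

text \<open>The edges of an argument are its constant stretches; the edge labelled
  \<open>\<theta> x\<close> bridges the gap left by \<open>x\<close>, and contraction concatenates
  everything to the substituted word. The variables of the tail are hidden first, after which a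
  chain of three edges remains. The prefix \<open>w\<close> is the accumulator of the
  recursion.\<close>

lemma hide_word_edges:
  assumes "\<And>x. count_list s (Var x) \<le> 1" "a \<notin> var_vertices (word_vars s)" "c \<notin> var_vertices (word_vars s)" "a \<noteq> c"
  shows "hide (var_vertices (word_vars s)) (word_edges a w s c \<union> var_edges \<theta> (word_vars s)) = {(a, w @ subst_word \<theta> s, c)} \<and>
    \<not> cyc (var_vertices (word_vars s)) (word_edges a w s c \<union> var_edges \<theta> (word_vars s))"
  using assms
proof (induction a w s c rule: word_edges.induct)
  case (1 a w c)
  then show ?case by (simp add: var_vertices_def var_edges_def subst_word_def)
next
  case (2 a w t s c)
  then show ?case by (simp add: subst_word_def)
next
  case (3 a w x s c)
  have x: "x \<notin> word_vars s" using 3(2)[of x] by (auto simp: word_vars_def count_list_0_iff)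
  have cnt: "count_list s (Var y) \<le> 1" for y using 3(2)[of y] by (auto split: if_splits)
  let ?V = "var_vertices (word_vars s)" and ?D = "word_edges (4 * x + 1) [] s c \<union> var_edges \<theta> (word_vars s)"
  let ?E = "{(a, w, 4 * x), (4 * x, \<theta> x, 4 * x + 1)}"
  have ac: "a \<notin> ?V" "c \<notin> ?V" "a \<noteq> 4 * x" "a \<noteq> 4 * x + 1" "c \<noteq> 4 * x" "c \<noteq> 4 * x + 1"
    using 3(3,4) by (auto simp: var_vertices_insert)
  have IH: "hide ?V ?D = {(4 * x + 1, subst_word \<theta> s, c)}" "\<not> cyc ?V ?D"
    using 3(1)[OF cnt] x ac by auto
  have d: "vertices ?E \<inter> ?V = {}" "?V \<inter> {4 * x, 4 * x + 1} = {}"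
    using x ac by (auto simp: vertices_def)
  have V: "var_vertices (word_vars (Var x # s)) = ?V \<union> {4 * x, 4 * x + 1}"
    by (auto simp: var_vertices_insert)
  have E: "word_edges a w (Var x # s) c \<union> var_edges \<theta> (word_vars (Var x # s)) = ?D \<union> ?E"
    by (auto simp: var_edges_def)
  have E': "{(4 * x + 1, subst_word \<theta> s, c)} \<union> ?E = {(a, w, 4 * x), (4 * x, \<theta> x, 4 * x + 1), (4 * x + 1, subst_word \<theta> s, c)}"
    by auto
  show ?case
    unfolding V E plug_after_hide[OF d] IH(1) E'
    using hide_three_edges[of a "4 * x" "4 * x + 1" c w "\<theta> x" "subst_word \<theta> s"] ac IH(2)
    by (simp add: subst_word_def)
qed

lemma count_list_concat: "count_list (concat ss) x = (\<Sum>m<length ss. count_list (ss ! m) x)"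
proof (induction ss rule: rev_induct)
  case (snoc s ss)
  have "(\<Sum>m<length ss. count_list ((ss @ [s]) ! m) x) = (\<Sum>m<length ss. count_list (ss ! m) x)"
    by (intro sum.cong) (auto simp: nth_append)
  then show ?case using snoc by simp
qed simp

lemma distinct_pairs:
  assumes "distinct xs" "inj f" "inj g" "\<And>x y. f x \<noteq> g y"
  shows "distinct (pairs f g xs)"
  using assms(1) by (induction xs) (auto simp: set_pairs assms(4) assms(4)[symmetric] dest: injD[OF assms(2)] injD[OF assms(3)])

locale mcfg_encoding =
  fixes G :: "('n, 't) mcfg"
  assumes wf: "wf_mcfg G"
begin

definition arity_boundary :: "'n \<Rightarrow> boundary" where
  "arity_boundary A = word_boundary (mcfg_arity G A)"

sublocale boundaries arity_boundary .

lemma pol_Pos: "pol (Pos A) = word_signs (mcfg_arity G A)"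
  by (simp add: pol_def arity_boundary_def signs_word_boundary)

definition var_list :: "nat list \<Rightarrow> nat list" where
  "var_list xs = pairs (\<lambda>x. 4 * x) (\<lambda>x. 4 * x + 1) xs"

definition arg_list :: "nat \<Rightarrow> nat list" where
  "arg_list k = pairs (\<lambda>m. 4 * m + 2) (\<lambda>m. 4 * m + 3) [0..<k]"

definition body_slots :: "('n \<times> nat list) list \<Rightarrow> 'n slot list" where
  "body_slots bs = map (\<lambda>(B, xs). (Neg B, rev (var_list xs))) bs"

definition production_slots :: "('n, 't) production \<Rightarrow> 'n slot list" where
  "production_slots p = body_slots (body p) @ [(Pos (head p), arg_list (length (args p)))]"

definition production_edges :: "('n, 't) production \<Rightarrow> 't edge set" where
  "production_edges p = (\<Union>m<length (args p). word_edges (4 * m + 2) [] (args p ! m) (4 * m + 3))"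

lemma set_var_list: "set (var_list xs) = var_vertices (set xs)"
  by (auto simp: var_list_def set_pairs var_vertices_def)

lemma distinct_var_list: "distinct xs \<Longrightarrow> distinct (var_list xs)"
  unfolding var_list_def by (rule distinct_pairs) (simp_all add: inj_def, presburger)

lemma distinct_arg_list: "distinct (arg_list k)"
  unfolding arg_list_def by (rule distinct_pairs) (simp_all add: inj_def, presburger)

lemma sources_arg_list: "sources (word_signs k) (arg_list k) = (\<lambda>m. 4 * m + 2) ` {..<k}"
  and targets_arg_list: "targets (word_signs k) (arg_list k) = (\<lambda>m. 4 * m + 3) ` {..<k}"
  by (simp_all add: word_signs_def arg_list_def sources_pairs targets_pairs atLeast0LessThan)

text \<open>A premise enters the sequent through its negative literal, which exchanges the roles of
  the vertices: the beginning \<open>4 * x\<close> of a component is a target of the entry, and its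
  end \<open>4 * x + 1\<close> a source.\<close>

lemma var_list_boundary:
  assumes "length xs = mcfg_arity G B"
  shows "sources (pol (Neg B)) (rev (var_list xs)) = (\<lambda>x. 4 * x + 1) ` set xs"
    "targets (pol (Neg B)) (rev (var_list xs)) = (\<lambda>x. 4 * x) ` set xs"
    "length (var_list xs) = length (pol (Neg B))"
proof -
  have l: "length (var_list xs) = length (pol (Pos B))"
    using assms by (simp add: var_list_def pol_Pos word_signs_def del: length_pol)
  have n: "pol (Neg B) = rev (map Not (pol (Pos B)))" using pol_neg[of "Pos B"] by simp
  show "sources (pol (Neg B)) (rev (var_list xs)) = (\<lambda>x. 4 * x + 1) ` set xs"
    "targets (pol (Neg B)) (rev (var_list xs)) = (\<lambda>x. 4 * x) ` set xs"
    unfolding n sources_dual[OF l] targets_dual[OF l] using assms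
    by (simp_all add: pol_Pos word_signs_def var_list_def sources_pairs targets_pairs)
  show "length (var_list xs) = length (pol (Neg B))" using l by (simp add: n del: length_pol)
qed

lemma body_slots_wf:
  assumes "distinct (concat (map snd bs))" "\<And>B xs. (B, xs) \<in> set bs \<Longrightarrow> length xs = mcfg_arity G B"
  shows "wf_slots (mset (body_slots bs)) \<and>
    slot_vertices (mset (body_slots bs)) = var_vertices (set (concat (map snd bs))) \<and>
    slot_sources (mset (body_slots bs)) = (\<lambda>x. 4 * x + 1) ` set (concat (map snd bs)) \<and>
    slot_targets (mset (body_slots bs)) = (\<lambda>x. 4 * x) ` set (concat (map snd bs))"
  using assms
proof (induction bs)
  case Nil
  then show ?case by (simp add: body_slots_def var_vertices_def)
next
  case (Cons x bs)
  obtain B xs where x: "x = (B, xs)" by fastforce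
  have IH: "wf_slots (mset (body_slots bs))"
    "slot_vertices (mset (body_slots bs)) = var_vertices (set (concat (map snd bs)))"
    "slot_sources (mset (body_slots bs)) = (\<lambda>x. 4 * x + 1) ` set (concat (map snd bs))"
    "slot_targets (mset (body_slots bs)) = (\<lambda>x. 4 * x) ` set (concat (map snd bs))"
    using Cons by auto
  have len: "length xs = mcfg_arity G B" using Cons.prems(2) x by simp
  have d: "distinct xs" "set xs \<inter> set (concat (map snd bs)) = {}" using Cons.prems(1) x by auto
  have "var_vertices (set xs) \<inter> var_vertices (set (concat (map snd bs))) = {}"
    using d(2) by (auto simp: var_vertices_def) presburger+
  then have w: "wf_slots (add_mset (Neg B, rev (var_list xs)) (mset (body_slots bs)))"
    using IH(1,2) var_list_boundary(3)[OF len] distinct_var_list[OF d(1)]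
    by (simp add: wf_slots_add set_var_list del: length_pol)
  have b: "body_slots (x # bs) = (Neg B, rev (var_list xs)) # body_slots bs" by (simp add: body_slots_def x)
  show ?case unfolding b using w IH var_list_boundary[OF len]
    by (simp add: x set_var_list image_Un var_vertices_def Un_ac)
qed

text \<open>Negative literals get the empty set, encoded by the conjunct \<open>s\<close>. The entry
  of a production has one positive formula, its head. With any other slot as output the head would
  need a test from an empty set, so validity has content only with the head as output.\<close>

definition lit :: "bool \<Rightarrow> 'n \<Rightarrow> nat list \<Rightarrow> 't edge set \<Rightarrow> bool" where
  "lit s B us E \<longleftrightarrow> s \<and> length us = 2 * mcfg_arity G B \<and> distinct us \<and>
     (\<exists>ws. length ws = mcfg_arity G B \<and> E = pattern_edges (word_pattern (mcfg_arity G B)) ws us \<and>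
        mcfg_derivable G B ws)"

lemma length_word_signs [simp]: "length (word_signs k) = 2 * k"
  by (simp add: word_signs_def)

sublocale semantics arity_boundary lit
proof
  fix s P us and E :: "'t edge set" assume "lit s P us E"
  then have *: "s" "length us = 2 * mcfg_arity G P" "distinct us"
    "\<exists>ws. E = pattern_edges (word_pattern (mcfg_arity G P)) ws us" by (auto simp: lit_def)
  then show "wf_slots {#(if s then Pos P else Neg P, us)#} \<and>
      matching (sources (pol (if s then Pos P else Neg P)) us) (targets (pol (if s then Pos P else Neg P)) us) E"
    using pattern_edges_matching[OF is_pattern_word_pattern[of "mcfg_arity G P"], of us]
    by (auto simp: wf_slots_single pol_Pos simp del: length_pol)
next
  fix s P us and E :: "'t edge set" and g :: "nat \<Rightarrow> nat" assume "lit s P us E" "inj_on g (set us)"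
  then show "lit s P (map g us) (rename g E)"
    unfolding lit_def using rename_pattern_edges[OF is_pattern_word_pattern[of "mcfg_arity G P"], of us g]
    by (auto simp: distinct_map)
qed

context
  fixes p assumes p: "p \<in> mcfg_productions G"
begin

lemma wf_p: "wf_production G p"
  using wf p by (auto simp: wf_mcfg_def)

lemma body_length: "(B, xs) \<in> set (body p) \<Longrightarrow> length xs = mcfg_arity G B"
  using wf_p by (auto simp: wf_production_def)

lemma args_length: "length (args p) = mcfg_arity G (head p)"
  using wf_p by (simp add: wf_production_def)

lemma distinct_production_vars: "distinct (production_vars p)"
  using wf_p by (simp add: wf_production_def)

lemma args_symbols: "s \<in> set (args p) \<Longrightarrow> set s \<subseteq> Term ` mcfg_terminals G \<union> Var ` set (production_vars p)"
  using wf_p by (simp add: wf_production_def)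

lemma count_args: "count_list (concat (args p)) (Var x) \<le> 1"
proof (cases "x \<in> set (production_vars p)")
  case False
  then have "Var x \<notin> set (concat (args p))" using args_symbols by fastforce
  then show ?thesis by (simp add: count_list_0_iff)
qed (use wf_p in \<open>simp add: wf_production_def\<close>)

lemma count_arg: "m < length (args p) \<Longrightarrow> count_list (args p ! m) (Var x) \<le> 1"
  using count_args[of x] member_le_sum[of m "{..<length (args p)}" "\<lambda>m. count_list (args p ! m) (Var x)"]
  by (simp add: count_list_concat)

lemma word_vars_disjoint:
  assumes "m < length (args p)" "n < length (args p)" "m \<noteq> n"
  shows "word_vars (args p ! m) \<inter> word_vars (args p ! n) = {}"
proof (rule ccontr)
  assume "word_vars (args p ! m) \<inter> word_vars (args p ! n) \<noteq> {}"
  then obtain x where "Var x \<in> set (args p ! m)" "Var x \<in> set (args p ! n)" by (auto simp: word_vars_def)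
  then have "count_list (args p ! m) (Var x) \<ge> 1" "count_list (args p ! n) (Var x) \<ge> 1"
    using count_list_0_iff[of "args p ! m" "Var x"] count_list_0_iff[of "args p ! n" "Var x"] by linarith+
  moreover have "(\<Sum>k\<in>{m, n}. count_list (args p ! k) (Var x)) \<le> count_list (concat (args p)) (Var x)"
    unfolding count_list_concat using assms by (intro sum_mono2) auto
  ultimately show False using count_args[of x] assms(3) by simp
qed

lemma word_vars_UN: "(\<Union>m<length (args p). word_vars (args p ! m)) = set (production_vars p)"
proof
  show "(\<Union>m<length (args p). word_vars (args p ! m)) \<subseteq> set (production_vars p)"
  proof
    fix x assume "x \<in> (\<Union>m<length (args p). word_vars (args p ! m))"
    then obtain m where "m < length (args p)" "Var x \<in> set (args p ! m)" by (auto simp: word_vars_def)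
    then show "x \<in> set (production_vars p)" using args_symbols[OF nth_mem] by blast
  qed
  show "set (production_vars p) \<subseteq> (\<Union>m<length (args p). word_vars (args p ! m))"
  proof
    fix x assume "x \<in> set (production_vars p)"
    then have "count_list (concat (args p)) (Var x) = 1" using wf_p by (simp add: wf_production_def)
    then have "Var x \<in> set (concat (args p))" using count_list_0_iff[of "concat (args p)" "Var x"] by auto
    then obtain s where "s \<in> set (args p)" "Var x \<in> set s" by auto
    then show "x \<in> (\<Union>m<length (args p). word_vars (args p ! m))"
      by (auto simp: word_vars_def in_set_conv_nth)
  qed
qed

lemma arg_vertex_not_var: "4 * m + 2 \<notin> var_vertices X" "4 * m + 3 \<notin> var_vertices X"
proof -
  have "(4 * m + 2 :: nat) \<noteq> 4 * x" "(4 * m + 2 :: nat) \<noteq> 4 * x + 1"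
    "(4 * m + 3 :: nat) \<noteq> 4 * x" "(4 * m + 3 :: nat) \<noteq> 4 * x + 1" for x by presburger+
  then show "4 * m + 2 \<notin> var_vertices X" "4 * m + 3 \<notin> var_vertices X" unfolding var_vertices_def by blast+
qed

lemma arg_matching:
  assumes "m < length (args p)"
  shows "matching (insert (4 * m + 2) ((\<lambda>x. 4 * x + 1) ` word_vars (args p ! m)))
    (insert (4 * m + 3) ((\<lambda>x. 4 * x) ` word_vars (args p ! m))) (word_edges (4 * m + 2) [] (args p ! m) (4 * m + 3))"
  using arg_vertex_not_var[of m "word_vars (args p ! m)"] count_arg[OF assms]
  by (intro word_edges_matching) (auto simp: var_vertices_def)

lemma production_edges_matching:
  "matching ((\<lambda>m. 4 * m + 2) ` {..<length (args p)} \<union> (\<lambda>x. 4 * x + 1) ` set (production_vars p))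
    ((\<lambda>m. 4 * m + 3) ` {..<length (args p)} \<union> (\<lambda>x. 4 * x) ` set (production_vars p)) (production_edges p)"
proof -
  let ?I = "{..<length (args p)}"
  let ?S = "\<lambda>m. insert (4 * m + 2) ((\<lambda>x. 4 * x + 1) ` word_vars (args p ! m))"
  let ?T = "\<lambda>m. insert (4 * m + 3) ((\<lambda>x. 4 * x) ` word_vars (args p ! m))"
  have ne: "(4 * m + 2 :: nat) \<noteq> 4 * x + 1" "4 * x + 1 \<noteq> (4 * m + 2 :: nat)"
    "(4 * m + 3 :: nat) \<noteq> 4 * x" "4 * x \<noteq> (4 * m + 3 :: nat)" for m x :: nat by presburger+
  have "matching (\<Union>m\<in>?I. ?S m) (\<Union>m\<in>?I. ?T m) (production_edges p)"
    unfolding production_edges_def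
  proof (rule matching_UN)
    show "?S m \<inter> ?S n = {} \<and> ?T m \<inter> ?T n = {}" if "m \<in> ?I" "n \<in> ?I" "m \<noteq> n" for m n
      using word_vars_disjoint[of m n] that by (auto simp: disjoint_iff ne[simplified])
  qed (use arg_matching in auto)
  moreover have "(\<Union>m\<in>?I. ?S m) = (\<lambda>m. 4 * m + 2) ` ?I \<union> (\<lambda>x. 4 * x + 1) ` (\<Union>m\<in>?I. word_vars (args p ! m))"
    "(\<Union>m\<in>?I. ?T m) = (\<lambda>m. 4 * m + 3) ` ?I \<union> (\<lambda>x. 4 * x) ` (\<Union>m\<in>?I. word_vars (args p ! m))" by auto
  ultimately show ?thesis unfolding word_vars_UN by (simp only:)
qed

text \<open>Plugging values of the variables into the entry of a production computes the tuple of
  its head. Both inclusions between the languages rest on this.\<close>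

lemma hide_production_edges:
  fixes \<theta> :: "nat \<Rightarrow> 't list"
  defines "X \<equiv> set (production_vars p)"
  shows "hide (var_vertices X) (production_edges p \<union> var_edges \<theta> X) =
      pattern_edges (word_pattern (length (args p))) (map (subst_word \<theta>) (args p)) (arg_list (length (args p)))"
    and "\<not> cyc (var_vertices X) (production_edges p \<union> var_edges \<theta> X)"
proof -
  let ?I = "{..<length (args p)}"
  let ?V = "\<lambda>m. var_vertices (word_vars (args p ! m))"
  let ?E = "\<lambda>m. word_edges (4 * m + 2) [] (args p ! m) (4 * m + 3) \<union> var_edges \<theta> (word_vars (args p ! m))"
  \<comment> \<open>The territory of argument \<open>m\<close>: its two end points and the vertices
    of its variables. Linearity of the production makes these disjoint.\<close>
  let ?W = "\<lambda>m. {4 * m + 2, 4 * m + 3} \<union> ?V m"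
  have V: "(\<Union>m\<in>?I. ?V m) = var_vertices X"
    unfolding X_def word_vars_UN[symmetric] by (auto simp: var_vertices_def)
  have E: "(\<Union>m\<in>?I. ?E m) = production_edges p \<union> var_edges \<theta> X"
    unfolding X_def word_vars_UN[symmetric] by (auto simp: var_edges_def production_edges_def)
  have one: "hide (?V m) (?E m) = {(4 * m + 2, subst_word \<theta> (args p ! m), 4 * m + 3)} \<and> \<not> cyc (?V m) (?E m)"
    if "m \<in> ?I" for m
    using hide_word_edges[of "args p ! m" "4 * m + 2" "4 * m + 3" "[]" \<theta>] count_arg that arg_vertex_not_var[of m] by simp
  have "hide (\<Union>m\<in>?I. ?V m) (\<Union>m\<in>?I. ?E m) = (\<Union>m\<in>?I. hide (?V m) (?E m)) \<and> \<not> cyc (\<Union>m\<in>?I. ?V m) (\<Union>m\<in>?I. ?E m)"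
  proof (rule hide_UN[where W = ?W])
    show "?V m \<subseteq> ?W m \<and> vertices (?E m) \<subseteq> ?W m" if "m \<in> ?I" for m
      using matching_vertices[OF arg_matching[of m]] that by (auto simp: vertices_var_edges var_vertices_def)
    show "?W m \<inter> ?W n = {}" if "m \<in> ?I" "n \<in> ?I" "m \<noteq> n" for m n
    proof -
      have "?V m \<inter> ?V n = {}"
        using word_vars_disjoint[of m n] that unfolding var_vertices_def disjoint_iff by (auto; presburger)
      moreover have "{4 * m + 2, 4 * m + 3} \<inter> {4 * n + 2, 4 * n + 3} = {}"
        using that by (auto; presburger)
      ultimately show ?thesis
        using arg_vertex_not_var[of m "word_vars (args p ! n)"] arg_vertex_not_var[of n "word_vars (args p ! m)"]
        by blast
    qed
  qed (use one in auto)
  moreover have "(\<Union>m\<in>?I. hide (?V m) (?E m)) =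
      pattern_edges (word_pattern (length (args p))) (map (subst_word \<theta>) (args p)) (arg_list (length (args p)))"
    using one unfolding arg_list_def by (subst pattern_edges_word_pattern) auto
  ultimately show "hide (var_vertices X) (production_edges p \<union> var_edges \<theta> X) =
      pattern_edges (word_pattern (length (args p))) (map (subst_word \<theta>) (args p)) (arg_list (length (args p)))"
    "\<not> cyc (var_vertices X) (production_edges p \<union> var_edges \<theta> X)"
    unfolding V E by simp_all
qed

lemmas body_slots_p = body_slots_wf[OF distinct_production_vars[unfolded production_vars_def] body_length,
    folded production_vars_def]

lemma production_slots_mset: "mset (production_slots p) =
    add_mset (Pos (head p), arg_list (length (args p))) (mset (body_slots (body p)))"
  by (simp add: production_slots_def)

lemma wf_production_slots: "wf_slots (mset (production_slots p))"
proof -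
  have "set (arg_list k) \<inter> var_vertices X = {}" for k X
    using arg_vertex_not_var[of _ X] by (auto simp: arg_list_def set_pairs)
  moreover have "length (arg_list (length (args p))) = length (pol (Pos (head p)))"
    by (simp add: arg_list_def pol_Pos args_length del: length_pol)
  ultimately show ?thesis
    unfolding production_slots_mset wf_slots_add using body_slots_p distinct_arg_list by auto
qed

lemma production_slots_matching:
  "matching (slot_sources (mset (production_slots p))) (slot_targets (mset (production_slots p))) (production_edges p)"
  using production_edges_matching body_slots_p
  unfolding production_slots_mset by (simp add: pol_Pos args_length[symmetric] sources_arg_list targets_arg_list)

end

lemma var_edges_var_list:
  assumes "length xs = k"
  shows "pattern_edges (word_pattern k) (map \<theta> xs) (var_list xs) = var_edges \<theta> (set xs)"
proof -
  have "pattern_edges (word_pattern k) (map \<theta> xs) (var_list xs) =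
      (\<lambda>m. (4 * (xs ! m), map \<theta> xs ! m, 4 * (xs ! m) + 1)) ` {..<k}"
    unfolding var_list_def using assms by (rule pattern_edges_word_pattern)
  also have "\<dots> = (\<lambda>m. (\<lambda>x. (4 * x, \<theta> x, 4 * x + 1)) (xs ! m)) ` {..<k}"
    using assms by (intro image_cong) auto
  also have "\<dots> = var_edges \<theta> (set xs)"
    unfolding var_edges_def using assms by (auto simp: set_conv_nth)
  finally show ?thesis .
qed

text \<open>A test chooses a derivable tuple for each premise separately. As the variables of a
  production are pairwise distinct, the choices merge into a single assignment, extended here
  premise by premise.\<close>

lemma tests_body_slots:
  assumes "tests (mset (body_slots bs)) F" "distinct (concat (map snd bs))"
    "\<And>B xs. (B, xs) \<in> set bs \<Longrightarrow> length xs = mcfg_arity G B"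
  shows "\<exists>\<theta>. F = var_edges \<theta> (set (concat (map snd bs))) \<and> (\<forall>(B, xs) \<in> set bs. mcfg_derivable G B (map \<theta> xs))"
  using assms
proof (induction bs arbitrary: F)
  case Nil
  then show ?case by (simp add: body_slots_def var_edges_def)
next
  case (Cons x bs)
  obtain B xs where x: "x = (B, xs)" by fastforce
  have len: "length xs = mcfg_arity G B" using Cons.prems(3) x by simp
  have d: "distinct xs" "set xs \<inter> set (concat (map snd bs)) = {}" using Cons.prems(2) x by auto
  obtain F1 F2 where F: "holds (Pos B) (var_list xs) F1" "tests (mset (body_slots bs)) F2" "F = F1 \<union> F2"
    using Cons.prems(1) by (auto simp: body_slots_def x tests_add)
  obtain \<theta> where \<theta>: "F2 = var_edges \<theta> (set (concat (map snd bs)))" "\<forall>(B, xs) \<in> set bs. mcfg_derivable G B (map \<theta> xs)"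
    using Cons.IH[OF F(2)] Cons.prems(2,3) by auto
  obtain ws where ws: "length ws = mcfg_arity G B" "F1 = pattern_edges (word_pattern (mcfg_arity G B)) ws (var_list xs)"
    "mcfg_derivable G B ws" using F(1) by (auto simp: lit_def)
  define \<eta> where "\<eta> y = (if y \<in> set xs then the (map_of (zip xs ws) y) else \<theta> y)" for y
  have "map \<eta> xs = ws"
    using len ws(1) d(1) by (intro nth_equalityI) (auto simp: \<eta>_def map_of_zip_nth)
  moreover have "mcfg_derivable G C (map \<eta> ys)" if "(C, ys) \<in> set bs" for C ys
  proof -
    have eq: "map \<eta> ys = map \<theta> ys" using that d(2) by (fastforce simp: \<eta>_def)
    have "mcfg_derivable G C (map \<theta> ys)" using \<theta>(2) that by blast
    then show ?thesis by (simp only: eq)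
  qed
  moreover have "var_edges \<eta> (set (concat (map snd bs))) = var_edges \<theta> (set (concat (map snd bs)))"
    unfolding var_edges_def using d(2) by (intro image_cong) (auto simp: \<eta>_def)
  moreover have "var_edges \<eta> (set xs) = F1"
    using var_edges_var_list[OF len, of \<eta>] ws \<open>map \<eta> xs = ws\<close> by simp
  moreover have "var_edges \<eta> (set (concat (map snd (x # bs)))) = var_edges \<eta> (set xs) \<union> var_edges \<eta> (set (concat (map snd bs)))"
    by (simp add: x var_edges_def image_Un)
  ultimately have "F = var_edges \<eta> (set (concat (map snd (x # bs))))" "mcfg_derivable G B (map \<eta> xs)"
    "\<And>C ys. (C, ys) \<in> set bs \<Longrightarrow> mcfg_derivable G C (map \<eta> ys)"
    using \<theta> F(3) ws(3) by auto
  then show ?case by (intro exI[of _ \<eta>]) (auto simp: x)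
qed

lemma valid_production:
  assumes p: "p \<in> mcfg_productions G"
  shows "valid (mset (production_slots p)) (production_edges p)"
  unfolding valid_def
proof (intro conjI allI impI)
  show "wf_slots (mset (production_slots p))" by (rule wf_production_slots[OF p])
  show "matching (slot_sources (mset (production_slots p))) (slot_targets (mset (production_slots p))) (production_edges p)"
    by (rule production_slots_matching[OF p])
  fix A us M' and F :: "'t edge set"
  assume M': "mset (production_slots p) = add_mset (A, us) M'" and F: "tests M' F"
  show "holds A us (hide (slot_vertices M') (production_edges p \<union> F))"
  proof (cases "(A, us) = (Pos (head p), arg_list (length (args p)))")
    case True
    then have M: "M' = mset (body_slots (body p))" using M' by (simp add: production_slots_mset[OF p])
    have "\<exists>\<theta>. F = var_edges \<theta> (set (concat (map snd (body p)))) \<and> (\<forall>(B, xs) \<in> set (body p). mcfg_derivable G B (map \<theta> xs))"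
      using F unfolding M by (rule tests_body_slots)
        (use distinct_production_vars[OF p] body_length[OF p] in \<open>auto simp: production_vars_def\<close>)
    then obtain \<theta> where \<theta>: "F = var_edges \<theta> (set (production_vars p))" "\<forall>(B, xs) \<in> set (body p). mcfg_derivable G B (map \<theta> xs)"
      by (auto simp: production_vars_def)
    have "mcfg_derivable G (head p) (map (subst_word \<theta>) (args p))"
      using mcfg_derivable.intros[OF p \<theta>(2)] .
    moreover have "slot_vertices M' = var_vertices (set (production_vars p))" using body_slots_p[OF p] M by simp
    ultimately show ?thesis
      using True hide_production_edges(1)[OF p, of \<theta>] distinct_arg_list args_length[OF p]
      by (auto simp: \<theta>(1) lit_def arg_list_def intro!: exI[of _ "map (subst_word \<theta>) (args p)"])
  next
    case False
    then obtain K where "M' = add_mset (Pos (head p), arg_list (length (args p))) K"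
      using M' unfolding production_slots_mset[OF p] add_eq_conv_ex by blast
    then show ?thesis using F by (simp add: tests_add lit_def)
  qed
qed

definition production_renaming :: "('n, 't) production \<Rightarrow> nat \<Rightarrow> nat" where
  "production_renaming p = (SOME g. inj_on g (slot_vertices (mset (production_slots p))) \<and>
     map (\<lambda>(A, us). (A, map g us)) (production_slots p) = standard_slots 0 (map fst (production_slots p)))"

lemma production_renaming:
  assumes "p \<in> mcfg_productions G"
  shows "inj_on (production_renaming p) (slot_vertices (mset (production_slots p)))"
    "rename_slots (production_renaming p) (mset (production_slots p)) = mset (standard_slots 0 (map fst (production_slots p)))"
  using someI_ex[OF standard_renaming_exists[OF wf_production_slots[OF assms]], folded production_renaming_def]
  by (auto simp: rename_slots_def simp flip: mset_map)

definition lexical_entry :: "('n, 't) production \<Rightarrow> ('n, 't) judgement" where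
  "lexical_entry p = (Multiword (rename (production_renaming p) (production_edges p)) {#}, map fst (production_slots p))"

definition grammar :: "('n, 't) llg" where
  "grammar = \<lparr>llg_literals = mcfg_nonterminals G, llg_boundary = arity_boundary,
     llg_terminals = mcfg_terminals G, llg_lexicon = lexical_entry ` mcfg_productions G, llg_start = mcfg_start G\<rparr>"

sublocale named: named_derivability grammar
  rewrites "llg_boundary grammar = arity_boundary"
  by (simp add: grammar_def)

lemma derivable_production:
  assumes p: "p \<in> mcfg_productions G"
  shows "named.derivable (mset (production_slots p)) (production_edges p)"
proof -
  have "lexical_entry p \<in> llg_lexicon grammar" using p by (simp add: grammar_def)
  then show ?thesis
    unfolding named.derivable_def lexical_entry_def
    using wf_production_slots[OF p] production_slots_matching[OF p] production_renaming[OF p] llg_derivable.Lexicon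
    by blast
qed

text \<open>The derivations of the premises are cut into the lexical entry. The names
  \<open>us\<close> are kept arbitrary because the induction hypothesis is applied at the names that
  the slots of the entry carry.\<close>

lemma mcfg_derivable_derivable:
  assumes "mcfg_derivable G B ws"
  shows "length us = 2 * mcfg_arity G B \<Longrightarrow> distinct us \<Longrightarrow>
    named.derivable {#(Pos B, us)#} (pattern_edges (word_pattern (mcfg_arity G B)) ws us)"
  using assms
proof (induction arbitrary: us rule: mcfg_derivable.induct)
  case (1 p \<theta>)
  note p = 1(1)
  let ?slot = "\<lambda>(B, xs). (Neg B, rev (var_list xs), pattern_edges (word_pattern (mcfg_arity G B)) (map \<theta> xs) (var_list xs))"
  let ?N = "mset (map ?slot (body p))"
  have img: "image_mset (\<lambda>(A, us, F). (A, us)) ?N = mset (body_slots (body p))"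
    unfolding body_slots_def mset_map multiset.map_comp by (intro image_mset_cong) auto
  have F: "(\<Union>(A, us, F) \<in> set_mset ?N. F) = var_edges \<theta> (set (production_vars p))"
  proof -
    have "(\<Union>(A, us, F) \<in> set_mset ?N. F) = (\<Union>(B, xs) \<in> set (body p). var_edges \<theta> (set xs))"
      using var_edges_var_list[OF body_length[OF p], of _ _ \<theta>] by (auto split: prod.splits)
    also have "\<dots> = var_edges \<theta> (set (production_vars p))"
      by (auto simp: var_edges_def production_vars_def split: prod.splits) force+
    finally show ?thesis .
  qed
  have V: "slot_vertices (mset (body_slots (body p))) = var_vertices (set (production_vars p))"
    using body_slots_p[OF p] by simp
  have d: "named.derivable (add_mset (Pos (head p), arg_list (length (args p))) (image_mset (\<lambda>(A, us, F). (A, us)) ?N)) (production_edges p)"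
    unfolding img using derivable_production[OF p] by (simp add: production_slots_mset[OF p])
  have "named.derivable {#(neg A, rev us)#} F" if AF: "(A, us, F) \<in># ?N" for A us F
  proof -
    obtain B xs where Bxs: "(B, xs) \<in> set (body p)" "A = Neg B" "us = rev (var_list xs)"
      "F = pattern_edges (word_pattern (mcfg_arity G B)) (map \<theta> xs) (var_list xs)" using AF by auto
    have "distinct xs" using distinct_production_vars[OF p] Bxs(1)
      by (auto simp: production_vars_def distinct_concat_iff)
    then show ?thesis using 1(2) Bxs body_length[OF p Bxs(1)] distinct_var_list
      by (force simp: var_list_def)
  qed
  from named.derivable_plug[OF d this]
  have "named.derivable {#(Pos (head p), arg_list (length (args p)))#}
      (pattern_edges (word_pattern (length (args p))) (map (subst_word \<theta>) (args p)) (arg_list (length (args p))))"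
    unfolding img F V using hide_production_edges[OF p, of \<theta>] by simp
  moreover obtain g where g: "map g (arg_list (length (args p))) = us" "inj_on g (set (arg_list (length (args p))))"
  proof (rule distinct_map_exists)
    show "length (arg_list (length (args p))) = length us" using 1(3) args_length[OF p] by (simp add: arg_list_def)
  qed (use 1(4) distinct_arg_list in auto)
  ultimately have "named.derivable {#(Pos (head p), us)#}
      (rename g (pattern_edges (word_pattern (length (args p))) (map (subst_word \<theta>) (args p)) (arg_list (length (args p)))))"
    using named.derivable_rename[of "{#(Pos (head p), arg_list (length (args p)))#}" _ g] by auto
  moreover have "rename g (pattern_edges (word_pattern (length (args p))) (map (subst_word \<theta>) (args p)) (arg_list (length (args p)))) =
      pattern_edges (word_pattern (length (args p))) (map (subst_word \<theta>) (args p)) us"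
    by (rule trans[OF rename_pattern_edges[OF is_pattern_word_pattern]]) (simp add: arg_list_def, simp only: g(1))
  ultimately show ?case by (simp add: args_length[OF p])
qed

lemma mcfg_derivable_lists: "mcfg_derivable G B ws \<Longrightarrow> set ws \<subseteq> lists (mcfg_terminals G)"
proof (induction rule: mcfg_derivable.induct)
  case (1 p \<theta>)
  have "\<theta> x \<in> lists (mcfg_terminals G)" if "x \<in> set (production_vars p)" for x
    using that 1(2) unfolding production_vars_def by fastforce
  then have "subst_symbol \<theta> y \<in> lists (mcfg_terminals G)" if "s \<in> set (args p)" "y \<in> set s" for s y
    using args_symbols[OF 1(1) that(1)] that(2) by (cases y) auto
  then show ?case by (fastforce simp: subst_word_def)
qed

lemma lexical_entry_is_judgement:
  assumes p: "p \<in> mcfg_productions G"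
  shows "is_judgement grammar (lexical_entry p)"
proof -
  let ?E = "rename (production_renaming p) (production_edges p)" and ?\<Gamma> = "map fst (production_slots p)"
  have "matching (slot_sources (mset (standard_slots 0 ?\<Gamma>))) (slot_targets (mset (standard_slots 0 ?\<Gamma>))) ?E"
    unfolding production_renaming(2)[OF p, symmetric] slot_sources_rename slot_targets_rename
    using production_renaming(1)[OF p] wf_slots_sources_Un_targets[OF wf_production_slots[OF p]]
    by (intro matching_rename production_slots_matching[OF p]) simp
  then have "matching (lefts (sequent_boundary arity_boundary ?\<Gamma>)) (rights (sequent_boundary arity_boundary ?\<Gamma>)) ?E"
    unfolding slot_sources_standard_slots slot_targets_standard_slots by simp
  moreover have "w \<in> lists (mcfg_terminals G)" if "(i, w, j) \<in> ?E" for i w j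
  proof -
    have word: "w \<in> lists (mcfg_terminals G)"
      if "(i, w, j) \<in> word_edges a u s c" "set s \<subseteq> Term ` mcfg_terminals G \<union> range Var" "u \<in> lists (mcfg_terminals G)"
      for i w j a u s c
      using that by (induction a u s c rule: word_edges.induct) auto
    from that obtain m i' j' where m: "m < length (args p)" "(i', w, j') \<in> word_edges (4 * m + 2) [] (args p ! m) (4 * m + 3)"
      by (auto simp: mem_rename production_edges_def)
    then show ?thesis using args_symbols[OF p, of "args p ! m"] by (intro word[OF m(2)]) auto
  qed
  ultimately have "is_regular_multiword (mcfg_terminals G) (sequent_boundary arity_boundary ?\<Gamma>) ?E"
    by (rule matching_is_regular_multiword)
  moreover have "\<forall>A \<in> set ?\<Gamma>. set_formula A \<subseteq> mcfg_nonterminals G"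
    using wf_p[OF p] by (auto simp: production_slots_def body_slots_def wf_production_def)
  ultimately show ?thesis
    by (simp add: is_judgement_def lexical_entry_def grammar_def is_multiword_def)
qed

lemma wf_grammar: "wf_llg grammar" and tensor_free_grammar: "tensor_free_lexicon grammar"
proof -
  have "lefts (word_boundary 1) = {1}" by (auto simp: lefts_word_boundary)
  then have "card (lefts (arity_boundary (mcfg_start G))) = 1" "rights (arity_boundary (mcfg_start G)) = {2}"
    using wf by (auto simp: wf_mcfg_def arity_boundary_def rights_def)
  then show "wf_llg grammar"
    using wf lexical_entry_is_judgement by (auto simp: wf_llg_def grammar_def[THEN arg_cong[where f = llg_literals]]
        grammar_def[THEN arg_cong[where f = llg_terminals]] grammar_def[THEN arg_cong[where f = llg_lexicon]]
        grammar_def[THEN arg_cong[where f = llg_start]] grammar_def[THEN arg_cong[where f = llg_boundary]] wf_mcfg_def)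
  show "tensor_free_lexicon grammar"
    by (auto simp: tensor_free_lexicon_def grammar_def lexical_entry_def production_slots_def body_slots_def)
qed

lemma start_arity: "mcfg_arity G (mcfg_start G) = 1"
  using wf by (simp add: wf_mcfg_def)

text \<open>Adequacy gives one inclusion: with a single formula and nothing to plug, the multiword
  is a derivable tuple of the start symbol. For the other one, membership in
  \<open>llg_language\<close> leaves the vertices of the edge open, so a derivation up to renaming
  suffices.\<close>

theorem grammar_language: "llg_language grammar = mcfg_language G"
proof
  show "llg_language grammar \<subseteq> mcfg_language G"
  proof
    fix w assume "w \<in> llg_language grammar"
    then obtain \<sigma> i j where \<sigma>: "llg_derivable grammar \<sigma> [Pos (mcfg_start G)]" "regular \<sigma>" "edges \<sigma> = {(i, w, j)}"
      by (auto simp: llg_language_def grammar_def)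
    have "valid (mset (standard_slots 0 [Pos (mcfg_start G)])) (edges \<sigma>)"
    proof (rule adequacy[OF _ _ \<sigma>(1,2)])
      show "llg_boundary grammar = arity_boundary" by (simp add: grammar_def)
      show "valid (mset (standard_slots 0 \<Gamma>)) (edges \<sigma>)" if \<sigma>\<Gamma>: "(\<sigma>, \<Gamma>) \<in> llg_lexicon grammar" for \<sigma> \<Gamma>
      proof -
        obtain p where p: "p \<in> mcfg_productions G" "(\<sigma>, \<Gamma>) = lexical_entry p" using \<sigma>\<Gamma> by (auto simp: grammar_def)
        then show ?thesis
          using valid_rename[OF valid_production[OF p(1)] production_renaming(1)[OF p(1)]]
          by (simp add: lexical_entry_def production_renaming(2)[OF p(1)])
      qed
    qed
    then have "holds (Pos (mcfg_start G)) (block 0 (fsize (Pos (mcfg_start G)))) (edges \<sigma>)"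
      using valid_holds[of "Pos (mcfg_start G)" _ "{#}" "edges \<sigma>" "{}"] by simp
    then obtain ws us where ws: "length ws = 1" "edges \<sigma> = pattern_edges (word_pattern 1) ws us" "mcfg_derivable G (mcfg_start G) ws"
      by (auto simp: lit_def start_arity)
    then have "ws = [w]" using \<sigma>(3) by (cases ws) (auto simp: pattern_edges_def word_pattern_def lessThan_Suc)
    then show "w \<in> mcfg_language G"
      using ws mcfg_derivable_lists[OF ws(3)] by (simp add: mcfg_language_def)
  qed
  show "mcfg_language G \<subseteq> llg_language grammar"
  proof
    fix w assume "w \<in> mcfg_language G"
    then have "mcfg_derivable G (mcfg_start G) [w]" by (simp add: mcfg_language_def)
    then have "named.derivable {#(Pos (mcfg_start G), [0, 1])#} (pattern_edges (word_pattern 1) [w] [0, 1])"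
      using mcfg_derivable_derivable[of "mcfg_start G" "[w]" "[0, 1]"] by (simp add: start_arity)
    then obtain g where g: "llg_derivable grammar (Multiword (rename g (pattern_edges (word_pattern 1) [w] [0, 1])) {#}) [Pos (mcfg_start G)]"
      by (rule named.derivable_single)
    moreover have "rename g (pattern_edges (word_pattern 1) [w] [0, 1]) = {(g 0, w, g 1)}"
      by (simp add: pattern_edges_def word_pattern_def rename_def lessThan_Suc)
    moreover have "llg_start grammar = mcfg_start G" by (simp add: grammar_def)
    ultimately show "w \<in> llg_language grammar"
      by (auto simp: llg_language_def regular_def intro!: exI[of _ "Multiword {(g 0, w, g 1)} {#}"])
  qed
qed

end

section \<open>Productions read off a tensor-free lexicon\<close>

section \<open>From linear logic grammars to multiple context-free grammars\<close>

instance formula :: (countable) countable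
  by countable_datatype

lemma distinct_concat_disjoint:
  assumes "distinct (concat xs)" "i < length xs" "j < length xs" "i \<noteq> j"
  shows "set (xs ! i) \<inter> set (xs ! j) = {}"
proof -
  have *: "set (xs ! i) \<inter> set (xs ! j) = {}" if "i < j" "j < length xs" for i j
  proof -
    have "distinct (concat (take j xs) @ xs ! j @ concat (drop (Suc j) xs))"
      using assms(1) id_take_nth_drop[OF that(2)] by (metis concat.simps(2) concat_append)
    moreover have "xs ! i \<in> set (take j xs)"
      using that by (metis in_set_conv_nth length_take min_less_iff_conj nth_take order_less_trans)
    ultimately show ?thesis by auto
  qed
  show ?thesis using *[of i j] *[of j i] assms by (cases "i < j") (auto simp: Int_commute)
qed

lemma label_count_UN:
  fixes n :: nat
  assumes "\<And>j. j < n \<Longrightarrow> finite (E j)" "\<And>i j. \<lbrakk>i < n; j < n; i \<noteq> j\<rbrakk> \<Longrightarrow> E i \<inter> E j = {}"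
  shows "label_count x (\<Union>j<n. E j) = (\<Sum>j<n. label_count x (E j))"
  unfolding label_count_def by (rule sum.UNION_disjoint) (use assms in auto)

lemma label_count_pattern_edges:
  assumes "is_pattern p \<pi>" "length us = length p" "distinct us"
  shows "label_count x (pattern_edges \<pi> ws us) = (\<Sum>m<length \<pi>. count_list (ws ! m) x)"
proof -
  have "inj_on (\<lambda>m. (us ! fst (\<pi> ! m), ws ! m, us ! snd (\<pi> ! m))) {..<length \<pi>}"
    using is_pattern_inj(1)[OF assms(1)] is_pattern_less(1)[OF assms(1)] assms(2,3)
    by (auto simp: inj_on_def nth_eq_iff_index_eq)
  then show ?thesis unfolding label_count_def pattern_edges_def by (simp add: sum.reindex)
qed

lemma subst_word_append: "subst_word \<theta> (u @ v) = subst_word \<theta> u @ subst_word \<theta> v"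
  by (simp add: subst_word_def)

lemma subst_word_Term: "subst_word \<theta> (map Term w) = w"
  by (induction w) (auto simp: subst_word_def)

context boundaries
begin

text \<open>The boundary of a par lists the vertices of \<open>B\<close> before those of
  \<open>A\<close>, which explains \<open>drop\<close> for \<open>A\<close> and \<open>take\<close>
  for \<open>B\<close>. A tensor stays whole; a tensor-free formula has none.\<close>

primrec flatten :: "'n formula \<Rightarrow> nat list \<Rightarrow> 'n slot multiset" where
  "flatten (Pos P) us = {#(Pos P, us)#}"
| "flatten (Neg P) us = {#(Neg P, us)#}"
| "flatten (Tensor A B) us = {#(Tensor A B, us)#}"
| "flatten (Par A B) us = flatten A (drop (fsize B) us) + flatten B (take (fsize B) us)"

definition flatten_slots :: "'n slot multiset \<Rightarrow> 'n slot multiset" where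
  "flatten_slots M = (\<Sum>x\<in>#M. flatten (fst x) (snd x))"

lemma flatten_slots_simps [simp]:
  "flatten_slots {#} = {#}" "flatten_slots (add_mset x M) = flatten (fst x) (snd x) + flatten_slots M"
  by (simp_all add: flatten_slots_def)

text \<open>This is where tensor-freeness of the lexicon is used: all slots become literals, whose
  sets in the model can be chosen freely. For a tensor, \<open>holds\<close> admits only unions of
  an element of each half, whereas a lexical multiword may connect the halves by an edge.\<close>

lemma flatten_literal:
  "\<lbrakk>tensor_free A; (X, vs) \<in># flatten A us\<rbrakk> \<Longrightarrow> X \<in> Pos ` set_formula A \<union> Neg ` set_formula A"
  by (induction A arbitrary: us) (auto simp: image_Un)

lemma flatten_slots_literal:
  assumes "(X, vs) \<in># flatten_slots M" "\<And>A us. (A, us) \<in># M \<Longrightarrow> tensor_free A \<and> set_formula A \<subseteq> N"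
  shows "X \<in> Pos ` N \<union> Neg ` N"
  using assms
proof (induction M)
  case (add x M)
  obtain A us where x: "x = (A, us)" by fastforce
  show ?case
  proof (cases "(X, vs) \<in># flatten A us")
    case True
    then show ?thesis using flatten_literal[of A X vs us] add.prems(2)[of A us] x by auto
  next
    case False
    then show ?thesis using add x by auto
  qed
qed simp

definition plugged_edges :: "'n slot list \<Rightarrow> (nat \<times> nat) list list \<Rightarrow> 'a list list list \<Rightarrow> 'a edge set" where
  "plugged_edges c \<pi>s wss = (\<Union>j<length c. pattern_edges (\<pi>s ! j) (wss ! j) (rev (snd (c ! j))))"

lemma slot_nth:
  assumes "wf_slots (mset c)" "j < length c"
  shows "length (snd (c ! j)) = length (pol (fst (c ! j)))" "distinct (snd (c ! j))"
proof -
  have "c ! j \<in># mset c" using assms(2) by simp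
  then show "length (snd (c ! j)) = length (pol (fst (c ! j)))" using assms(1) unfolding wf_slots_def by blast
  show "distinct (snd (c ! j))"
    using wf_slots_distinct[OF assms(1)] assms(2) by (auto simp: distinct_concat_iff)
qed

lemma slot_nth_disjoint:
  assumes "wf_slots (mset c)" "i < length c" "j < length c" "i \<noteq> j"
  shows "set (snd (c ! i)) \<inter> set (snd (c ! j)) = {}"
  using distinct_concat_disjoint[OF wf_slots_distinct[OF assms(1)], of i j] assms by simp

lemma plugged_pattern_matching:
  assumes "wf_slots (mset c)" "j < length c" "is_pattern (pol (neg (fst (c ! j)))) \<pi>"
  shows "matching (targets (pol (fst (c ! j))) (snd (c ! j))) (sources (pol (fst (c ! j))) (snd (c ! j)))
    (pattern_edges \<pi> ws (rev (snd (c ! j))))"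
proof -
  note s = slot_nth[OF assms(1,2)]
  have "matching (sources (pol (neg (fst (c ! j)))) (rev (snd (c ! j)))) (targets (pol (neg (fst (c ! j)))) (rev (snd (c ! j))))
    (pattern_edges \<pi> ws (rev (snd (c ! j))))"
    using s length_pol_neg[of "fst (c ! j)"] by (intro pattern_edges_matching[OF assms(3)]) auto
  then show ?thesis by (simp only: pol_neg sources_dual[OF s(1)] targets_dual[OF s(1)])
qed

lemma plugged_edges_matching:
  assumes wf: "wf_slots (mset c)" and \<pi>s: "\<And>j. j < length c \<Longrightarrow> is_pattern (pol (neg (fst (c ! j)))) (\<pi>s ! j)"
  shows "matching (slot_targets (mset c)) (slot_sources (mset c)) (plugged_edges c \<pi>s wss)"
proof -
  have "slot_targets (mset c) = (\<Union>j<length c. targets (pol (fst (c ! j))) (snd (c ! j)))"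
    "slot_sources (mset c) = (\<Union>j<length c. sources (pol (fst (c ! j))) (snd (c ! j)))"
    by (auto simp: slot_targets_def slot_sources_def set_conv_nth)
  moreover have "matching (\<Union>j<length c. targets (pol (fst (c ! j))) (snd (c ! j)))
      (\<Union>j<length c. sources (pol (fst (c ! j))) (snd (c ! j))) (plugged_edges c \<pi>s wss)"
    unfolding plugged_edges_def
  proof (rule matching_UN)
    show "targets (pol (fst (c ! i))) (snd (c ! i)) \<inter> targets (pol (fst (c ! j))) (snd (c ! j)) = {} \<and>
        sources (pol (fst (c ! i))) (snd (c ! i)) \<inter> sources (pol (fst (c ! j))) (snd (c ! j)) = {}"
      if "i \<in> {..<length c}" "j \<in> {..<length c}" "i \<noteq> j" for i j
      using slot_nth_disjoint[OF wf, of i j] that sources_subset[of "pol (fst (c ! i))" "snd (c ! i)"]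
        sources_subset[of "pol (fst (c ! j))" "snd (c ! j)"] targets_subset[of "pol (fst (c ! i))" "snd (c ! i)"]
        targets_subset[of "pol (fst (c ! j))" "snd (c ! j)"] by blast
  qed (use plugged_pattern_matching[OF wf] \<pi>s in auto)
  ultimately show ?thesis by (simp only:)
qed

lemma label_count_plugged_edges:
  assumes wf: "wf_slots (mset c)" and \<pi>s: "\<And>j. j < length c \<Longrightarrow> is_pattern (pol (neg (fst (c ! j)))) (\<pi>s ! j)"
  shows "label_count x (plugged_edges c \<pi>s wss) = (\<Sum>j<length c. \<Sum>m<length (\<pi>s ! j). count_list (wss ! j ! m) x)"
proof -
  let ?E = "\<lambda>j. pattern_edges (\<pi>s ! j) (wss ! j) (rev (snd (c ! j)))"
  have m: "matching (targets (pol (fst (c ! j))) (snd (c ! j))) (sources (pol (fst (c ! j))) (snd (c ! j))) (?E j)"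
    if "j < length c" for j using plugged_pattern_matching[OF wf that \<pi>s[OF that]] .
  have "label_count x (\<Union>j<length c. ?E j) = (\<Sum>j<length c. label_count x (?E j))"
  proof (rule label_count_UN)
    show "finite (?E j)" if "j < length c" for j using matching_finite[OF m[OF that]] .
    show "?E i \<inter> ?E j = {}" if ij: "i < length c" "j < length c" "i \<noteq> j" for i j
    proof -
      have "e \<notin> ?E j" if "e \<in> ?E i" for e
        using matchingD(1)[OF m[OF ij(1)], of "fst e" "fst (snd e)" "snd (snd e)"]
          matchingD(1)[OF m[OF ij(2)], of "fst e" "fst (snd e)" "snd (snd e)"] that
          slot_nth_disjoint[OF wf ij] targets_subset by fastforce
      then show ?thesis by blast
    qed
  qed
  also have "\<dots> = (\<Sum>j<length c. \<Sum>m<length (\<pi>s ! j). count_list (wss ! j ! m) x)"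
  proof (rule sum.cong)
    fix j assume "j \<in> {..<length c}"
    then have j: "j < length c" by simp
    show "label_count x (?E j) = (\<Sum>m<length (\<pi>s ! j). count_list (wss ! j ! m) x)"
      using slot_nth[OF wf j] length_pol_neg[of "fst (c ! j)"] by (intro label_count_pattern_edges[OF \<pi>s[OF j]]) auto
  qed simp
  finally show ?thesis unfolding plugged_edges_def .
qed

lemma relabel_plugged_edges:
  assumes "\<And>j. j < length c \<Longrightarrow> length (wss ! j) = length (\<pi>s ! j) \<and> wss' ! j = map f (wss ! j)"
  shows "relabel f (plugged_edges c \<pi>s wss) = plugged_edges c \<pi>s wss'"
proof -
  have "relabel f (plugged_edges c \<pi>s wss) = (\<Union>j<length c. relabel f (pattern_edges (\<pi>s ! j) (wss ! j) (rev (snd (c ! j)))))"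
    unfolding plugged_edges_def relabel_def by blast
  also have "\<dots> = plugged_edges c \<pi>s wss'"
    unfolding plugged_edges_def using assms by (intro SUP_cong) (auto simp: relabel_pattern_edges)
  finally show ?thesis .
qed

end

text \<open>Opposite in direction to \<open>derivable_flatten\<close>: derivability passes from a
  lexical entry to its flattened form, whereas validity is established for the flattened form and
  passes back.\<close>

lemma (in semantics) valid_flatten:
  "\<lbrakk>valid (flatten A us + M) E; length us = fsize A\<rbrakk> \<Longrightarrow> valid (add_mset (A, us) M) E"
proof (induction A arbitrary: us M)
  case (Par A B)
  let ?us1 = "drop (fsize B) us" and ?us2 = "take (fsize B) us"
  have "valid (flatten A ?us1 + (flatten B ?us2 + M)) E" using Par.prems by (simp add: add.assoc)
  then have "valid (add_mset (A, ?us1) (flatten B ?us2 + M)) E" using Par.IH(1) Par.prems(2) by simp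
  then have "valid (flatten B ?us2 + add_mset (A, ?us1) M) E" by simp
  then have "valid (add_mset (B, ?us2) (add_mset (A, ?us1) M)) E" using Par.IH(2) Par.prems(2) by simp
  then have "valid (add_mset (A, ?us1) (add_mset (B, ?us2) M)) E" by (simp add: add_mset_commute)
  from valid_par[OF this] show ?case by simp
qed auto

lemma (in semantics) valid_flatten_slots:
  assumes "valid (flatten_slots M + K) E" "\<And>A us. (A, us) \<in># M \<Longrightarrow> length us = fsize A"
  shows "valid (M + K) E"
  using assms
proof (induction M arbitrary: K)
  case (add x M)
  obtain A us where x: "x = (A, us)" by fastforce
  have "valid (flatten A us + (flatten_slots M + K)) E" using add.prems(1) by (simp add: x add.assoc)
  then have "valid (add_mset (A, us) (flatten_slots M + K)) E"
    using add.prems(2)[of A us] x by (intro valid_flatten) auto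
  then have "valid (flatten_slots M + add_mset (A, us) K) E" by simp
  then have "valid (M + add_mset (A, us) K) E" by (rule add.IH) (use add.prems(2) in auto)
  then show ?case by (simp add: x)
qed simp

context named_derivability
begin

lemma derivable_flatten:
  "\<lbrakk>derivable (add_mset (A, us) M) E; set_formula A \<subseteq> llg_literals G\<rbrakk> \<Longrightarrow> derivable (flatten A us + M) E"
proof (induction A arbitrary: us M)
  case (Par A B)
  let ?us1 = "drop (fsize B) us" and ?us2 = "take (fsize B) us"
  have len: "length us = fsize B + fsize A" using derivableD(1)[OF Par.prems(1)] by (simp add: wf_slots_add)
  have "derivable (add_mset (Par A B, ?us2 @ ?us1) M) E" using Par.prems(1) by simp
  then have "derivable (add_mset (A, ?us1) (add_mset (B, ?us2) M)) E"
    by (rule derivable_par_inverse) (use Par.prems(2) len in auto)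
  then have "derivable (flatten A ?us1 + add_mset (B, ?us2) M) E" by (rule Par.IH(1)) (use Par.prems(2) in auto)
  then have "derivable (add_mset (B, ?us2) (flatten A ?us1 + M)) E" by simp
  then have "derivable (flatten B ?us2 + (flatten A ?us1 + M)) E" by (rule Par.IH(2)) (use Par.prems(2) in auto)
  then show ?case by (simp add: add_ac)
qed auto

lemma derivable_flatten_slots:
  assumes "derivable (M + K) E" "\<And>A us. (A, us) \<in># M \<Longrightarrow> set_formula A \<subseteq> llg_literals G"
  shows "derivable (flatten_slots M + K) E"
  using assms
proof (induction M arbitrary: K)
  case (add x M)
  obtain A us where x: "x = (A, us)" by fastforce
  have "derivable (add_mset (A, us) (M + K)) E" using add.prems(1) by (simp add: x)
  then have "derivable (flatten A us + (M + K)) E"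
    using add.prems(2)[of A us] x by (intro derivable_flatten) auto
  then have "derivable (M + (flatten A us + K)) E" by (simp add: add_ac)
  then have "derivable (flatten_slots M + (flatten A us + K)) E" using add by auto
  then show ?case by (simp add: x add_ac)
qed simp

end

locale llg_encoding =
  fixes G :: "(nat, 't) llg"
  assumes wf: "wf_llg G" and tensor_free: "tensor_free_lexicon G"
begin

sublocale named_derivability G .

definition literals :: "nat formula set" where
  "literals = Pos ` llg_literals G \<union> Neg ` llg_literals G"

lemma neg_literals: "X \<in> literals \<Longrightarrow> neg X \<in> literals"
  by (auto simp: literals_def)

text \<open>The nonterminals have to be natural numbers, hence the coding of a countable type.
  \<open>None\<close> is reserved for a fresh start symbol, because a code of the start literal with
  its pattern has arity 2.\<close>

definition nonterminal_code :: "nat formula \<Rightarrow> (nat \<times> nat) list \<Rightarrow> nat" where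
  "nonterminal_code X \<pi> = to_nat (Some (X, \<pi>))"

definition start_code :: nat where
  "start_code = to_nat (None :: (nat formula \<times> (nat \<times> nat) list) option)"

definition code_arity :: "nat \<Rightarrow> nat" where
  "code_arity n = (case from_nat n :: (nat formula \<times> (nat \<times> nat) list) option of
     None \<Rightarrow> 1 | Some (X, \<pi>) \<Rightarrow> length \<pi> + 1)"

lemma code_simps [simp]:
  "nonterminal_code X \<pi> = nonterminal_code X' \<pi>' \<longleftrightarrow> X = X' \<and> \<pi> = \<pi>'"
  "nonterminal_code X \<pi> \<noteq> start_code" "start_code \<noteq> nonterminal_code X \<pi>"
  "code_arity (nonterminal_code X \<pi>) = length \<pi> + 1" "code_arity start_code = 1"
  by (auto simp: nonterminal_code_def start_code_def code_arity_def)

text \<open>Component \<open>m\<close> of the tuple plugged into slot \<open>j\<close> becomes a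
  variable; pairing both indices keeps the variables of different slots apart.\<close>

definition test_words :: "nat \<Rightarrow> nat \<Rightarrow> 't symbol list list" where
  "test_words j k = map (\<lambda>m. [Var (prod_encode (j, m))]) [0..<k]"

definition symbolic_edges :: "'t edge set \<Rightarrow> nat slot list \<Rightarrow> (nat \<times> nat) list list \<Rightarrow> 't symbol edge set" where
  "symbolic_edges E c \<pi>s = relabel (map Term) E \<union>
     plugged_edges c \<pi>s (map (\<lambda>j. test_words j (length (\<pi>s ! j))) [0..<length c])"

text \<open>
  A nonterminal carries one component more than its pattern has edges; the additional component
  always derives the empty word, so that arities are nonzero even when the boundary is empty.
\<close>

definition rule :: "nat formula \<Rightarrow> (nat \<times> nat) list \<Rightarrow> nat slot list \<Rightarrow> (nat \<times> nat) list list \<Rightarrow>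
    't symbol list list \<Rightarrow> (nat, 't) production" where
  "rule X \<pi> c \<pi>s ss = Production
     (map (\<lambda>j. (nonterminal_code (neg (fst (c ! j))) (\<pi>s ! j), map (\<lambda>m. prod_encode (j, m)) [0..<length (\<pi>s ! j) + 1]))
       [0..<length c])
     (nonterminal_code X \<pi>)
     (ss @ [map (\<lambda>j. Var (prod_encode (j, length (\<pi>s ! j)))) [0..<length c]])"

text \<open>\<open>c\<close> lists the slots other than the output \<open>(X, us)\<close>, and
  \<pi>\<open>s\<close> the shapes plugged into them; \<open>ss\<close> consists of the symbolic
  labels of the result, which has shape \<pi>. Acyclicity can be tested on symbolic labels because
  it does not depend on labels, by \<open>cyc_relabel\<close>.\<close>

definition admissible :: "'t edge set \<Rightarrow> nat formula \<Rightarrow> nat list \<Rightarrow> nat slot list \<Rightarrow> (nat \<times> nat) list list \<Rightarrow>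
    (nat \<times> nat) list \<Rightarrow> 't symbol list list \<Rightarrow> bool" where
  "admissible E X us c \<pi>s \<pi> ss \<longleftrightarrow> length \<pi>s = length c \<and>
     (\<forall>j < length c. is_pattern (pol (neg (fst (c ! j)))) (\<pi>s ! j)) \<and> is_pattern (pol X) \<pi> \<and> length ss = length \<pi> \<and>
     \<not> cyc (slot_vertices (mset c)) (symbolic_edges E c \<pi>s) \<and>
     hide (slot_vertices (mset c)) (symbolic_edges E c \<pi>s) = pattern_edges \<pi> ss us"

definition entry_slots :: "nat formula list \<Rightarrow> nat slot multiset" where
  "entry_slots \<Gamma> = flatten_slots (mset (standard_slots 0 \<Gamma>))"

definition rules :: "(nat, 't) production set" where
  "rules = {rule X \<pi> c \<pi>s ss | X \<pi> c \<pi>s ss. \<exists>\<sigma> \<Gamma> us. (\<sigma>, \<Gamma>) \<in> llg_lexicon G \<and> regular \<sigma> \<and>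
     entry_slots \<Gamma> = add_mset (X, us) (mset c) \<and> admissible (edges \<sigma>) X us c \<pi>s \<pi> ss}"

text \<open>The start symbol is unary, while the code of the start literal carries the additional
  component. Concatenation discards that component, as it is empty, and still uses each variable
  exactly once.\<close>

definition start_rules :: "(nat, 't) production set" where
  "start_rules = (\<lambda>\<pi>. Production [(nonterminal_code (Pos (llg_start G)) \<pi>, [0, 1])] start_code [[Var 0, Var 1]]) `
     {\<pi>. is_pattern (pol (Pos (llg_start G))) \<pi>}"

definition grammar :: "(nat, 't) mcfg" where
  "grammar = \<lparr>mcfg_nonterminals = insert start_code {nonterminal_code X \<pi> | X \<pi>. X \<in> literals \<and> is_pattern (pol X) \<pi>},
     mcfg_arity = code_arity, mcfg_terminals = llg_terminals G, mcfg_start = start_code,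
     mcfg_productions = rules \<union> start_rules\<rparr>"

lemma grammar_sel [simp]:
  "mcfg_nonterminals grammar = insert start_code {nonterminal_code X \<pi> | X \<pi>. X \<in> literals \<and> is_pattern (pol X) \<pi>}"
  "mcfg_arity grammar = code_arity" "mcfg_terminals grammar = llg_terminals G" "mcfg_start grammar = start_code"
  "mcfg_productions grammar = rules \<union> start_rules"
  by (simp_all add: grammar_def)

lemma rule_sel [simp]:
  "head (rule X \<pi> c \<pi>s ss) = nonterminal_code X \<pi>"
  "body (rule X \<pi> c \<pi>s ss) = map (\<lambda>j. (nonterminal_code (neg (fst (c ! j))) (\<pi>s ! j),
      map (\<lambda>m. prod_encode (j, m)) [0..<length (\<pi>s ! j) + 1])) [0..<length c]"
  "args (rule X \<pi> c \<pi>s ss) = ss @ [map (\<lambda>j. Var (prod_encode (j, length (\<pi>s ! j)))) [0..<length c]]"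
  by (simp_all add: rule_def)

context
  fixes \<sigma> \<Gamma>
  assumes entry: "(\<sigma>, \<Gamma>) \<in> llg_lexicon G" "regular \<sigma>"
begin

lemma entry_judgement: "is_judgement G (\<sigma>, \<Gamma>)"
  using wf entry by (auto simp: wf_llg_def)

lemma entry_formulas: "(A, us) \<in># mset (standard_slots 0 \<Gamma>) \<Longrightarrow> tensor_free A \<and> set_formula A \<subseteq> llg_literals G"
proof -
  assume "(A, us) \<in># mset (standard_slots 0 \<Gamma>)"
  then have "A \<in> set (map fst (standard_slots 0 \<Gamma>))" by (metis fst_conv image_eqI list.set_map set_mset_mset)
  then have "A \<in> set \<Gamma>" by simp
  then show ?thesis using entry_judgement tensor_free entry by (auto simp: is_judgement_def tensor_free_lexicon_def)
qed

lemma derivable_entry: "derivable (entry_slots \<Gamma>) (edges \<sigma>)"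
proof -
  have "derivable (mset (standard_slots 0 \<Gamma>) + {#}) (edges \<sigma>)"
    using derivable_lexicon[OF entry entry_judgement] by simp
  then have "derivable (entry_slots \<Gamma> + {#}) (edges \<sigma>)"
    unfolding entry_slots_def by (rule derivable_flatten_slots) (use entry_formulas in auto)
  then show ?thesis by simp
qed

lemma entry_literals: "(X, us) \<in># entry_slots \<Gamma> \<Longrightarrow> X \<in> literals"
  unfolding entry_slots_def literals_def by (erule flatten_slots_literal) (erule entry_formulas)

lemma entry_labels: "(i, w, j) \<in> edges \<sigma> \<Longrightarrow> w \<in> lists (llg_terminals G)"
  using entry_judgement by (auto simp: is_judgement_def is_multiword_def is_regular_multiword_def)

end

lemma label_count_Term: "label_count (Var x) (relabel (map Term) (E :: 't edge set)) = 0"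
proof -
  have "count_list (map Term w) (Var x) = 0" for w :: "'t list" by (simp add: count_list_0_iff image_iff)
  then show ?thesis by (auto simp: label_count_def relabel_def intro!: sum.neutral)
qed

lemma rule_vars: "set (production_vars (rule X \<pi> c \<pi>s ss)) = {prod_encode (j, m) | j m. j < length c \<and> m \<le> length (\<pi>s ! j)}"
  by (auto simp: production_vars_def less_Suc_eq_le simp del: upt_Suc)

lemma wf_rule:
  assumes entry: "(\<sigma>, \<Gamma>) \<in> llg_lexicon G" "regular \<sigma>"
    and slots: "entry_slots \<Gamma> = add_mset (X, us) (mset c)" and adm: "admissible (edges \<sigma>) X us c \<pi>s \<pi> ss"
  shows "wf_production grammar (rule X \<pi> c \<pi>s ss)"
proof -
  let ?p = "rule X \<pi> c \<pi>s ss" and ?V = "slot_vertices (mset c)" and ?S = "symbolic_edges (edges \<sigma>) c \<pi>s"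
  let ?W = "map (\<lambda>j. test_words j (length (\<pi>s ! j))) [0..<length c]"
  note d = derivable_entry[OF entry, unfolded slots]
  have wfc: "wf_slots (mset c)" and us: "length us = length (pol X)" "distinct us"
    using derivableD(1)[OF d] by (auto simp: wf_slots_add)
  have \<pi>s: "is_pattern (pol (neg (fst (c ! j)))) (\<pi>s ! j)" if "j < length c" for j using adm that by (simp add: admissible_def)
  have \<pi>: "is_pattern (pol X) \<pi>" "length ss = length \<pi>" using adm by (simp_all add: admissible_def)
  have nc: "\<not> cyc ?V ?S" and hid: "hide ?V ?S = pattern_edges \<pi> ss us" using adm by (simp_all add: admissible_def)
  have lits: "X \<in> literals" "\<And>j. j < length c \<Longrightarrow> fst (c ! j) \<in> literals"
    using entry_literals[OF entry, of X us] entry_literals[OF entry, of "fst (c ! j)" "snd (c ! j)" for j] slots by auto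
  have vars: "set (production_vars ?p) = {prod_encode (j, m) | j m. j < length c \<and> m \<le> length (\<pi>s ! j)}" by (rule rule_vars)
  have "distinct (production_vars ?p)"
  proof -
    have "distinct (concat (map (\<lambda>j. map (\<lambda>m. prod_encode (j, m)) (L j)) [0..<n]))"
      if "\<And>j. distinct (L j)" for L :: "nat \<Rightarrow> nat list" and n
      using that by (induction n) (auto simp: distinct_map inj_on_def prod_encode_eq)
    from this[of "\<lambda>j. [0..<length (\<pi>s ! j) + 1]" "length c"] show ?thesis
      by (simp add: production_vars_def comp_def del: upt_Suc)
  qed
  moreover have "set s \<subseteq> Term ` llg_terminals G \<union> Var ` set (production_vars ?p)" if "s \<in> set (args ?p)" for s
  proof (cases "s \<in> set ss")
    case True
    then obtain m where m: "m < length \<pi>" "s = ss ! m" using \<pi>(2) by (auto simp: in_set_conv_nth)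
    \<comment> \<open>An argument is the label of a path, so its symbols come from the labels of the
      symbolic edges.\<close>
    have "(us ! fst (\<pi> ! m), s, us ! snd (\<pi> ! m)) \<in> hide ?V ?S" unfolding hid mem_pattern_edges using m by blast
    then have "set s \<subseteq> (\<Union>(a, u, b) \<in> ?S. set u)"
      unfolding mem_hide by (elim conjE) (rule internal_path_labels)
    also have "\<dots> \<subseteq> Term ` llg_terminals G \<union> Var ` set (production_vars ?p)"
    proof (rule UN_least)
      fix e assume "e \<in> ?S"
      obtain a u v where e: "e = (a, u, v)" by (cases e) auto
      from \<open>e \<in> ?S\<close> consider w where "(a, w, v) \<in> edges \<sigma>" "u = map Term w"
        | j m where "j < length c" "m < length (\<pi>s ! j)" "u = test_words j (length (\<pi>s ! j)) ! m"
        unfolding symbolic_edges_def Un_iff e mem_relabel plugged_edges_def by (auto simp: mem_pattern_edges)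
      then have "set u \<subseteq> Term ` llg_terminals G \<union> Var ` set (production_vars ?p)"
      proof cases
        case 1
        then show ?thesis using entry_labels[OF entry 1(1)] by auto
      next
        case 2
        then show ?thesis unfolding vars by (auto simp: test_words_def)
      qed
      then show "(case e of (a, u, b) \<Rightarrow> set u) \<subseteq> Term ` llg_terminals G \<union> Var ` set (production_vars ?p)" by (simp add: e)
    qed
    finally show ?thesis .
  next
    case False
    then show ?thesis using that unfolding vars by auto
  qed
  \<comment> \<open>A variable with \<open>m\<close> below the pattern length labels exactly one
    plugged edge, and hiding preserves label counts. The variable of the additional component labels
    no edge; it occurs only in the last argument.\<close>
  moreover have "count_list (concat (args ?p)) (Var x) = 1" if xp: "x \<in> set (production_vars ?p)" for x
  proof -
    obtain j m where x: "x = prod_encode (j, m)" "j < length c" "m \<le> length (\<pi>s ! j)" using xp unfolding vars by blast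
    have E: "matching (slot_sources (add_mset (X, us) (mset c))) (slot_targets (add_mset (X, us) (mset c))) (relabel (map Term) (edges \<sigma>))"
      by (rule matching_relabel[OF derivableD(2)[OF d]])
    have "(\<Sum>k<length \<pi>. count_list (ss ! k) (Var x)) = label_count (Var x) (hide ?V ?S)"
      unfolding hid by (rule label_count_pattern_edges[OF \<pi>(1) us, symmetric])
    also have "\<dots> = label_count (Var x) (plugged_edges c \<pi>s ?W)"
      using plug_matching(2)[OF derivableD(1)[OF d] E plugged_edges_matching[OF wfc \<pi>s] nc[unfolded symbolic_edges_def]]
        label_count_Term unfolding symbolic_edges_def by simp
    also have "\<dots> = (\<Sum>i<length c. \<Sum>k<length (\<pi>s ! i). count_list (?W ! i ! k) (Var x))"
      by (rule label_count_plugged_edges[OF wfc \<pi>s])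
    also have "\<dots> = (\<Sum>i<length c. \<Sum>k<length (\<pi>s ! i). if i = j \<and> k = m then 1 else 0)"
      by (intro sum.cong) (auto simp: test_words_def x prod_encode_eq)
    also have "\<dots> = (\<Sum>i<length c. if i = j then (\<Sum>k<length (\<pi>s ! j). if k = m then 1 else 0) else 0)"
      by (intro sum.cong) auto
    also have "\<dots> = (if m < length (\<pi>s ! j) then 1 else 0)" using x(2) by (simp add: sum.delta)
    finally have 1: "count_list (concat ss) (Var x) = (if m < length (\<pi>s ! j) then 1 else 0)"
      using \<pi>(2) by (simp add: count_list_concat)
    have "count_list (map (\<lambda>i. Var (prod_encode (i, length (\<pi>s ! i)))) [0..<n]) (Var x :: 't symbol) =
        (if j < n \<and> m = length (\<pi>s ! j) then 1 else 0)" for n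
      by (induction n) (auto simp: x prod_encode_eq)
    then have 2: "count_list (map (\<lambda>i. Var (prod_encode (i, length (\<pi>s ! i)))) [0..<length c]) (Var x :: 't symbol) =
        (if m = length (\<pi>s ! j) then 1 else 0)" using x(2) by simp
    show ?thesis using 1 2 x(3) by simp
  qed
  moreover have "\<forall>(B, xs) \<in> set (body ?p). B \<in> mcfg_nonterminals grammar \<and> length xs = mcfg_arity grammar B"
    using lits(2) neg_literals \<pi>s by (auto simp del: upt_Suc)
  ultimately show ?thesis unfolding wf_production_def using lits(1) \<pi> by (auto simp del: rule_sel(2))
qed

text \<open>Entry, output slot, order of the other slots and patterns range over finite sets. The
  arguments \<open>ss\<close> are determined by these, since a pattern and distinct names determine
  the tuple of labels.\<close>

lemma finite_rules: "finite rules"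
proof -
  let ?Pat = "\<lambda>M. \<Union>x \<in> set_mset M. {\<pi>. is_pattern (pol (neg (fst x))) \<pi>}"
  let ?R = "\<lambda>\<sigma> X us c \<pi>s \<pi>. {rule X \<pi> c \<pi>s ss | ss. admissible (edges \<sigma>) X us c \<pi>s \<pi> ss}"
  let ?U = "\<lambda>(\<sigma>, \<Gamma>). \<Union>(X, us) \<in> set_mset (entry_slots \<Gamma>).
      \<Union>c \<in> {c. set c \<subseteq> set_mset (entry_slots \<Gamma>) \<and> length c \<le> size (entry_slots \<Gamma>)}.
      \<Union>\<pi>s \<in> {\<pi>s. set \<pi>s \<subseteq> ?Pat (entry_slots \<Gamma>) \<and> length \<pi>s \<le> size (entry_slots \<Gamma>)}.
      \<Union>\<pi> \<in> {\<pi>. is_pattern (pol X) \<pi>}. ?R \<sigma> X us c \<pi>s \<pi>"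
  let ?L = "{(\<sigma>, \<Gamma>) \<in> llg_lexicon G. regular \<sigma>}"
  have "rules \<subseteq> (\<Union>x \<in> ?L. ?U x)"
  proof
    fix p assume "p \<in> rules"
    then obtain X \<pi> c \<pi>s ss \<sigma> \<Gamma> us where p: "p = rule X \<pi> c \<pi>s ss" "(\<sigma>, \<Gamma>) \<in> llg_lexicon G" "regular \<sigma>"
      "entry_slots \<Gamma> = add_mset (X, us) (mset c)" "admissible (edges \<sigma>) X us c \<pi>s \<pi> ss"
      unfolding rules_def by blast
    have "set \<pi>s \<subseteq> ?Pat (entry_slots \<Gamma>)"
    proof
      fix \<rho> assume "\<rho> \<in> set \<pi>s"
      then obtain j where j: "j < length c" "\<rho> = \<pi>s ! j" using p(5) by (auto simp: admissible_def in_set_conv_nth)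
      then have "is_pattern (pol (neg (fst (c ! j)))) \<rho>" "c ! j \<in># entry_slots \<Gamma>" using p(4,5) by (auto simp: admissible_def)
      then show "\<rho> \<in> ?Pat (entry_slots \<Gamma>)" by blast
    qed
    moreover have "set c \<subseteq> set_mset (entry_slots \<Gamma>)" "length c \<le> size (entry_slots \<Gamma>)" "length \<pi>s \<le> size (entry_slots \<Gamma>)"
      "is_pattern (pol X) \<pi>" "(X, us) \<in># entry_slots \<Gamma>" using p(4,5) by (auto simp: admissible_def)
    moreover have "p \<in> ?R \<sigma> X us c \<pi>s \<pi>" using p by blast
    ultimately have "p \<in> ?U (\<sigma>, \<Gamma>)" unfolding split by blast
    then show "p \<in> (\<Union>x \<in> ?L. ?U x)" using p(2,3) by blast
  qed
  moreover have "finite (\<Union>x \<in> ?L. ?U x)"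
  proof (rule finite_UN_I)
    show "finite ?L" using wf by (auto simp: wf_llg_def intro: finite_subset[of _ "llg_lexicon G"])
    fix x assume x: "x \<in> ?L"
    obtain \<sigma> \<Gamma> where \<sigma>\<Gamma>: "x = (\<sigma>, \<Gamma>)" by fastforce
    have entry: "(\<sigma>, \<Gamma>) \<in> llg_lexicon G" "regular \<sigma>" using x \<sigma>\<Gamma> by auto
    have fin: "finite (?R \<sigma> X us c \<pi>s \<pi>)" if Xus: "(X, us) \<in># entry_slots \<Gamma>" for X us c \<pi>s \<pi>
    proof -
      obtain M where "entry_slots \<Gamma> = add_mset (X, us) M" using Xus by (metis mset_add)
      then have us: "length us = length (pol X)" "distinct us"
        using derivableD(1)[OF derivable_entry[OF entry]] by (auto simp: wf_slots_add)
      have "ss = ss'" if "admissible (edges \<sigma>) X us c \<pi>s \<pi> ss" "admissible (edges \<sigma>) X us c \<pi>s \<pi> ss'" for ss ss'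
        using that pattern_edges_eq_iff[of "pol X" \<pi> us ss ss'] us unfolding admissible_def by simp
      then have "\<exists>ss0. {ss. admissible (edges \<sigma>) X us c \<pi>s \<pi> ss} \<subseteq> {ss0}" by blast
      then have "finite {ss. admissible (edges \<sigma>) X us c \<pi>s \<pi> ss}" by (meson finite.emptyI finite_insert finite_subset)
      then show ?thesis by simp
    qed
    have "finite {c. set c \<subseteq> set_mset (entry_slots \<Gamma>) \<and> length c \<le> size (entry_slots \<Gamma>)}"
      by (rule finite_lists_length_le) simp
    moreover have "finite {\<pi>s. set \<pi>s \<subseteq> ?Pat (entry_slots \<Gamma>) \<and> length \<pi>s \<le> size (entry_slots \<Gamma>)}"
      by (rule finite_lists_length_le) (auto simp: finite_patterns)
    ultimately show "finite (?U x)"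
      unfolding \<sigma>\<Gamma> split using fin by (intro finite_UN_I) (auto simp: finite_patterns split: prod.splits)
  qed
  ultimately show ?thesis by (rule finite_subset)
qed

text \<open>The first components of a pattern enumerate the left end points, of which the start
  literal has exactly one. Positions count from 0 and vertices from 1, hence the map
  \<open>Suc\<close>.\<close>

lemma start_pattern_length:
  assumes "is_pattern (pol (Pos (llg_start G))) \<pi>" shows "length \<pi> = 1"
proof -
  let ?X = "llg_boundary G (llg_start G)"
  have "distinct (map fst \<pi>)" using assms by (simp add: is_pattern_def)
  then have "length \<pi> = card (fst ` set \<pi>)" by (metis distinct_card length_map list.set_map)
  also have "\<dots> = card {k. k < bsize ?X \<and> Suc k \<in> lefts ?X}"
    using assms by (auto simp: is_pattern_def pol_def nth_signs intro!: arg_cong[where f = card])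
  also have "\<dots> = card (Suc ` {k. k < bsize ?X \<and> Suc k \<in> lefts ?X})" by (simp add: card_image)
  also have "Suc ` {k. k < bsize ?X \<and> Suc k \<in> lefts ?X} = lefts ?X"
  proof
    show "lefts ?X \<subseteq> Suc ` {k. k < bsize ?X \<and> Suc k \<in> lefts ?X}"
    proof
      fix i assume i: "i \<in> lefts ?X"
      then have "1 \<le> i" "i \<le> bsize ?X" using lefts_subset[of ?X] by auto
      then show "i \<in> Suc ` {k. k < bsize ?X \<and> Suc k \<in> lefts ?X}" using i by (intro image_eqI[of _ _ "i - 1"]) auto
    qed
  qed auto
  finally show ?thesis using wf by (simp add: wf_llg_def)
qed

lemma wf_grammar: "wf_mcfg grammar"
proof -
  have fin: "finite literals" using wf by (simp add: literals_def wf_llg_def)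
  have "{nonterminal_code X \<pi> | X \<pi>. X \<in> literals \<and> is_pattern (pol X) \<pi>} =
      (\<Union>X \<in> literals. nonterminal_code X ` {\<pi>. is_pattern (pol X) \<pi>})" by auto
  then have "finite {nonterminal_code X \<pi> | X \<pi>. X \<in> literals \<and> is_pattern (pol X) \<pi>}"
    using fin finite_patterns by auto
  moreover have "wf_production grammar p" if "p \<in> rules" for p
    using that wf_rule unfolding rules_def by blast
  moreover have "wf_production grammar p" if p: "p \<in> start_rules" for p
  proof -
    obtain \<pi> where \<pi>: "p = Production [(nonterminal_code (Pos (llg_start G)) \<pi>, [0, 1])] start_code [[Var 0, Var 1]]"
      "is_pattern (pol (Pos (llg_start G))) \<pi>" using p by (auto simp: start_rules_def)
    have "Pos (llg_start G) \<in> literals" using wf by (simp add: literals_def wf_llg_def)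
    then show ?thesis using start_pattern_length[OF \<pi>(2)] \<pi>
      by (auto simp: wf_production_def production_vars_def)
  qed
  moreover have "finite start_rules" by (simp add: start_rules_def finite_patterns)
  ultimately show ?thesis
    unfolding wf_mcfg_def using wf finite_rules by (auto simp: wf_llg_def)
qed

text \<open>Both a literal and its dual get elements here: the tuples that the grammar derives, laid
  out along any of the patterns. The final \<open>[]\<close> is the additional component.\<close>

definition lit :: "bool \<Rightarrow> nat \<Rightarrow> nat list \<Rightarrow> 't edge set \<Rightarrow> bool" where
  "lit s P us E \<longleftrightarrow> (let X = if s then Pos P else Neg P in length us = length (pol X) \<and> distinct us \<and>
     (\<exists>\<pi> ws. is_pattern (pol X) \<pi> \<and> length ws = length \<pi> \<and> E = pattern_edges \<pi> ws us \<and>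
        mcfg_derivable grammar (nonterminal_code X \<pi>) (ws @ [[]])))"

sublocale semantics "llg_boundary G" lit
proof
  fix s P us and E :: "'t edge set" assume "lit s P us E"
  then show "wf_slots {#(if s then Pos P else Neg P, us)#} \<and>
      matching (sources (pol (if s then Pos P else Neg P)) us) (targets (pol (if s then Pos P else Neg P)) us) E"
    unfolding lit_def Let_def wf_slots_single using pattern_edges_matching by blast
next
  fix s P us and E :: "'t edge set" and g :: "nat \<Rightarrow> nat" assume "lit s P us E" "inj_on g (set us)"
  then show "lit s P (map g us) (rename g E)"
    unfolding lit_def Let_def using rename_pattern_edges by (fastforce simp: distinct_map)
qed

lemma holds_literal:
  assumes "X \<in> literals"
  shows "holds X us E \<longleftrightarrow> length us = length (pol X) \<and> distinct us \<and>
     (\<exists>\<pi> ws. is_pattern (pol X) \<pi> \<and> length ws = length \<pi> \<and> E = pattern_edges \<pi> ws us \<and>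
        mcfg_derivable grammar (nonterminal_code X \<pi>) (ws @ [[]]))"
  using assms unfolding literals_def by (elim UnE imageE) (simp_all add: lit_def Let_def)

lemma length_test_words [simp]: "length (test_words j k) = k"
  by (simp add: test_words_def)

text \<open>A substitution turns the symbolic plugging into the actual one. By
  \<open>hide_relabel\<close> it then also turns the arguments of the production into the words of
  the result.\<close>

lemma relabel_symbolic_edges:
  assumes "\<And>j. j < length c \<Longrightarrow> length (wss ! j) = length (\<pi>s ! j)"
    "\<And>j m. \<lbrakk>j < length c; m < length (\<pi>s ! j)\<rbrakk> \<Longrightarrow> \<theta> (prod_encode (j, m)) = wss ! j ! m"
  shows "relabel (subst_word \<theta>) (symbolic_edges E c \<pi>s) = E \<union> plugged_edges c \<pi>s wss"
proof -
  have "relabel (subst_word \<theta>) (relabel (map Term) E) = E"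
    by (simp add: relabel_def image_image case_prod_beta subst_word_Term)
  moreover have "relabel (subst_word \<theta>) (plugged_edges c \<pi>s (map (\<lambda>j. test_words j (length (\<pi>s ! j))) [0..<length c])) =
      plugged_edges c \<pi>s wss"
  proof (rule relabel_plugged_edges)
    fix j assume j: "j < length c"
    have "wss ! j = map (subst_word \<theta>) (test_words j (length (\<pi>s ! j)))"
      using assms j by (intro nth_equalityI) (auto simp: test_words_def subst_word_def)
    then show "length (map (\<lambda>j. test_words j (length (\<pi>s ! j))) [0..<length c] ! j) = length (\<pi>s ! j) \<and>
        wss ! j = map (subst_word \<theta>) (map (\<lambda>j. test_words j (length (\<pi>s ! j))) [0..<length c] ! j)" using j by simp
  qed
  ultimately show ?thesis by (simp add: symbolic_edges_def)
qed

text \<open>Each test has a pattern and a derivable tuple. The patterns select a production made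
  from this entry, the tuples give its assignment, and one application of the production derives the
  tuple of the output.\<close>

lemma valid_entry:
  assumes entry: "(\<sigma>, \<Gamma>) \<in> llg_lexicon G" "regular \<sigma>"
  shows "valid (entry_slots \<Gamma>) (edges \<sigma>)"
  unfolding valid_def
proof (intro conjI allI impI)
  note d = derivable_entry[OF entry]
  show "wf_slots (entry_slots \<Gamma>)" "matching (slot_sources (entry_slots \<Gamma>)) (slot_targets (entry_slots \<Gamma>)) (edges \<sigma>)"
    using derivableD[OF d] by auto
  fix X us M F
  assume slots: "entry_slots \<Gamma> = add_mset (X, us) M" and F: "tests M F" and nc: "\<not> cyc (slot_vertices M) (edges \<sigma> \<union> F)"
  obtain N where N: "M = image_mset (\<lambda>(A, us, F). (A, us)) N" "\<forall>(A, us, F) \<in># N. holds (neg A) (rev us) F"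
    "F = (\<Union>(A, us, F) \<in> set_mset N. F)" using F unfolding tests_def by blast
  \<comment> \<open>The tests are put into some order; \<open>rules\<close> contains a production
    for each ordering \<open>c\<close> of the slots that occurs.\<close>
  obtain l where l: "mset l = N" using ex_mset by blast
  define c where "c = map (\<lambda>(A, us, F). (A, us)) l"
  have M: "M = mset c" unfolding N(1) c_def by (simp add: l)
  have lit: "Y \<in> literals" if "(Y, vs) \<in># entry_slots \<Gamma>" for Y vs using entry_literals[OF entry that] .
  have wfc: "wf_slots (add_mset (X, us) (mset c))" using derivableD(1)[OF d] slots M by simp
  have "\<exists>\<pi> ws. is_pattern (pol (neg (fst (c ! j)))) \<pi> \<and> length ws = length \<pi> \<and>
      snd (snd (l ! j)) = pattern_edges \<pi> ws (rev (snd (c ! j))) \<and>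
      mcfg_derivable grammar (nonterminal_code (neg (fst (c ! j))) \<pi>) (ws @ [[]])" if j: "j < length c" for j
  proof -
    obtain A vs K where A: "l ! j = (A, vs, K)" by (cases "l ! j") auto
    have jl: "j < length l" using j by (simp add: c_def)
    then have "(A, vs, K) \<in># N" using A l by (metis nth_mem_mset)
    then have h: "holds (neg A) (rev vs) K" using N(2) by blast
    have cj: "c ! j = (A, vs)" using A jl by (simp add: c_def)
    have "c ! j \<in># M" using j M by simp
    then have "neg A \<in> literals" using lit[of A vs] slots cj neg_literals by simp
    then show ?thesis using h holds_literal[of "neg A" "rev vs" K] cj A by auto
  qed
  then obtain \<Pi> W where \<Pi>W: "is_pattern (pol (neg (fst (c ! j)))) (\<Pi> j)" "length (W j) = length (\<Pi> j)"
      "snd (snd (l ! j)) = pattern_edges (\<Pi> j) (W j) (rev (snd (c ! j)))"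
      "mcfg_derivable grammar (nonterminal_code (neg (fst (c ! j))) (\<Pi> j)) (W j @ [[]])" if "j < length c" for j
    by metis
  define \<pi>s where "\<pi>s = map \<Pi> [0..<length c]"
  define wss where "wss = map W [0..<length c]"
  \<comment> \<open>The index just beyond \<open>W j\<close> hits the appended empty word, the value
    of the additional component.\<close>
  define \<theta> where "\<theta> x = (case prod_decode x of (j, m) \<Rightarrow> (W j @ [[]]) ! m)" for x
  have nth: "\<pi>s ! j = \<Pi> j" "wss ! j = W j" if "j < length c" for j using that by (simp_all add: \<pi>s_def wss_def)
  have F': "F = plugged_edges c \<pi>s wss"
  proof -
    have "F = (\<Union>x \<in> set l. snd (snd x))" unfolding N(3) l[symmetric] by (auto simp: case_prod_beta)
    also have "\<dots> = (\<Union>j<length c. snd (snd (l ! j)))" by (auto simp: set_conv_nth c_def)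
    also have "\<dots> = plugged_edges c \<pi>s wss"
      unfolding plugged_edges_def using \<Pi>W(3) nth by (intro SUP_cong) auto
    finally show ?thesis .
  qed
  have \<theta>: "\<theta> (prod_encode (j, m)) = (W j @ [[]]) ! m" for j m by (simp add: \<theta>_def)
  let ?S = "symbolic_edges (edges \<sigma>) c \<pi>s" and ?V = "slot_vertices (mset c)"
  have rel: "relabel (subst_word \<theta>) ?S = edges \<sigma> \<union> F"
    unfolding F' using \<Pi>W(2) nth \<theta> by (intro relabel_symbolic_edges) (auto simp: nth_append)
  \<comment> \<open>Labels do not influence cycles, so acyclicity of the actual plugging makes the
    symbolic one admissible.\<close>
  have ncS: "\<not> cyc ?V ?S" using nc cyc_relabel[of "subst_word \<theta>", OF subst_word_append, of ?V ?S] rel M by simp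
  have pats: "is_pattern (pol (neg (fst (c ! j)))) (\<pi>s ! j)" if "j < length c" for j using \<Pi>W(1)[OF that] nth[OF that] by simp
  have "matching (sources (pol X) us) (targets (pol X) us) (hide ?V ?S)"
    unfolding symbolic_edges_def
  proof (rule plug_matching(1)[OF wfc])
    show "matching (slot_sources (add_mset (X, us) (mset c))) (slot_targets (add_mset (X, us) (mset c))) (relabel (map Term) (edges \<sigma>))"
      using matching_relabel[OF derivableD(2)[OF d]] slots M by simp
    show "matching (slot_targets (mset c)) (slot_sources (mset c))
        (plugged_edges c \<pi>s (map (\<lambda>j. test_words j (length (\<pi>s ! j))) [0..<length c]))"
      using wfc pats by (intro plugged_edges_matching) (auto simp: wf_slots_add)
  qed (use ncS in \<open>simp add: symbolic_edges_def\<close>)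
  moreover have us: "length us = length (pol X)" "distinct us" using wfc by (auto simp: wf_slots_add)
  ultimately obtain \<pi> ss where \<pi>: "is_pattern (pol X) \<pi>" "length ss = length \<pi>" "hide ?V ?S = pattern_edges \<pi> ss us"
    using matching_pattern[of "pol X" us "hide ?V ?S"] by blast
  have "admissible (edges \<sigma>) X us c \<pi>s \<pi> ss"
    unfolding admissible_def using pats \<pi> ncS by (simp add: \<pi>s_def)
  then have "rule X \<pi> c \<pi>s ss \<in> rules" unfolding rules_def using entry slots M by blast
  then have p: "rule X \<pi> c \<pi>s ss \<in> mcfg_productions grammar" by simp
  have "\<forall>(B, xs) \<in> set (body (rule X \<pi> c \<pi>s ss)). mcfg_derivable grammar B (map \<theta> xs)"
  proof -
    have "map \<theta> (map (\<lambda>m. prod_encode (j, m)) [0..<length (\<Pi> j) + 1]) = W j @ [[]]" if "j < length c" for j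
      using \<Pi>W(2)[OF that] \<theta> by (intro nth_equalityI) (auto simp del: upt_Suc)
    then show ?thesis using \<Pi>W(4) nth by (auto simp del: upt_Suc map_map)
  qed
  from mcfg_derivable.intros[OF p this]
  have "mcfg_derivable grammar (nonterminal_code X \<pi>) (map (subst_word \<theta>) ss @
      [subst_word \<theta> (map (\<lambda>j. Var (prod_encode (j, length (\<pi>s ! j)))) [0..<length c])])" by simp
  moreover have "subst_word \<theta> (map (\<lambda>j. Var (prod_encode (j, length (\<pi>s ! j)))) [0..<length c]) = []"
    using \<theta> nth \<Pi>W(2) by (auto simp: subst_word_def nth_append)
  moreover have "hide (slot_vertices M) (edges \<sigma> \<union> F) = pattern_edges \<pi> (map (subst_word \<theta>) ss) us"
    using hide_relabel[of "subst_word \<theta>", OF subst_word_append, of ?V ?S] rel M \<pi> relabel_pattern_edges[OF \<pi>(2), of "subst_word \<theta>" us]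
    by simp
  ultimately show "holds X us (hide (slot_vertices M) (edges \<sigma> \<union> F))"
    using lit[of X us] slots us \<pi> by (auto simp: holds_literal intro!: exI[of _ \<pi>] exI[of _ "map (subst_word \<theta>) ss"])
qed

text \<open>The induction has to carry along that the additional component is empty; otherwise the
  start rule, which appends it, would change the word. The start symbol needs a claim of its own, as
  it codes no literal.\<close>

lemma mcfg_derivable_derivable:
  assumes "mcfg_derivable grammar n ts"
  shows "(\<forall>X \<pi>. n = nonterminal_code X \<pi> \<longrightarrow> (\<exists>ws. ts = ws @ [[]] \<and> length ws = length \<pi> \<and>
      (\<forall>us. length us = length (pol X) \<longrightarrow> distinct us \<longrightarrow> derivable {#(X, us)#} (pattern_edges \<pi> ws us)))) \<and>
    (n = start_code \<longrightarrow> (\<exists>\<pi> w. ts = [w] \<and> is_pattern (pol (Pos (llg_start G))) \<pi> \<and>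
      (\<forall>us. length us = length (pol (Pos (llg_start G))) \<longrightarrow> distinct us \<longrightarrow>
        derivable {#(Pos (llg_start G), us)#} (pattern_edges \<pi> [w] us))))"
  using assms
proof (induction rule: mcfg_derivable.induct)
  case (1 p \<theta>)
  have "p \<in> rules \<or> p \<in> start_rules" using 1(1) by simp
  then show ?case
  proof
    assume "p \<in> start_rules"
    then obtain \<pi> where p: "p = Production [(nonterminal_code (Pos (llg_start G)) \<pi>, [0, 1])] start_code [[Var 0, Var 1]]"
      "is_pattern (pol (Pos (llg_start G))) \<pi>" by (auto simp: start_rules_def)
    then have "\<exists>ws. [\<theta> 0, \<theta> 1] = ws @ [[]] \<and> length ws = length \<pi> \<and>
      (\<forall>us. length us = length (pol (Pos (llg_start G))) \<longrightarrow> distinct us \<longrightarrow> derivable {#(Pos (llg_start G), us)#} (pattern_edges \<pi> ws us))"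
      using 1(2) by auto
    then obtain ws where ws: "[\<theta> 0, \<theta> 1] = ws @ [[]]"
      "\<forall>us. length us = length (pol (Pos (llg_start G))) \<longrightarrow> distinct us \<longrightarrow> derivable {#(Pos (llg_start G), us)#} (pattern_edges \<pi> ws us)"
      by blast
    then have "ws = [\<theta> 0]" "\<theta> 1 = []" by (auto simp: Cons_eq_append_conv)
    then show ?thesis using ws p by (auto simp: subst_word_def intro!: exI[of _ \<pi>])
  next
    assume "p \<in> rules"
    then obtain X \<pi> c \<pi>s ss \<sigma> \<Gamma> us where p: "p = rule X \<pi> c \<pi>s ss" and entry: "(\<sigma>, \<Gamma>) \<in> llg_lexicon G" "regular \<sigma>"
      and slots: "entry_slots \<Gamma> = add_mset (X, us) (mset c)" and adm: "admissible (edges \<sigma>) X us c \<pi>s \<pi> ss"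
      unfolding rules_def by blast
    note d = derivable_entry[OF entry, unfolded slots]
    have wfc: "wf_slots (mset c)" and us: "length us = length (pol X)" "distinct us"
      using derivableD(1)[OF d] by (auto simp: wf_slots_add)
    have \<pi>: "is_pattern (pol X) \<pi>" "length ss = length \<pi>" using adm by (simp_all add: admissible_def)
    have "\<exists>ws. map \<theta> (map (\<lambda>m. prod_encode (j, m)) [0..<length (\<pi>s ! j) + 1]) = ws @ [[]] \<and> length ws = length (\<pi>s ! j) \<and>
        derivable {#(neg (fst (c ! j)), rev (snd (c ! j)))#} (pattern_edges (\<pi>s ! j) ws (rev (snd (c ! j))))" if j: "j < length c" for j
    proof -
      have "(nonterminal_code (neg (fst (c ! j))) (\<pi>s ! j), map (\<lambda>m. prod_encode (j, m)) [0..<length (\<pi>s ! j) + 1]) \<in> set (body p)"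
        using j by (simp add: p del: upt_Suc)
      note bspec[OF 1(2) this, unfolded prod.case, THEN conjunct2, THEN conjunct1, THEN spec, THEN spec, THEN mp, OF refl]
      then obtain ws where "map \<theta> (map (\<lambda>m. prod_encode (j, m)) [0..<length (\<pi>s ! j) + 1]) = ws @ [[]]" "length ws = length (\<pi>s ! j)"
        "\<forall>us. length us = length (pol (neg (fst (c ! j)))) \<longrightarrow> distinct us \<longrightarrow> derivable {#(neg (fst (c ! j)), us)#} (pattern_edges (\<pi>s ! j) ws us)"
        by blast
      moreover have "length (rev (snd (c ! j))) = length (pol (neg (fst (c ! j))))" "distinct (rev (snd (c ! j)))"
        using slot_nth[OF wfc j] length_pol_neg[of "fst (c ! j)"] by auto
      ultimately show ?thesis by blast
    qed
    then obtain W where W: "map \<theta> (map (\<lambda>m. prod_encode (j, m)) [0..<length (\<pi>s ! j) + 1]) = W j @ [[]]" "length (W j) = length (\<pi>s ! j)"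
      "derivable {#(neg (fst (c ! j)), rev (snd (c ! j)))#} (pattern_edges (\<pi>s ! j) (W j) (rev (snd (c ! j))))" if "j < length c" for j
      by metis
    define wss where "wss = map W [0..<length c]"
    have \<theta>: "\<theta> (prod_encode (j, m)) = (W j @ [[]]) ! m" if "j < length c" "m \<le> length (\<pi>s ! j)" for j m
    proof -
      have "\<theta> (prod_encode (j, m)) = map \<theta> (map (\<lambda>m. prod_encode (j, m)) [0..<length (\<pi>s ! j) + 1]) ! m"
        using that by (simp del: upt_Suc)
      then show ?thesis using W(1)[OF that(1)] by simp
    qed
    let ?slot = "\<lambda>j. (fst (c ! j), snd (c ! j), pattern_edges (\<pi>s ! j) (W j) (rev (snd (c ! j))))"
    let ?N = "mset (map ?slot [0..<length c])"
    let ?S = "symbolic_edges (edges \<sigma>) c \<pi>s" and ?V = "slot_vertices (mset c)" and ?F = "plugged_edges c \<pi>s wss"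
    have rel: "relabel (subst_word \<theta>) ?S = edges \<sigma> \<union> ?F"
      using W(2) \<theta> by (intro relabel_symbolic_edges) (auto simp: wss_def nth_append)
    have img: "image_mset (\<lambda>(A, us, F). (A, us)) ?N = mset c"
    proof -
      have "image_mset (\<lambda>(A, us, F). (A, us)) ?N = mset (map (\<lambda>j. c ! j) [0..<length c])"
        unfolding mset_map multiset.map_comp by (intro image_mset_cong) simp
      then show ?thesis by (simp add: map_nth)
    qed
    have FN: "(\<Union>(A, us, F) \<in> set_mset ?N. F) = ?F" by (auto simp: plugged_edges_def wss_def)
    have "\<not> cyc ?V (edges \<sigma> \<union> ?F)"
      using adm cyc_relabel[of "subst_word \<theta>", OF subst_word_append, of ?V ?S] rel by (simp add: admissible_def)
    moreover have "derivable {#(neg A, rev us)#} F" if "(A, us, F) \<in># ?N" for A us F using that W(3) by auto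
    ultimately have "derivable {#(X, us)#} (hide ?V (edges \<sigma> \<union> ?F))"
      using derivable_plug[of X us ?N "edges \<sigma>"] d unfolding img FN by blast
    moreover have "hide ?V (edges \<sigma> \<union> ?F) = pattern_edges \<pi> (map (subst_word \<theta>) ss) us"
      using hide_relabel[of "subst_word \<theta>", OF subst_word_append, of ?V ?S] rel adm relabel_pattern_edges[OF \<pi>(2), of "subst_word \<theta>" us]
      by (simp add: admissible_def)
    ultimately have dX: "derivable {#(X, us)#} (pattern_edges \<pi> (map (subst_word \<theta>) ss) us)" by simp
    have "derivable {#(X, vs)#} (pattern_edges \<pi> (map (subst_word \<theta>) ss) vs)" if vs: "length vs = length (pol X)" "distinct vs" for vs
    proof -
      obtain g where g: "map g us = vs" "inj_on g (set us)" using distinct_map_exists[of us vs] us vs by auto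
      show ?thesis using derivable_rename[OF dX, of g] g rename_pattern_edges[OF \<pi>(1) us(1), of g "map (subst_word \<theta>) ss"] by simp
    qed
    moreover have "subst_word \<theta> (map (\<lambda>j. Var (prod_encode (j, length (\<pi>s ! j)))) [0..<length c]) = []"
      using \<theta> W(2) by (auto simp: subst_word_def nth_append)
    ultimately show ?thesis using \<pi>(2) by (auto simp: p)
  qed
qed

text \<open>By definition \<open>mcfg_language\<close> contains only words over the terminals; for a
  word of the linear logic grammar the assumption provides this.\<close>

theorem grammar_language:
  assumes "llg_language G \<subseteq> lists (llg_terminals G)"
  shows "mcfg_language grammar = llg_language G"
proof
  let ?S = "Pos (llg_start G)"
  show "mcfg_language grammar \<subseteq> llg_language G"
  proof
    fix w assume "w \<in> mcfg_language grammar"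
    then have "mcfg_derivable grammar start_code [w]" by (simp add: mcfg_language_def)
    then obtain \<pi> where \<pi>: "is_pattern (pol ?S) \<pi>" "derivable {#(?S, block 0 (fsize ?S))#} (pattern_edges \<pi> [w] (block 0 (fsize ?S)))"
      using mcfg_derivable_derivable[of start_code "[w]"] by force
    let ?us = "block 0 (fsize ?S)"
    have "pattern_edges \<pi> [w] ?us = {(?us ! fst (\<pi> ! 0), w, ?us ! snd (\<pi> ! 0))}"
      using start_pattern_length[OF \<pi>(1)] by (simp add: pattern_edges_def lessThan_Suc)
    then obtain g i j where "llg_derivable G (Multiword (rename g {(i, w, j)}) {#}) [?S]"
      using derivable_single[OF \<pi>(2)] by metis
    then show "w \<in> llg_language G"
      by (auto simp: llg_language_def regular_def rename_def intro!: exI[of _ "Multiword {(g i, w, g j)} {#}"])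
  qed
  show "llg_language G \<subseteq> mcfg_language grammar"
  proof
    fix w assume w: "w \<in> llg_language G"
    then obtain \<sigma> i j where \<sigma>: "llg_derivable G \<sigma> [?S]" "regular \<sigma>" "edges \<sigma> = {(i, w, j)}"
      by (auto simp: llg_language_def)
    have "valid (mset (standard_slots 0 [?S])) (edges \<sigma>)"
    proof (rule adequacy[OF refl _ \<sigma>(1,2)])
      fix \<sigma> \<Gamma> assume entry: "(\<sigma>, \<Gamma>) \<in> llg_lexicon G" "regular \<sigma>"
      have "valid (flatten_slots (mset (standard_slots 0 \<Gamma>)) + {#}) (edges \<sigma>)"
        using valid_entry[OF entry] by (simp add: entry_slots_def)
      then have "valid (mset (standard_slots 0 \<Gamma>) + {#}) (edges \<sigma>)"
      proof (rule valid_flatten_slots)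
        show "length us = fsize A" if "(A, us) \<in># mset (standard_slots 0 \<Gamma>)" for A us
          using wf_standard_slots[of 0 \<Gamma>] that unfolding wf_slots_def by fastforce
      qed
      then show "valid (mset (standard_slots 0 \<Gamma>)) (edges \<sigma>)" by simp
    qed
    then have "holds ?S (block 0 (fsize ?S)) (edges \<sigma>)"
      using valid_holds[of ?S _ "{#}" "edges \<sigma>" "{}"] by simp
    moreover have S: "?S \<in> literals" using wf by (simp add: literals_def wf_llg_def)
    ultimately obtain \<pi> ws us where \<pi>: "is_pattern (pol ?S) \<pi>" "length ws = length \<pi>" "edges \<sigma> = pattern_edges \<pi> ws us"
      "mcfg_derivable grammar (nonterminal_code ?S \<pi>) (ws @ [[]])" unfolding holds_literal[OF S] by blast
    have "length ws = 1" using start_pattern_length[OF \<pi>(1)] \<pi>(2) by simp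
    moreover have "edges \<sigma> = {(us ! fst (\<pi> ! 0), ws ! 0, us ! snd (\<pi> ! 0))}"
      unfolding \<pi>(3) pattern_edges_def start_pattern_length[OF \<pi>(1)] by (simp add: lessThan_Suc)
    ultimately have "ws = [w]" using \<sigma>(3) by (cases ws) auto
    define p :: "(nat, 't) production" where "p = Production [(nonterminal_code ?S \<pi>, [0, 1])] start_code [[Var 0, Var 1]]"
    have "p \<in> mcfg_productions grammar" using \<pi>(1) by (auto simp: p_def start_rules_def)
    \<comment> \<open>Variable 1 stands for the additional component, so it receives the empty
      word.\<close>
    moreover have "\<forall>(B, xs) \<in> set (body p). mcfg_derivable grammar B (map (\<lambda>x. if x = 0 then w else []) xs)"
      using \<pi>(4) \<open>ws = [w]\<close> by (simp add: p_def)
    ultimately have "mcfg_derivable grammar (head p) (map (subst_word (\<lambda>x. if x = 0 then w else [])) (args p))"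
      by (rule mcfg_derivable.intros)
    then show "w \<in> mcfg_language grammar"
      using w assms by (auto simp: p_def mcfg_language_def subst_word_def)
  qed
qed

end

theorem mainTheorem1:
  fixes T :: "'t set" and L :: "'t list set"
  assumes "finite T" and "L \<subseteq> lists T"
  shows "(\<exists>G :: (nat, 't) mcfg. wf_mcfg G \<and> mcfg_terminals G = T \<and> L = mcfg_language G) \<longleftrightarrow>
    (\<exists>G' :: (nat, 't) llg. wf_llg G' \<and> llg_terminals G' = T \<and> tensor_free_lexicon G' \<and>
       L = llg_language G')"
proof
  assume "\<exists>G :: (nat, 't) mcfg. wf_mcfg G \<and> mcfg_terminals G = T \<and> L = mcfg_language G"
  then obtain G :: "(nat, 't) mcfg" where G: "wf_mcfg G" "mcfg_terminals G = T" "L = mcfg_language G" by blast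
  interpret mcfg_encoding G by unfold_locales (rule G(1))
  have "llg_terminals grammar = T" using G(2) by (simp add: grammar_def)
  then show "\<exists>G' :: (nat, 't) llg. wf_llg G' \<and> llg_terminals G' = T \<and> tensor_free_lexicon G' \<and> L = llg_language G'"
    using wf_grammar tensor_free_grammar grammar_language G(3) by blast
next
  assume "\<exists>G' :: (nat, 't) llg. wf_llg G' \<and> llg_terminals G' = T \<and> tensor_free_lexicon G' \<and> L = llg_language G'"
  then obtain G' :: "(nat, 't) llg" where G': "wf_llg G'" "llg_terminals G' = T" "tensor_free_lexicon G'" "L = llg_language G'"
    by blast
  interpret llg_encoding G' by unfold_locales (rule G'(1) G'(3))+
  have "mcfg_language grammar = L" using grammar_language assms(2) G' by simp
  then show "\<exists>G :: (nat, 't) mcfg. wf_mcfg G \<and> mcfg_terminals G = T \<and> L = mcfg_language G"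
    using wf_grammar G'(2) grammar_sel(3) by metis
qed

end
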